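(* Let $S_2:\mathbb{R}^d\to\mathbb{R}$ be a function. Then there exists a stationary random measurable set $X$ in $\mathbb{R}^d$ such that $S_2(y)=\gamma^s_X(y)$ for all $y\in\mathbb{R}^d$ and ${\operatorname{Per}}^s(X)<\infty$ if and only if $S_2$ is admissible and Lipschitz at $0$ along the $d$ canonical directions, i.e. $\operatorname{Lip}_j(S_2,0)<\infty$ for every $j\in\{1,\dots,d\}$.
   Context: Let $\mathcal{L}^d$ be Lebesgue measure and $\mathcal{M}$ the set of Lebesgue measurable subsets of $\mathbb{R}^d$, two sets being identified when their symmetric difference is Lebesgue-null, endowed with the topology of local convergence in measure ($A_n\to A$ iff $\mathcal{L}^d((A_n\Delta A)\cap U)\to0$ for every bounded open $U$, i.e. $L^1_{loc}$ convergence of indicators) and its Borel $\sigma$-algebra. A random measurable set (RAMS) is a random variable with values in $\mathcal{M}$; it is stationary if its law is invariant under translations of $\mathbb{R}^d$. Let $\mathcal{W}$ be the set of bounded open sets $W\subset\mathbb{R}^d$ with $\mathcal{L}^d(\partial W)=0$. For $A\in\mathcal{M}$, $y\in\mathbb{R}^d$, $W\in\mathcal{W}$, put $\delta_{y;W}(A)=\mathcal{L}^d(A\cap(y+A)\cap W)$. For a stationary RAMS $X$, its specific covariogram is $\gamma^s_X(y)=\mathbf{E}\,\mathcal{L}^d(X\cap(y+X)\cap(0,1)^d)$. The perimeter of $A\in\mathcal{M}$ in an open set $U$ is ${\operatorname{Per}}(A;U)=\sup\{\int_U \mathbb{1}_A\operatorname{div}\varphi\,dx:\ \varphi\in C^1_c(U,\mathbb{R}^d),\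 \|\varphi(x)\|_2\le1\ \forall x\}$, and the specific perimeter of a stationary RAMS is ${\operatorname{Per}}^s(X)=\mathbf{E}\,{\operatorname{Per}}(X;(0,1)^d)$. A function $\gamma:\mathbb{R}^d\times\mathcal{W}\to\mathbb{R}$ is admissible if for all $q\ge1$, $a\in\mathbb{R}^q$, $y_1,\dots,y_q\in\mathbb{R}^d$, $W_1,\dots,W_q\in\mathcal{W}$, $c\in\mathbb{R}$: if $c+\sum_i a_i\delta_{y_i;W_i}(A)\ge0$ for all $A\in\mathcal{M}$, then $c+\sum_i a_i\gamma(y_i;W_i)\ge0$. A function $S_2:\mathbb{R}^d\to\mathbb{R}$ is admissible if $(y,W)\mapsto S_2(y)\mathcal{L}^d(W)$ is admissible. With $(e_1,\dots,e_d)$ the canonical basis, $\operatorname{Lip}_j(F,y)=\sup_{t\ne0}|F(y+te_j)-F(y)|/|t|$. *)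

theory Defs
  imports "HOL-Analysis.Analysis" "HOL-Probability.Probability"
begin

definition transl :: "'a::euclidean_space \<Rightarrow> 'a set \<Rightarrow> 'a set" where
  "transl y A = (\<lambda>x. y + x) ` A"

definition loc_conv :: "(nat \<Rightarrow> 'a::euclidean_space set) \<Rightarrow> 'a set \<Rightarrow> bool" where
  "loc_conv S A \<longleftrightarrow> (\<forall>U. open U \<and> bounded U \<longrightarrow>
      ((\<lambda>n. measure lebesgue (((S n - A) \<union> (A - S n)) \<inter> U)) \<longlonglongrightarrow> 0))"

text \<open>Open sets of the topology of local convergence in measure on the Lebesgue measurable
  sets (the sequential topology of this convergence; it is metrizable, so this is the topology).
  Open sets are automatically saturated w.r.t. a.e. equality, so the Borel sigma-algebra below
  is that of the quotient space M.\<close>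
definition rams_open :: "'a::euclidean_space set set \<Rightarrow> bool" where
  "rams_open \<U> \<longleftrightarrow> \<U> \<subseteq> sets lebesgue \<and>
     (\<forall>A S. A \<in> \<U> \<and> (\<forall>n. S n \<in> sets lebesgue) \<and> loc_conv S A
        \<longrightarrow> eventually (\<lambda>n. S n \<in> \<U>) sequentially)"

definition rams_space :: "'a::euclidean_space set measure" where
  "rams_space = sigma (sets lebesgue) {\<U>. rams_open \<U>}"

definition stationary_rams :: "'w measure \<Rightarrow> ('w \<Rightarrow> 'a::euclidean_space set) \<Rightarrow> bool" where
  "stationary_rams M X \<longleftrightarrow> prob_space M \<and> X \<in> M \<rightarrow>\<^sub>M rams_space \<and>
     (\<forall>y. distr M rams_space (\<lambda>\<omega>. transl y (X \<omega>)) = distr M rams_space X)"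

definition spec_cov :: "'w measure \<Rightarrow> ('w \<Rightarrow> 'a::euclidean_space set) \<Rightarrow> 'a \<Rightarrow> real" where
  "spec_cov M X y = (\<integral>\<omega>. measure lebesgue (X \<omega> \<inter> transl y (X \<omega>) \<inter> box 0 One) \<partial>M)"

definition divergence :: "('a::euclidean_space \<Rightarrow> 'a) \<Rightarrow> 'a \<Rightarrow> real" where
  "divergence \<phi> x = (\<Sum>i\<in>Basis. frechet_derivative \<phi> (at x) i \<bullet> i)"

definition C1c_unit :: "'a::euclidean_space set \<Rightarrow> ('a \<Rightarrow> 'a) set" where
  "C1c_unit U = {\<phi>. (\<forall>x\<in>U. \<phi> differentiable (at x)) \<and>
       (\<forall>i\<in>Basis. continuous_on U (\<lambda>x. frechet_derivative \<phi> (at x) i)) \<and>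
       (\<exists>K. compact K \<and> K \<subseteq> U \<and> (\<forall>x. x \<notin> K \<longrightarrow> \<phi> x = 0)) \<and>
       (\<forall>x. norm (\<phi> x) \<le> 1)}"

definition Per :: "'a::euclidean_space set \<Rightarrow> 'a set \<Rightarrow> ennreal" where
  "Per A U = (SUP \<phi>\<in>C1c_unit U.
      ennreal (\<integral>x. indicator (A \<inter> U) x * divergence \<phi> x \<partial>lebesgue))"

definition spec_per :: "'w measure \<Rightarrow> ('w \<Rightarrow> 'a::euclidean_space set) \<Rightarrow> ennreal" where
  "spec_per M X = (\<integral>\<^sup>+\<omega>. Per (X \<omega>) (box 0 One) \<partial>M)"

definition Wsets :: "'a::euclidean_space set set" where
  "Wsets = {W. open W \<and> bounded W \<and> frontier W \<in> null_sets lebesgue}"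

definition delta :: "'a::euclidean_space \<Rightarrow> 'a set \<Rightarrow> 'a set \<Rightarrow> real" where
  "delta y W A = measure lebesgue (A \<inter> transl y A \<inter> W)"

definition admissible :: "('a::euclidean_space \<Rightarrow> 'a set \<Rightarrow> real) \<Rightarrow> bool" where
  "admissible \<gamma> \<longleftrightarrow> (\<forall>(q::nat) (a::nat \<Rightarrow> real) (y::nat \<Rightarrow> 'a) (W::nat \<Rightarrow> 'a set) (c::real).
     q \<ge> 1 \<and> (\<forall>i<q. W i \<in> Wsets) \<and>
     (\<forall>A\<in>sets lebesgue. c + (\<Sum>i<q. a i * delta (y i) (W i) A) \<ge> 0)
     \<longrightarrow> c + (\<Sum>i<q. a i * \<gamma> (y i) (W i)) \<ge> 0)"

definition admissible_S2 :: "('a::euclidean_space \<Rightarrow> real) \<Rightarrow> bool" where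
  "admissible_S2 S2 \<longleftrightarrow> admissible (\<lambda>y W. S2 y * measure lebesgue W)"

definition Lip_dir :: "('a::euclidean_space \<Rightarrow> real) \<Rightarrow> 'a \<Rightarrow> 'a \<Rightarrow> ereal" where
  "Lip_dir F y j = (SUP t\<in>-{0::real}. ereal (\<bar>F (y + t *\<^sub>R j) - F y\<bar> / \<bar>t\<bar>))"

end

theory Submission
  imports Defs
begin

text \<open>Necessity. For fixed \<open>y\<close> the measure \<open>B \<mapsto> E \<L>(X \<inter> (y + X) \<inter> B)\<close> is translation invariant, hence
  a multiple of Lebesgue measure, so admissibility follows by taking expectations; the perimeter
  dominates the difference quotients of the covariogram.

  Sufficiency. Testing admissibility on unions of small cubes and separating a point from the convex
  hull of finitely many configurations gives, for every \<open>n\<close>, a random subset of a large cube of the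
  lattice \<open>2\<^sup>-\<^sup>n \<int>\<^sup>d\<close> whose pair probabilities are nearly \<open>S\<^sub>2\<close>. Shifting it uniformly makes it nearly
  stationary, and a weak limit in the compact space of subsets of the dyadic points yields a
  stationary field \<open>\<xi>\<close> on the dyadic points with \<open>P(z, z' \<in> \<xi>) = S\<^sub>2(z - z')\<close>. Admissibility makes \<open>S\<^sub>2\<close>
  globally Lipschitz, so \<open>P(z \<in> \<xi>, z' \<notin> \<xi>) = O(\<parallel>z - z'\<parallel>)\<close>; the field therefore extends along
  dyadic roundings to a jointly measurable field on the whole space, and no tightness argument in
  the space of measurable sets is needed. The Lipschitz bound also gives finite specific perimeter, by
  Fatou's lemma applied to difference quotients of the indicator function.\<close>

section \<open>Translations and local convergence in measure\<close>

text \<open>Membership of a single point has no meaning in the space of measurable sets modulo null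
  sets, whereas \<open>S2 (z - z')\<close> should become a pair probability of points. The bridge is
  averaging: for measurable \<open>A\<close>, a small cube \<open>W0\<close> and \<open>u\<close> in
  \<open>W0\<close>, the lattice points \<open>z\<close> with \<open>z + u \<in> A\<close> form a
  configuration, and integrating over \<open>u\<close> turns its pair counts into values of
  \<open>delta\<close> on the windows \<open>z + W0\<close>. A linear inequality valid for all
  configurations is thereby one to which admissibility applies. The way back rests on one identity:
  once \<open>S2\<close> gives pair probabilities, two points disagree with probability
  \<open>2 * (S2 0 - S2 (z - z'))\<close>. The Lipschitz bound makes this summable along dyadic
  roundings, so the field on countably many points determines a set. Mesh \<open>2^-n\<close> and
  side length \<open>2^n\<close> are coupled so that the relative boundary loss for a fixed shift is
  of order \<open>2^-n\<close> and vanishes in the limit.\<close>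

lemma transl_iff: "x \<in> transl y A \<longleftrightarrow> x - y \<in> A"
  by (auto simp: transl_def intro: image_eqI[where x="x - y"])

lemma transl_lebesgue [measurable (raw)]: "A \<in> sets lebesgue \<Longrightarrow> transl y A \<in> sets lebesgue"
  unfolding transl_def by (rule lebesgue_sets_translation)

lemma transl_vimage: "transl y A = (\<lambda>x. x - y) -` A"
  by (auto simp: transl_iff)

lemma emeasure_transl: "emeasure lebesgue (transl y A) = emeasure lebesgue A"
  using emeasure_lebesgue_affine[of 1 y A] by (simp add: transl_def add.commute)

lemma measure_transl: "measure lebesgue (transl y A) = measure lebesgue A"
  by (simp add: measure_def emeasure_transl)

lemma transl_0: "transl 0 A = A"
  by (auto simp: transl_iff)

lemma transl_eq_image: "transl y A = (+) y ` A" by (simp add: transl_def)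

lemma open_transl: "open U \<Longrightarrow> open (transl y U)"
  unfolding transl_eq_image by (rule open_translation)

lemma bounded_transl: "bounded U \<Longrightarrow> bounded (transl y U)"
  unfolding transl_eq_image by (rule bounded_translation)

lemma lmeasurable_Int_bounded:
  assumes "A \<in> sets lebesgue" "bounded B" "B \<in> sets lebesgue"
  shows "A \<inter> B \<in> lmeasurable"
  using assms by (intro bounded_set_imp_lmeasurable) auto

lemma abs_measure_diff_le:
  assumes "A \<in> lmeasurable" "B \<in> lmeasurable"
  shows "\<bar>measure lebesgue A - measure lebesgue B\<bar> \<le> measure lebesgue (sym_diff A B)"
proof -
  have m: "A - B \<in> lmeasurable" "B - A \<in> lmeasurable" "sym_diff A B \<in> lmeasurable" "A \<inter> B \<in> lmeasurable"
    using assms by auto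
  have set_diff_Int: "A - B - A \<inter> B = A - B" "B - A - B \<inter> A = B - A" by auto
  have "measure lebesgue A = measure lebesgue (A \<inter> B) + measure lebesgue (A - B)"
    using measure_Un2[of "A \<inter> B" lebesgue "A - B"] m
    by (simp add: Int_Diff_Un Diff_Diff_Int set_diff_Int)
  moreover have "measure lebesgue B = measure lebesgue (A \<inter> B) + measure lebesgue (B - A)"
    using measure_Un2[of "B \<inter> A" lebesgue "B - A"] m
    by (simp add: Int_Diff_Un set_diff_Int) (simp add: Int_commute)
  moreover have "measure lebesgue (A - B) \<le> measure lebesgue (sym_diff A B)"
    "measure lebesgue (B - A) \<le> measure lebesgue (sym_diff A B)"
    using m by (auto intro!: measure_mono_fmeasurable)
  ultimately show ?thesis using measure_nonneg[of lebesgue "A-B"] measure_nonneg[of lebesgue "B-A"]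
    by linarith
qed

lemma loc_conv_transl:
  assumes "loc_conv S A"
  shows "loc_conv (\<lambda>n. transl y (S n)) (transl y A)"
  unfolding loc_conv_def
proof (intro allI impI)
  fix U :: "'a set" assume U: "open U \<and> bounded U"
  have eq: "sym_diff (transl y (S n)) (transl y A) \<inter> U = transl y (sym_diff (S n) A \<inter> transl (-y) U)" for n
    by (auto simp: transl_iff)
  have "open (transl (-y) U) \<and> bounded (transl (-y) U)"
    using U open_transl bounded_transl by blast
  then show "(\<lambda>n. measure lebesgue (sym_diff (transl y (S n)) (transl y A) \<inter> U)) \<longlonglongrightarrow> 0"
    unfolding eq measure_transl using assms unfolding loc_conv_def by blast
qed

section \<open>Borel structure of local convergence and continuous functionals\<close>

lemma space_rams [simp]: "space rams_space = sets lebesgue"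
  unfolding rams_space_def by (rule space_measure_of) (auto simp: rams_open_def)

lemma rams_openD:
  assumes "rams_open U" "A \<in> U" "\<forall>n. S n \<in> sets lebesgue" "loc_conv S A"
  shows "eventually (\<lambda>n. S n \<in> U) sequentially"
  using assms unfolding rams_open_def by blast

lemma rams_open_in_sets: "rams_open U \<Longrightarrow> U \<in> sets rams_space"
  unfolding rams_space_def by (subst sets_measure_of) (auto simp: rams_open_def)

lemma sets_rams_space: "sets rams_space = sigma_sets (sets lebesgue) {U. rams_open U}"
  unfolding rams_space_def by (subst sets_measure_of) (auto simp: rams_open_def)

text \<open>\<open>rams_open\<close> is sequential openness, so a sequentially continuous functional
  has open strict superlevel sets, and these suffice for measurability. Window volumes and Lipschitz
  functionals are both handled this way.\<close>

lemma borel_measurable_rams_spaceI: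
  fixes F :: "'a::euclidean_space set \<Rightarrow> real"
  assumes "\<And>S A. \<lbrakk>\<And>n. S n \<in> sets lebesgue; A \<in> sets lebesgue; loc_conv S A\<rbrakk> \<Longrightarrow> (\<lambda>n. F (S n)) \<longlonglongrightarrow> F A"
  shows "F \<in> borel_measurable rams_space"
proof (rule borel_measurableI_greater)
  fix c
  have "rams_open {A \<in> sets lebesgue. c < F A}"
    unfolding rams_open_def
  proof (intro conjI allI impI)
    fix A and S :: "nat \<Rightarrow> 'a set"
    assume *: "A \<in> {A \<in> sets lebesgue. c < F A} \<and> (\<forall>n. S n \<in> sets lebesgue) \<and> loc_conv S A"
    then have "(\<lambda>n. F (S n)) \<longlonglongrightarrow> F A" using assms by blast
    then have "eventually (\<lambda>n. c < F (S n)) sequentially"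
      using * by (intro order_tendstoD) auto
    then show "eventually (\<lambda>n. S n \<in> {A \<in> sets lebesgue. c < F A}) sequentially"
      by (rule eventually_mono) (use * in auto)
  qed auto
  then show "{w \<in> space rams_space. c < F w} \<in> sets rams_space"
    using rams_open_in_sets by auto
qed

lemma measurable_transl_rams:
  "transl y \<in> rams_space \<rightarrow>\<^sub>M (rams_space :: 'a::euclidean_space set measure)"
  unfolding rams_space_def
proof (rule measurable_measure_of)
  show "{\<U>. rams_open \<U>} \<subseteq> Pow (sets lebesgue)" by (auto simp: rams_open_def)
  show "transl y \<in> space (sigma (sets lebesgue) {\<U>. rams_open \<U>}) \<rightarrow> sets lebesgue"
    using space_rams transl_lebesgue unfolding rams_space_def by auto
  fix V :: "'a set set" assume V: "V \<in> {\<U>. rams_open \<U>}"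
  have "rams_open {A \<in> sets lebesgue. transl y A \<in> V}"
    unfolding rams_open_def
  proof (intro conjI allI impI)
    fix A and S :: "nat \<Rightarrow> 'a set"
    assume *: "A \<in> {A \<in> sets lebesgue. transl y A \<in> V} \<and> (\<forall>n. S n \<in> sets lebesgue) \<and> loc_conv S A"
    have "rams_open V" using V by simp
    moreover have "transl y A \<in> V \<and> (\<forall>n. transl y (S n) \<in> sets lebesgue) \<and> loc_conv (\<lambda>n. transl y (S n)) (transl y A)"
      using * transl_lebesgue loc_conv_transl by blast
    ultimately have "eventually (\<lambda>n. transl y (S n) \<in> V) sequentially"
      using rams_openD[of V "transl y A" "\<lambda>n. transl y (S n)"] by simp
    then show "eventually (\<lambda>n. S n \<in> {A \<in> sets lebesgue. transl y A \<in> V}) sequentially"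
      by (rule eventually_mono) (use * in auto)
  qed auto
  then have "{A \<in> sets lebesgue. transl y A \<in> V} \<in> sets rams_space" by (rule rams_open_in_sets)
  moreover have "transl y -` V \<inter> sets lebesgue = {A \<in> sets lebesgue. transl y A \<in> V}" by auto
  ultimately show "transl y -` V \<inter> space (sigma (sets lebesgue) {\<U>. rams_open \<U>})
      \<in> sets (sigma (sets lebesgue) {\<U>. rams_open \<U>})"
    using space_rams unfolding rams_space_def by metis
qed

lemma tendsto_measure_loc_conv:
  assumes S: "\<And>n. S n \<in> sets lebesgue" and A: "A \<in> sets lebesgue" and c: "loc_conv S A"
    and B: "B \<in> sets lebesgue" "bounded B"
  shows "(\<lambda>n. measure lebesgue (S n \<inter> transl y (S n) \<inter> B)) \<longlonglongrightarrow> measure lebesgue (A \<inter> transl y A \<inter> B)"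
proof -
  \<comment> \<open>\<open>loc_conv\<close> speaks of open windows only, so the bounded window
    \<open>B\<close> is enlarged to a ball.\<close>
  obtain r where r: "B \<subseteq> ball 0 r" using B(2) bounded_subset_ballD by blast
  let ?U = "ball 0 r :: 'a set"
  have c2: "loc_conv (\<lambda>n. transl y (S n)) (transl y A)" using c by (rule loc_conv_transl)
  have t: "(\<lambda>n. measure lebesgue (sym_diff (S n) A \<inter> ?U)
      + measure lebesgue (sym_diff (transl y (S n)) (transl y A) \<inter> ?U)) \<longlonglongrightarrow> 0 + 0"
    using c c2 unfolding loc_conv_def by (intro tendsto_add) auto
  have "norm (measure lebesgue (S n \<inter> transl y (S n) \<inter> B) - measure lebesgue (A \<inter> transl y A \<inter> B))
     \<le> measure lebesgue (sym_diff (S n) A \<inter> ?U)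
      + measure lebesgue (sym_diff (transl y (S n)) (transl y A) \<inter> ?U)" (is "_ \<le> ?a + ?b") for n
  proof -
    let ?P = "S n \<inter> transl y (S n) \<inter> B" and ?Q = "A \<inter> transl y A \<inter> B"
    have m: "?P \<in> lmeasurable" "?Q \<in> lmeasurable"
      using S A B by (auto intro!: lmeasurable_Int_bounded sets.Int transl_lebesgue)
    have m2: "sym_diff (S n) A \<inter> ?U \<in> lmeasurable"
       "sym_diff (transl y (S n)) (transl y A) \<inter> ?U \<in> lmeasurable"
      using S A by (auto intro!: lmeasurable_Int_bounded sets.Un sets.Diff transl_lebesgue)
    have "norm (measure lebesgue ?P - measure lebesgue ?Q) \<le> measure lebesgue (sym_diff ?P ?Q)"
      using abs_measure_diff_le[OF m] by simp
    also have "\<dots> \<le> measure lebesgue ((sym_diff (S n) A \<inter> ?U) \<union> (sym_diff (transl y (S n)) (transl y A) \<inter> ?U))"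
      using m m2 r by (intro measure_mono_fmeasurable) (auto simp: fmeasurableD)
    also have "\<dots> \<le> ?a + ?b"
      using m2 by (intro measure_Un_le) (auto simp: fmeasurableD)
    finally show ?thesis .
  qed
  then have "(\<lambda>n. measure lebesgue (S n \<inter> transl y (S n) \<inter> B) - measure lebesgue (A \<inter> transl y A \<inter> B)) \<longlonglongrightarrow> 0"
    by (intro Lim_null_comparison[OF always_eventually[OF allI] t[simplified]]) simp
  then show ?thesis by (simp add: LIM_zero_iff)
qed

lemma borel_measurable_delta:
  assumes "B \<in> sets lebesgue" "bounded B"
  shows "(\<lambda>A. measure lebesgue (A \<inter> transl y A \<inter> B)) \<in> borel_measurable rams_space"
  by (rule borel_measurable_rams_spaceI) (rule tendsto_measure_loc_conv, simp_all add: assms)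

section \<open>The covariogram of a stationary random set on arbitrary windows\<close>

lemma nn_integral_lborel_reflect:
  fixes f :: "'a::euclidean_space \<Rightarrow> ennreal"
  assumes [measurable]: "f \<in> borel_measurable borel"
  shows "(\<integral>\<^sup>+t. f (x - t) \<partial>lborel) = (\<integral>\<^sup>+t. f t \<partial>lborel)"
proof -
  have "(\<integral>\<^sup>+t. f t \<partial>lborel) = (\<integral>\<^sup>+t. f t \<partial>density (distr lborel borel (\<lambda>t. x + (-1) *\<^sub>R t)) (\<lambda>_. ennreal (\<bar>-1::real\<bar>^DIM('a))))"
    using lborel_affine[of "-1" x] by simp
  also have "\<dots> = (\<integral>\<^sup>+t. f (x - t) \<partial>lborel)"
    by (subst nn_integral_density) (auto simp: nn_integral_distr)
  finally show ?thesis by simp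
qed

text \<open>Integrate \<open>emeasure \<mu> (transl t B)\<close> over \<open>t\<close> in
  \<open>Q\<close>. Invariance gives the left side; Fubini and the substitution
  \<open>s = x - t\<close> exchange the roles of \<open>B\<close> and \<open>Q\<close> and give the
  right side. The cross-multiplied form stays meaningful when a factor is zero or infinite.\<close>

lemma translation_invariant_measure_unique:
  fixes \<mu> :: "'a::euclidean_space measure"
  assumes sets[measurable_cong]: "sets \<mu> = sets borel" and sf: "sigma_finite_measure \<mu>"
    and inv: "\<And>v B. B \<in> sets borel \<Longrightarrow> emeasure \<mu> (transl v B) = emeasure \<mu> B"
    and B[measurable]: "B \<in> sets borel" and Q[measurable]: "Q \<in> sets borel"
  shows "emeasure \<mu> B * emeasure lborel Q = emeasure lborel B * emeasure \<mu> Q"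
proof -
  interpret \<mu>: sigma_finite_measure \<mu> by (rule sf)
  interpret pair_sigma_finite \<mu> "lborel :: 'a measure" ..
  have tr: "transl v C \<in> sets borel" if "C \<in> sets borel" for v and C :: "'a set"
    using that measurable_sets[of "\<lambda>x. x - v" borel borel C] by (simp add: transl_vimage)
  have key: "emeasure \<mu> (transl t C) = (\<integral>\<^sup>+x. indicator C (x - t) \<partial>\<mu>)" if "C \<in> sets borel" for t C
  proof -
    have "(\<integral>\<^sup>+x. indicator C (x - t) \<partial>\<mu>) = (\<integral>\<^sup>+x. indicator (transl t C) x \<partial>\<mu>)"
      by (intro nn_integral_cong) (auto simp: indicator_def transl_iff)
    then show ?thesis using tr[OF that] by (simp add: sets)
  qed
  have r: "(\<integral>\<^sup>+t. indicator Q t * indicator B (x - t) \<partial>lborel) = (\<integral>\<^sup>+s. indicator Q (x - s) * indicator B s \<partial>lborel)" for x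
    using nn_integral_lborel_reflect[of "\<lambda>s. indicator Q (x - s) * indicator B s" x] by simp
  have "emeasure \<mu> B * emeasure lborel Q = (\<integral>\<^sup>+t. indicator Q t * emeasure \<mu> B \<partial>lborel)"
    by (simp add: nn_integral_multc mult.commute)
  also have "\<dots> = (\<integral>\<^sup>+t. indicator Q t * emeasure \<mu> (transl t B) \<partial>lborel)"
    by (simp add: inv)
  also have "\<dots> = (\<integral>\<^sup>+t. (\<integral>\<^sup>+x. indicator Q t * indicator B (x - t) \<partial>\<mu>) \<partial>lborel)"
    by (simp add: key nn_integral_cmult)
  also have "\<dots> = (\<integral>\<^sup>+x. (\<integral>\<^sup>+t. indicator Q t * indicator B (x - t) \<partial>lborel) \<partial>\<mu>)"
    by (rule Fubini') measurable
  also have "\<dots> = (\<integral>\<^sup>+x. (\<integral>\<^sup>+s. indicator Q (x - s) * indicator B s \<partial>lborel) \<partial>\<mu>)"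
    by (simp add: r)
  also have "\<dots> = (\<integral>\<^sup>+s. (\<integral>\<^sup>+x. indicator B s * indicator Q (x - s) \<partial>\<mu>) \<partial>lborel)"
    by (subst Fubini') (auto simp: mult.commute)
  also have "\<dots> = (\<integral>\<^sup>+s. indicator B s * emeasure \<mu> (transl s Q) \<partial>lborel)"
    by (simp add: key nn_integral_cmult)
  also have "\<dots> = emeasure lborel B * emeasure \<mu> Q"
    by (simp add: inv nn_integral_multc)
  finally show ?thesis .
qed

text \<open>Unbounded windows are exhausted by balls. They are needed because the mean measure
  \<open>\<mu>\<close> in \<open>spec_cov_window\<close> must be defined on all Borel sets, not only
  on bounded ones.\<close>

lemma borel_measurable_emeasure_delta:
  assumes C: "C \<in> sets borel"
  shows "(\<lambda>A. emeasure lebesgue (A \<inter> transl y A \<inter> C)) \<in> borel_measurable rams_space"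
proof -
  define g where "g n A = ennreal (measure lebesgue (A \<inter> transl y A \<inter> (C \<inter> ball 0 (real n))))" for n A
  have g: "g n \<in> borel_measurable rams_space" for n
    unfolding g_def using C
    by (intro measurable_compose[OF borel_measurable_delta measurable_ennreal]) (auto simp: bounded_Int)
  have eq: "emeasure lebesgue (A \<inter> transl y A \<inter> C) = (SUP n. g n A)" if A: "A \<in> sets lebesgue" for A
  proof -
    have l: "A \<inter> transl y A \<in> sets lebesgue" using A by (auto intro: transl_lebesgue)
    have "(SUP n. emeasure lebesgue (A \<inter> transl y A \<inter> (C \<inter> ball 0 (real n)))) = emeasure lebesgue (\<Union>n. A \<inter> transl y A \<inter> (C \<inter> ball 0 (real n)))"
      using l C by (intro SUP_emeasure_incseq) (auto simp: incseq_def)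
    also have "(\<Union>n. A \<inter> transl y A \<inter> (C \<inter> ball 0 (real n))) = A \<inter> transl y A \<inter> C"
      using reals_Archimedean2 by auto
    finally have "emeasure lebesgue (A \<inter> transl y A \<inter> C)
      = (SUP n. emeasure lebesgue (A \<inter> transl y A \<inter> (C \<inter> ball 0 (real n))))" by simp
    moreover have "emeasure lebesgue (A \<inter> transl y A \<inter> (C \<inter> ball 0 (real n))) = g n A" for n
      unfolding g_def using C l by (intro emeasure_eq_measure2 lmeasurable_Int_bounded) (auto simp: bounded_Int)
    ultimately show ?thesis by simp
  qed
  have "(\<lambda>A. SUP n. g n A) \<in> borel_measurable rams_space" using g by (rule borel_measurable_SUP[OF countableI_type])
  then show ?thesis by (subst measurable_cong[OF eq]) auto
qed

lemma integrable_window: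
  fixes X :: "'w \<Rightarrow> 'a::euclidean_space set"
  assumes M: "prob_space M" and X: "X \<in> M \<rightarrow>\<^sub>M rams_space" and B: "B \<in> sets borel" "bounded B"
  shows "integrable M (\<lambda>\<omega>. measure lebesgue (X \<omega> \<inter> transl y (X \<omega>) \<inter> B))"
proof -
  interpret prob_space M by (rule M)
  have BL: "B \<in> lmeasurable" using B by (intro bounded_set_imp_lmeasurable) auto
  have le: "measure lebesgue (X \<omega> \<inter> transl y (X \<omega>) \<inter> B) \<le> measure lebesgue B" if "\<omega> \<in> space M" for \<omega>
    by (rule measure_mono_fmeasurable[OF _ _ BL])
       (use measurable_space[OF X that] BL in \<open>auto intro!: sets.Int transl_lebesgue dest: fmeasurableD\<close>)
  show ?thesis
  proof (rule integrable_const_bound[where B="measure lebesgue B", OF AE_I2])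
    show "norm (measure lebesgue (X \<omega> \<inter> transl y (X \<omega>) \<inter> B)) \<le> measure lebesgue B" if "\<omega> \<in> space M" for \<omega>
      using le[OF that] by (simp only: real_norm_def abs_of_nonneg[OF measure_nonneg])
    show "(\<lambda>\<omega>. measure lebesgue (X \<omega> \<inter> transl y (X \<omega>) \<inter> B)) \<in> borel_measurable M"
      using B by (intro measurable_compose[OF X borel_measurable_delta]) auto
  qed
qed

lemma spec_cov_window:
  fixes X :: "'w \<Rightarrow> 'a::euclidean_space set"
  assumes st: "stationary_rams M X" and B: "B \<in> sets borel" "bounded B"
  shows "(\<integral>\<omega>. measure lebesgue (X \<omega> \<inter> transl y (X \<omega>) \<inter> B) \<partial>M) = spec_cov M X y * measure lebesgue B"
proof -
  have X[measurable]: "X \<in> M \<rightarrow>\<^sub>M rams_space" using st by (auto simp: stationary_rams_def)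
  interpret prob_space M using st by (auto simp: stationary_rams_def)
  have XL: "X \<omega> \<in> sets lebesgue" "transl y (X \<omega>) \<in> sets lebesgue" if "\<omega> \<in> space M" for \<omega>
    using measurable_space[OF X that] by (auto intro: transl_lebesgue)
  define Z where "Z \<omega> = X \<omega> \<inter> transl y (X \<omega>)" for \<omega>
  have ZL: "Z \<omega> \<in> sets lebesgue" if "\<omega> \<in> space M" for \<omega> using XL[OF that] by (auto simp: Z_def)
  have Zlm: "Z \<omega> \<inter> C \<in> lmeasurable" if "\<omega> \<in> space M" "C \<in> sets borel" "bounded C" for C \<omega>
    using ZL[OF that(1)] that by (intro lmeasurable_Int_bounded) auto
  have em: "emeasure lebesgue (Z \<omega> \<inter> C) = ennreal (measure lebesgue (Z \<omega> \<inter> C))"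
    if "\<omega> \<in> space M" "C \<in> sets borel" "bounded C" for C \<omega>
    using Zlm[OF that] by (rule emeasure_eq_measure2)
  have meas: "(\<lambda>\<omega>. emeasure lebesgue (Z \<omega> \<inter> C)) \<in> borel_measurable M" if C: "C \<in> sets borel" for C
    unfolding Z_def by (rule measurable_compose[OF X borel_measurable_emeasure_delta[OF C]])
  define \<mu> where "\<mu> = measure_of UNIV (sets borel) (\<lambda>C. \<integral>\<^sup>+\<omega>. emeasure lebesgue (Z \<omega> \<inter> C) \<partial>M)"
  have sets_\<mu>: "sets \<mu> = sets borel"
    unfolding \<mu>_def using sets.sigma_sets_eq[of "borel :: 'a measure"] by (simp add: sets_measure_of_conv)
  have em\<mu>: "emeasure \<mu> C = (\<integral>\<^sup>+\<omega>. emeasure lebesgue (Z \<omega> \<inter> C) \<partial>M)" if C: "C \<in> sets borel" for C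
    unfolding \<mu>_def
  proof (rule emeasure_measure_of_sigma)
    show "sigma_algebra UNIV (sets (borel::'a measure))"
      using sets.sigma_algebra_axioms[of "borel::'a measure"] by simp
    show "positive (sets borel) (\<lambda>C. \<integral>\<^sup>+\<omega>. emeasure lebesgue (Z \<omega> \<inter> C) \<partial>M)" by (simp add: positive_def)
    show "countably_additive (sets borel) (\<lambda>C. \<integral>\<^sup>+\<omega>. emeasure lebesgue (Z \<omega> \<inter> C) \<partial>M)"
    proof (rule countably_additiveI)
      fix A :: "nat \<Rightarrow> 'a set" assume A: "range A \<subseteq> sets borel" "disjoint_family A"
      have "(\<Sum>i. \<integral>\<^sup>+\<omega>. emeasure lebesgue (Z \<omega> \<inter> A i) \<partial>M) = (\<integral>\<^sup>+\<omega>. (\<Sum>i. emeasure lebesgue (Z \<omega> \<inter> A i)) \<partial>M)"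
        using A by (intro nn_integral_suminf[symmetric] meas) auto
      also have "\<dots> = (\<integral>\<^sup>+\<omega>. emeasure lebesgue (Z \<omega> \<inter> \<Union> (range A)) \<partial>M)"
      proof (intro nn_integral_cong)
        fix \<omega> assume w: "\<omega> \<in> space M"
        have "(\<Sum>i. emeasure lebesgue (Z \<omega> \<inter> A i)) = emeasure lebesgue (\<Union>i. Z \<omega> \<inter> A i)"
          using A ZL[OF w] by (intro suminf_emeasure) (auto simp: disjoint_family_on_def)
        then show "(\<Sum>i. emeasure lebesgue (Z \<omega> \<inter> A i)) = emeasure lebesgue (Z \<omega> \<inter> \<Union> (range A))"
          by simp
      qed
      finally show "(\<Sum>i. \<integral>\<^sup>+\<omega>. emeasure lebesgue (Z \<omega> \<inter> A i) \<partial>M) = (\<integral>\<^sup>+\<omega>. emeasure lebesgue (Z \<omega> \<inter> \<Union> (range A)) \<partial>M)" .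
    qed
  qed (rule C)
  have val: "emeasure \<mu> C = ennreal (\<integral>\<omega>. measure lebesgue (Z \<omega> \<inter> C) \<partial>M)" if C: "C \<in> sets borel" "bounded C" for C
  proof -
    have "integrable M (\<lambda>\<omega>. measure lebesgue (Z \<omega> \<inter> C))"
      unfolding Z_def by (rule integrable_window[OF prob_space_axioms X C])
    then have "ennreal (\<integral>\<omega>. measure lebesgue (Z \<omega> \<inter> C) \<partial>M) = (\<integral>\<^sup>+\<omega>. ennreal (measure lebesgue (Z \<omega> \<inter> C)) \<partial>M)"
      by (subst nn_integral_eq_integral) auto
    also have "\<dots> = (\<integral>\<^sup>+\<omega>. emeasure lebesgue (Z \<omega> \<inter> C) \<partial>M)"
      by (intro nn_integral_cong) (simp add: em C)
    finally show ?thesis by (simp add: em\<mu> C)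
  qed
  have sf: "sigma_finite_measure \<mu>"
  proof
    have "emeasure \<mu> (ball 0 (real n)) \<noteq> \<infinity>" for n by (subst val) auto
    then show "\<exists>A. countable A \<and> A \<subseteq> sets \<mu> \<and> \<Union>A = space \<mu> \<and> (\<forall>a\<in>A. emeasure \<mu> a \<noteq> \<infinity>)"
      using reals_Archimedean2 sets_eq_imp_space_eq[OF sets_\<mu>]
      by (intro exI[of _ "range (\<lambda>n. ball 0 (real n))"]) (auto simp: sets_\<mu>)
  qed
  have inv: "emeasure \<mu> (transl v C) = emeasure \<mu> C" if C: "C \<in> sets borel" for v C
  proof -
    have tC: "transl v C \<in> sets borel"
      using that measurable_sets[of "\<lambda>x. x - v" borel borel C] by (simp add: transl_vimage)
    have tX: "transl (-v) \<circ> X \<in> M \<rightarrow>\<^sub>M rams_space"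
      using measurable_comp[OF X measurable_transl_rams] .
    have *: "(\<lambda>A. emeasure lebesgue (A \<inter> transl y A \<inter> C)) \<in> borel_measurable rams_space"
      by (rule borel_measurable_emeasure_delta[OF C])
    have "emeasure \<mu> (transl v C) = (\<integral>\<^sup>+\<omega>. emeasure lebesgue (transl (-v) (X \<omega>) \<inter> transl y (transl (-v) (X \<omega>)) \<inter> C) \<partial>M)"
      unfolding em\<mu>[OF tC]
    proof (intro nn_integral_cong)
      fix \<omega>
      \<comment> \<open>Moving the window by \<open>v\<close> has the same effect as moving the set
        by \<open>- v\<close>, which leaves the law unchanged.\<close>
      have "Z \<omega> \<inter> transl v C = transl v (transl (-v) (X \<omega>) \<inter> transl y (transl (-v) (X \<omega>)) \<inter> C)"
        by (auto simp: Z_def transl_iff)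
      then show "emeasure lebesgue (Z \<omega> \<inter> transl v C) = emeasure lebesgue (transl (-v) (X \<omega>) \<inter> transl y (transl (-v) (X \<omega>)) \<inter> C)"
        by (simp add: emeasure_transl)
    qed
    also have "\<dots> = (\<integral>\<^sup>+A. emeasure lebesgue (A \<inter> transl y A \<inter> C) \<partial>distr M rams_space (\<lambda>\<omega>. transl (-v) (X \<omega>)))"
      using tX * by (subst nn_integral_distr) (auto simp: comp_def)
    also have "distr M rams_space (\<lambda>\<omega>. transl (-v) (X \<omega>)) = distr M rams_space X"
      using st by (auto simp: stationary_rams_def)
    also have "(\<integral>\<^sup>+A. emeasure lebesgue (A \<inter> transl y A \<inter> C) \<partial>distr M rams_space X) = emeasure \<mu> C"
      using * by (subst nn_integral_distr) (auto simp: em\<mu> C Z_def)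
    finally show ?thesis .
  qed
  \<comment> \<open>The unit cube has volume 1, so comparison with it identifies the proportionality
    factor as \<open>spec_cov M X y\<close>.\<close>
  have "emeasure \<mu> B * emeasure lborel (box 0 (One::'a)) = emeasure lborel B * emeasure \<mu> (box 0 One)"
    using B by (intro translation_invariant_measure_unique sets_\<mu> sf inv) auto
  moreover have "emeasure lborel (box 0 (One::'a)) = 1" by (subst emeasure_lborel_box) auto
  moreover have "emeasure lborel B = ennreal (measure lebesgue B)"
    using B emeasure_eq_measure2[OF bounded_set_imp_lmeasurable[of B]] by simp
  moreover have "emeasure \<mu> (box 0 One) = ennreal (spec_cov M X y)"
    by (subst val) (simp_all add: spec_cov_def Z_def)
  moreover have "0 \<le> spec_cov M X y" unfolding spec_cov_def by (intro integral_nonneg_AE AE_I2) simp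
  ultimately have "ennreal (\<integral>\<omega>. measure lebesgue (Z \<omega> \<inter> B) \<partial>M) = ennreal (measure lebesgue B * spec_cov M X y)"
    using val[OF B] by (simp add: ennreal_mult)
  moreover have "0 \<le> (\<integral>\<omega>. measure lebesgue (Z \<omega> \<inter> B) \<partial>M)"
    by (intro integral_nonneg_AE AE_I2) simp
  ultimately show ?thesis
    using \<open>0 \<le> spec_cov M X y\<close> by (simp add: Z_def mult.commute)
qed

section \<open>Necessity of admissibility\<close>

lemma spec_cov_admissible:
  fixes X :: "'w \<Rightarrow> 'a::euclidean_space set"
  assumes st: "stationary_rams M X" and S2: "\<And>y. S2 y = spec_cov M X y"
  shows "admissible_S2 S2"
  unfolding admissible_S2_def admissible_def
proof (intro allI impI, elim conjE)
  fix q :: nat and a :: "nat \<Rightarrow> real" and y :: "nat \<Rightarrow> 'a" and W :: "nat \<Rightarrow> 'a set" and c :: real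
  assume W: "\<forall>i<q. W i \<in> Wsets"
    and nn: "\<forall>A\<in>sets lebesgue. c + (\<Sum>i<q. a i * delta (y i) (W i) A) \<ge> 0"
  have X[measurable]: "X \<in> M \<rightarrow>\<^sub>M rams_space" using st by (auto simp: stationary_rams_def)
  interpret prob_space M using st by (auto simp: stationary_rams_def)
  have XL: "X \<omega> \<in> sets lebesgue" if "\<omega> \<in> space M" for \<omega>
    using measurable_space[OF X that] by simp
  have Wb: "W i \<in> sets borel" "bounded (W i)" if "i < q" for i
    using W that by (auto simp: Wsets_def)
  have int: "integrable M (\<lambda>\<omega>. delta (y i) (W i) (X \<omega>))" if "i < q" for i
    unfolding delta_def by (rule integrable_window[OF prob_space_axioms X Wb[OF that]])
  have "0 \<le> (\<integral>\<omega>. c + (\<Sum>i<q. a i * delta (y i) (W i) (X \<omega>)) \<partial>M)"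
    using nn XL by (intro integral_nonneg_AE AE_I2) auto
  also have "\<dots> = c + (\<Sum>i<q. a i * (\<integral>\<omega>. delta (y i) (W i) (X \<omega>) \<partial>M))"
    using int by (subst Bochner_Integration.integral_add) (auto simp: prob_space)
  also have "\<dots> = c + (\<Sum>i<q. a i * (S2 (y i) * measure lebesgue (W i)))"
    unfolding delta_def using spec_cov_window[OF st] Wb by (simp add: S2)
  finally show "0 \<le> c + (\<Sum>i<q. a i * (S2 (y i) * measure lebesgue (W i)))" .
qed

section \<open>Directional variation and perimeter\<close>

text \<open>The squared positive part is continuously differentiable across 0. It glues cut-off
  functions of class C^1, which is all the regularity that \<open>C1c_unit\<close> demands.\<close>

lemma DERIV_max_0_square:
  "((\<lambda>s. (max 0 s)\<^sup>2) has_real_derivative 2 * max 0 s) (at s)"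
proof -
  consider "s > 0" | "s < 0" | "s = 0" by linarith
  then show ?thesis
  proof cases
    case 1
    have "((\<lambda>s. s\<^sup>2) has_real_derivative 2 * max 0 s) (at s)"
      using 1 by (auto intro!: derivative_eq_intros)
    then show ?thesis
      by (rule has_field_derivative_transform_within_open[of _ _ _ "{0<..}"]) (use 1 in auto)
  next
    case 2
    have "((\<lambda>s. 0) has_real_derivative 2 * max 0 s) (at s)"
      using 2 by (auto intro!: derivative_eq_intros)
    then show ?thesis
      by (rule has_field_derivative_transform_within_open[of _ _ _ "{..<0}"]) (use 2 in auto)
  next
    case 3
    have "((\<lambda>h. max 0 h :: real) \<longlongrightarrow> max 0 0) (at 0)" by (intro tendsto_intros)
    then have "((\<lambda>h. max 0 h :: real) \<longlongrightarrow> 0) (at 0)" by simp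
    then have "((\<lambda>h. (max 0 h)\<^sup>2 / h) \<longlongrightarrow> (0::real)) (at 0)"
      by (rule Lim_transform_eventually) (auto simp: eventually_at_filter power2_eq_square max_def)
    then show ?thesis using 3 by (simp add: DERIV_def)
  qed
qed

text \<open>Finitely many balls inside \<open>V\<close> cover \<open>K\<close>. The sum
  \<open>G\<close> of one bump \<open>b c\<close> per ball is positive on \<open>K\<close>, hence at
  least some \<open>m > 0\<close> there by compactness, and it vanishes off the closed balls. The
  gradient \<open>g\<close> is returned as a vector field so that its continuity is an ordinary
  statement about functions.\<close>

lemma C1_bump:
  fixes K V :: "'a::euclidean_space set"
  assumes K: "compact K" and V: "open V" "K \<subseteq> V"
  obtains \<psi> :: "'a \<Rightarrow> real" and g C where
    "\<And>x. (\<psi> has_derivative (\<lambda>h. g x \<bullet> h)) (at x)" "continuous_on UNIV g"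
    "\<And>x. 0 \<le> \<psi> x" "\<And>x. \<psi> x \<le> 1" "\<And>x. x \<in> K \<Longrightarrow> \<psi> x = 1"
    "compact C" "C \<subseteq> V" "\<And>x. x \<notin> C \<Longrightarrow> \<psi> x = 0"
proof -
  have "\<forall>x\<in>K. \<exists>r>0. cball x r \<subseteq> V" using V open_contains_cball by blast
  then obtain r where r: "\<And>x. x \<in> K \<Longrightarrow> r x > 0 \<and> cball x (r x) \<subseteq> V" by metis
  obtain D where D: "D \<subseteq> K" "finite D" "K \<subseteq> (\<Union>x\<in>D. ball x (r x))"
    using K r by (auto elim!: compactE_image[of K K "\<lambda>x. ball x (r x)"])
  define b where "b c x = (max 0 ((r c)\<^sup>2 - (x - c) \<bullet> (x - c)))\<^sup>2" for c x :: 'a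
  define gb where "gb c x = (- 4 * max 0 ((r c)\<^sup>2 - (x - c) \<bullet> (x - c))) *\<^sub>R (x - c)" for c x :: 'a
  have db: "(b c has_derivative (\<lambda>h. gb c x \<bullet> h)) (at x)" for c x
  proof -
    have "((\<lambda>x. (r c)\<^sup>2 - (x - c) \<bullet> (x - c)) has_derivative (\<lambda>h. - 2 * ((x - c) \<bullet> h))) (at x)"
      by (auto intro!: derivative_eq_intros simp: inner_commute)
    from has_derivative_compose[OF this has_field_derivative_imp_has_derivative[OF DERIV_max_0_square]]
    show ?thesis unfolding b_def gb_def by (simp add: algebra_simps)
  qed
  define G where "G x = (\<Sum>c\<in>D. b c x)" for x
  have dG: "(G has_derivative (\<lambda>h. (\<Sum>c\<in>D. gb c x) \<bullet> h)) (at x)" for x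
    unfolding G_def inner_sum_left by (intro has_derivative_sum db)
  have Gnn: "0 \<le> G x" for x unfolding G_def b_def by (intro sum_nonneg) auto
  have Gpos: "0 < G x" if "x \<in> K" for x
  proof -
    obtain c where c: "c \<in> D" "x \<in> ball c (r c)" using D \<open>x \<in> K\<close> by blast
    then have "norm (x - c) < r c" by (simp add: dist_norm norm_minus_commute)
    then have "(norm (x - c))\<^sup>2 < (r c)\<^sup>2" by (intro power_strict_mono) auto
    then have "(x - c) \<bullet> (x - c) < (r c)\<^sup>2" by (simp add: power2_norm_eq_inner)
    then have "0 < b c x" by (simp add: b_def)
    then show ?thesis unfolding G_def
      using c D by (intro sum_pos2[of D c]) (auto simp: b_def)
  qed
  have contG: "continuous_on UNIV G"
    using dG has_derivative_continuous by (blast intro: continuous_at_imp_continuous_on)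
  obtain m where m: "m > 0" "\<And>x. x \<in> K \<Longrightarrow> m \<le> G x"
  proof (cases "K = {}")
    case False
    then obtain x0 where "x0 \<in> K" "\<forall>x\<in>K. G x0 \<le> G x"
      using continuous_attains_inf[OF K False continuous_on_subset[OF contG]] by auto
    then show ?thesis using that[of "G x0"] Gpos by auto
  qed (use that[of 1] in auto)
  \<comment> \<open>This rescaling is 1 wherever \<open>G x \<ge> m\<close> and 0 wherever
    \<open>G x = 0\<close>, and the squared positive part keeps it C^1 in between.\<close>
  define \<psi> where "\<psi> x = 1 - (max 0 (1 - G x / m))\<^sup>2" for x
  define g where "g x = (2 * max 0 (1 - G x / m) / m) *\<^sub>R (\<Sum>c\<in>D. gb c x)" for x
  show ?thesis
  proof (rule that[of \<psi> g "\<Union>c\<in>D. cball c (r c)"])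
    fix x
    have "((\<lambda>x. 1 - G x / m) has_derivative (\<lambda>h. - ((\<Sum>c\<in>D. gb c x) \<bullet> h / m))) (at x)"
      by (rule derivative_eq_intros dG refl)+ (use m(1) in auto)
    from has_derivative_compose[OF this has_field_derivative_imp_has_derivative[OF DERIV_max_0_square]]
    have "((\<lambda>x. (max 0 (1 - G x / m))\<^sup>2) has_derivative (\<lambda>h. 2 * max 0 (1 - G x / m) * (- ((\<Sum>c\<in>D. gb c x) \<bullet> h / m)))) (at x)" .
    then have "((\<lambda>x. 1 - (max 0 (1 - G x / m))\<^sup>2) has_derivative
        (\<lambda>h. 0 - 2 * max 0 (1 - G x / m) * (- ((\<Sum>c\<in>D. gb c x) \<bullet> h / m)))) (at x)"
      by (intro has_derivative_diff has_derivative_const)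
    then show "(\<psi> has_derivative (\<lambda>h. g x \<bullet> h)) (at x)"
      unfolding \<psi>_def g_def by simp
    have "0 \<le> G x / m" using Gnn m by simp
    then have "(max 0 (1 - G x / m))\<^sup>2 \<le> 1" by (intro power_le_one) auto
    then show "0 \<le> \<psi> x" by (simp add: \<psi>_def)
    show "\<psi> x \<le> 1" by (simp add: \<psi>_def)
    show "\<psi> x = 1" if "x \<in> K" using m that by (simp add: \<psi>_def)
    show "\<psi> x = 0" if "x \<notin> (\<Union>c\<in>D. cball c (r c))"
    proof -
      have "b c x = 0" if "c \<in> D" for c
      proof -
        have "r c > 0" using that D r by blast
        moreover have "r c < norm (x - c)" using \<open>x \<notin> _\<close> that by (auto simp: dist_norm norm_minus_commute)
        ultimately have "(r c)\<^sup>2 < (norm (x - c))\<^sup>2" by (intro power_strict_mono) auto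
        then show ?thesis by (simp add: b_def power2_norm_eq_inner)
      qed
      then show ?thesis by (simp add: \<psi>_def G_def)
    qed
  next
    have "continuous_on UNIV (\<lambda>x. gb c x)" for c unfolding gb_def by (intro continuous_intros)
    then show "continuous_on UNIV g" unfolding g_def using m(1) contG by (intro continuous_intros) auto
    show "compact (\<Union>c\<in>D. cball c (r c))" using D by (intro compact_UN) auto
    show "(\<Union>c\<in>D. cball c (r c)) \<subseteq> V" using D r by blast
  qed
qed

section \<open>Translation of Lebesgue integrals\<close>

lemma measurable_translation_lebesgue: "(+) a \<in> (lebesgue :: 'a::euclidean_space measure) \<rightarrow>\<^sub>M lebesgue"
proof (rule measurableI)
  fix A :: "'a set" assume "A \<in> sets lebesgue"
  moreover have "(+) a -` A \<inter> space lebesgue = transl (- a) A" by (auto simp: transl_iff add.commute)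
  ultimately show "(+) a -` A \<inter> space lebesgue \<in> sets lebesgue" by (simp add: transl_lebesgue)
qed simp

lemma distr_lebesgue_translation: "distr lebesgue lebesgue ((+) a) = (lebesgue :: 'a::euclidean_space measure)"
proof (rule measure_eqI)
  fix A :: "'a set" assume "A \<in> sets (distr lebesgue lebesgue ((+) a))"
  moreover have "(+) a -` A \<inter> space lebesgue = transl (- a) A" by (auto simp: transl_iff add.commute)
  ultimately show "emeasure (distr lebesgue lebesgue ((+) a)) A = emeasure lebesgue A"
    using measurable_translation_lebesgue[of a] by (simp add: emeasure_distr emeasure_transl)
qed simp

lemma integral_lebesgue_translation:
  fixes f :: "'a::euclidean_space \<Rightarrow> real"
  assumes "f \<in> borel_measurable lebesgue"
  shows "(\<integral>x. f (a + x) \<partial>lebesgue) = (\<integral>x. f x \<partial>lebesgue)"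
  using integral_distr[OF measurable_translation_lebesgue[of a] assms]
  by (simp add: distr_lebesgue_translation)

lemma has_derivative_shift:
  assumes "(\<psi> has_derivative f') (at (x + c))"
  shows "((\<lambda>x. \<psi> (x + c)) has_derivative f') (at x)"
proof -
  have "((\<lambda>x. x + c) has_derivative (\<lambda>h. h)) (at x)" by (auto intro!: derivative_eq_intros)
  from has_derivative_compose[OF this assms] show ?thesis .
qed

text \<open>Averaging a test function along a segment turns the divergence into a difference.\<close>
lemma Per_test_difference:
  fixes A :: "'a::euclidean_space set" and \<psi> :: "'a \<Rightarrow> real"
  assumes U: "open U" and j: "j \<in> Basis" and t: "t \<noteq> 0"
    and d: "\<And>x. (\<psi> has_derivative (\<lambda>h. g x \<bullet> h)) (at x)" and cg: "continuous_on UNIV g"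
    and b: "\<And>x. 0 \<le> \<psi> x" "\<And>x. \<psi> x \<le> 1"
    and C: "compact C" "\<And>x. x \<notin> C \<Longrightarrow> \<psi> x = 0"
    and CU: "\<And>x s. x \<in> C \<Longrightarrow> 0 \<le> s \<Longrightarrow> s \<le> 1 \<Longrightarrow> x - (s * t) *\<^sub>R j \<in> U"
  shows "ennreal (\<integral>x. indicator A x * (\<psi> x - \<psi> (x + t *\<^sub>R j)) \<partial>lebesgue) \<le> ennreal \<bar>t\<bar> * Per A U"
proof -
  have c\<psi>: "continuous_on UNIV \<psi>"
    using d has_derivative_continuous by (blast intro: continuous_at_imp_continuous_on)
  \<comment> \<open>The segment from \<open>x\<close> to \<open>x + t *\<^sub>R j\<close> is
    parametrised over the unit interval, so both signs of \<open>t\<close> are treated at once.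
    \<open>D\<close> is its derivative in the operator form required by the Leibniz rule.\<close>
  define \<Phi> where "\<Phi> x = integral (cbox 0 1) (\<lambda>s::real. \<psi> (x + (s * t) *\<^sub>R j))" for x
  define D where "D x = integral (cbox 0 1) (\<lambda>s::real. blinfun_inner_left (g (x + (s * t) *\<^sub>R j)))" for x
  have cont\<psi>: "continuous_on S (\<lambda>s::real. \<psi> (x + (s * t) *\<^sub>R j))" for x S
    by (rule continuous_on_compose2[OF c\<psi>]) (auto intro!: continuous_intros)
  have contg: "continuous_on S (\<lambda>s::real. g (x + (s * t) *\<^sub>R j))" for x S
    by (rule continuous_on_compose2[OF cg]) (auto intro!: continuous_intros)
  have contD: "continuous_on (UNIV \<times> cbox 0 1) (\<lambda>(x, s::real). blinfun_inner_left (g (x + (s * t) *\<^sub>R j)))"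
    unfolding case_prod_beta
    by (rule bounded_linear.continuous_on[OF bounded_linear_blinfun_inner_left])
       (rule continuous_on_compose2[OF cg], auto intro!: continuous_intros)
  have der: "(\<Phi> has_derivative blinfun_apply (D x)) (at x)" for x
    unfolding \<Phi>_def D_def
  proof (rule leibniz_rule)
    fix x and s :: real
    show "((\<lambda>x. \<psi> (x + (s * t) *\<^sub>R j)) has_derivative blinfun_apply (blinfun_inner_left (g (x + (s * t) *\<^sub>R j)))) (at x)"
      using has_derivative_shift[OF d] by (simp add: inner_commute)
    show "(\<lambda>s. \<psi> (x + (s * t) *\<^sub>R j)) integrable_on cbox 0 1"
      by (intro integrable_continuous cont\<psi>)
  qed (use contD in auto)
  have cD: "continuous_on UNIV D"
    unfolding D_def by (rule integral_continuous_on_param[OF contD])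
  \<comment> \<open>The derivative of the average in the direction of averaging is an integral of a
    derivative, which telescopes to a difference of end values.\<close>
  have Dj: "t * blinfun_apply (D x) j = \<psi> (x + t *\<^sub>R j) - \<psi> x" for x
  proof -
    have "blinfun_apply (D x) j = integral (cbox 0 1) ((\<lambda>F. blinfun_apply F j) \<circ> (\<lambda>s. blinfun_inner_left (g (x + (s * t) *\<^sub>R j))))"
      unfolding D_def
      by (intro integral_linear[symmetric] bounded_linear_intros integrable_continuous
          bounded_linear.continuous_on[OF bounded_linear_blinfun_inner_left] contg)
    then have "t * blinfun_apply (D x) j = integral {0..1} (\<lambda>s. t * (j \<bullet> g (x + (s * t) *\<^sub>R j)))"
      by (simp add: o_def)
    also have "\<dots> = \<psi> (x + (1 * t) *\<^sub>R j) - \<psi> (x + (0 * t) *\<^sub>R j)"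
    proof (intro integral_unique fundamental_theorem_of_calculus)
      fix s :: real
      have "((\<lambda>s. x + (s * t) *\<^sub>R j) has_derivative (\<lambda>h. (h * t) *\<^sub>R j)) (at s within {0..1})"
        by (auto intro!: derivative_eq_intros)
      from has_derivative_compose[OF this d]
      show "((\<lambda>s. \<psi> (x + (s * t) *\<^sub>R j)) has_vector_derivative t * (j \<bullet> g (x + (s * t) *\<^sub>R j))) (at s within {0..1})"
        by (simp add: has_vector_derivative_def inner_commute mult_ac)
    qed auto
    finally show ?thesis by simp
  qed
  have \<Phi>b: "\<bar>\<Phi> x\<bar> \<le> 1" for x
  proof -
    have "norm (\<Phi> x) \<le> 1 * measure lborel (cbox 0 (1::real))"
      unfolding \<Phi>_def using b
      by (intro integrable_bound) (auto intro!: integrable_continuous_real cont\<psi> simp: abs_le_iff intro: order_trans[of _ 0])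
    then show ?thesis by simp
  qed
  \<comment> \<open>The sign makes the divergence equal to
    \<open>(\<psi> x - \<psi> (x + t *\<^sub>R j)) / \<bar>t\<bar>\<close>, with the absolute value
    of \<open>t\<close> in the denominator.\<close>
  define \<phi> where "\<phi> x = (- sgn t * \<Phi> x) *\<^sub>R j" for x
  have d\<phi>: "(\<phi> has_derivative (\<lambda>h. (- sgn t * blinfun_apply (D x) h) *\<^sub>R j)) (at x)" for x
    unfolding \<phi>_def
    by (intro has_derivative_scaleR_left has_derivative_mult_right der)
  have fd: "frechet_derivative \<phi> (at x) = (\<lambda>h. (- sgn t * blinfun_apply (D x) h) *\<^sub>R j)" for x
    using frechet_derivative_at[OF d\<phi>] by simp
  \<comment> \<open>Averaging spreads the support: it is contained in \<open>C\<close> swept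
    backwards along the segment.\<close>
  define K where "K = (\<lambda>(x, s). x - (s * t) *\<^sub>R j) ` (C \<times> {0..1::real})"
  have K: "compact K"
    unfolding K_def using C(1) by (intro compact_continuous_image compact_Times) (auto intro!: continuous_intros simp: case_prod_beta)
  have KU: "K \<subseteq> U" unfolding K_def using CU by auto
  have \<phi>0: "\<phi> x = 0" if "x \<notin> K" for x
  proof -
    have "\<psi> (x + (s * t) *\<^sub>R j) = 0" if "s \<in> cbox 0 1" for s
    proof (rule ccontr)
      assume "\<psi> (x + (s * t) *\<^sub>R j) \<noteq> 0"
      then have "x + (s * t) *\<^sub>R j \<in> C" using C by blast
      then have "x \<in> K" unfolding K_def using that
        by (intro image_eqI[of _ _ "(x + (s * t) *\<^sub>R j, s)"]) auto
      then show False using \<open>x \<notin> K\<close> by simp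
    qed
    then have "\<Phi> x = integral (cbox 0 1) (\<lambda>s::real. 0)"
      unfolding \<Phi>_def by (intro integral_cong) auto
    then show ?thesis by (simp add: \<phi>_def)
  qed
  have "\<phi> \<in> C1c_unit U"
    unfolding C1c_unit_def mem_Collect_eq
  proof (intro conjI ballI allI)
    show "\<phi> differentiable at x" for x using d\<phi> by (auto simp: differentiable_def)
    show "continuous_on U (\<lambda>x. frechet_derivative \<phi> (at x) i)" for i
      unfolding fd using continuous_on_subset[OF cD, of U] by (auto intro!: continuous_intros)
    show "\<exists>K. compact K \<and> K \<subseteq> U \<and> (\<forall>x. x \<notin> K \<longrightarrow> \<phi> x = 0)" using K KU \<phi>0 by blast
    show "norm (\<phi> x) \<le> 1" for x
      using \<Phi>b[of x] j by (simp add: \<phi>_def abs_mult abs_sgn_eq)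
  qed
  then have "ennreal (\<integral>x. indicator (A \<inter> U) x * divergence \<phi> x \<partial>lebesgue) \<le> Per A U"
    unfolding Per_def by (rule SUP_upper)
  also have "(\<integral>x. indicator (A \<inter> U) x * divergence \<phi> x \<partial>lebesgue)
     = (\<integral>x. indicator A x * (\<psi> x - \<psi> (x + t *\<^sub>R j)) / \<bar>t\<bar> \<partial>lebesgue)"
  proof (intro Bochner_Integration.integral_cong refl)
    fix x
    have "divergence \<phi> x = (\<Sum>i\<in>Basis. if i = j then - sgn t * blinfun_apply (D x) i else 0)"
      unfolding divergence_def fd using j by (intro sum.cong) (auto simp: inner_Basis)
    also have "\<dots> = - sgn t * blinfun_apply (D x) j" using j by simp
    also have "\<dots> = (\<psi> x - \<psi> (x + t *\<^sub>R j)) / \<bar>t\<bar>"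
      using t Dj[of x] by (cases "t > 0") (auto simp: field_simps)
    finally have div: "divergence \<phi> x = (\<psi> x - \<psi> (x + t *\<^sub>R j)) / \<bar>t\<bar>" .
    have "\<psi> x = 0 \<and> \<psi> (x + t *\<^sub>R j) = 0" if "x \<notin> U"
    proof -
      have "x \<notin> C" using CU[of x 0] that by auto
      moreover have "x + t *\<^sub>R j \<notin> C" using CU[of "x + t *\<^sub>R j" 1] that by auto
      ultimately show ?thesis using C by blast
    qed
    then show "indicator (A \<inter> U) x * divergence \<phi> x = indicator A x * (\<psi> x - \<psi> (x + t *\<^sub>R j)) / \<bar>t\<bar>"
      by (auto simp: div indicator_def)
  qed
  finally have "ennreal ((\<integral>x. indicator A x * (\<psi> x - \<psi> (x + t *\<^sub>R j)) \<partial>lebesgue) / \<bar>t\<bar>) \<le> Per A U"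
    by simp
  then have "ennreal \<bar>t\<bar> * ennreal ((\<integral>x. indicator A x * (\<psi> x - \<psi> (x + t *\<^sub>R j)) \<partial>lebesgue) / \<bar>t\<bar>) \<le> ennreal \<bar>t\<bar> * Per A U"
    by (rule mult_left_mono) simp
  also have "ennreal \<bar>t\<bar> * ennreal ((\<integral>x. indicator A x * (\<psi> x - \<psi> (x + t *\<^sub>R j)) \<partial>lebesgue) / \<bar>t\<bar>)
     = ennreal (\<integral>x. indicator A x * (\<psi> x - \<psi> (x + t *\<^sub>R j)) \<partial>lebesgue)"
    using t by (subst ennreal_mult'[symmetric]) auto
  finally show ?thesis .
qed

text \<open>With \<open>\<psi>\<close> close to the indicator of \<open>?E\<close>, moving the shift
  from \<open>\<psi>\<close> to the set turns the test integral of
  \<open>Per_test_difference\<close> into the integral of \<open>\<psi>\<close> against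
  \<open>indicator A - indicator (transl (t *\<^sub>R j) A)\<close>. This difference is 1 on
  \<open>?E\<close>, so the integral nearly equals the measure of \<open>?E\<close>.\<close>

lemma measure_diff_transl_le_Per:
  fixes A :: "'a::euclidean_space set"
  assumes A: "A \<in> sets lebesgue" and U: "open U" and U': "open U'" "bounded U'" and j: "j \<in> Basis" and t: "t \<noteq> 0"
    and UU: "\<And>x s. x \<in> U' \<Longrightarrow> 0 \<le> s \<Longrightarrow> s \<le> 1 \<Longrightarrow> x - (s * t) *\<^sub>R j \<in> U"
  shows "ennreal (measure lebesgue ((A - transl (t *\<^sub>R j) A) \<inter> U')) \<le> ennreal \<bar>t\<bar> * Per A U"
proof (rule ennreal_le_epsilon)
  fix e :: real assume e: "0 < e"
  let ?E = "(A - transl (t *\<^sub>R j) A) \<inter> U'"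
  have E: "?E \<in> lmeasurable" using A U' by (intro lmeasurable_Int_bounded) (auto intro: transl_lebesgue)
  then have EL: "?E \<in> sets lebesgue" by (rule fmeasurableD)
  \<comment> \<open>Why thirds: in the final estimate \<open>?E - K\<close> is lost twice and
    \<open>T - ?E\<close> once.\<close>
  obtain K where K: "closed K" "K \<subseteq> ?E" "?E - K \<in> lmeasurable" "emeasure lebesgue (?E - K) < ennreal (e/3)"
    using sets_lebesgue_inner_closed[OF EL, of "e/3"] e by auto
  obtain T where T: "open T" "?E \<subseteq> T" "T - ?E \<in> lmeasurable" "emeasure lebesgue (T - ?E) < ennreal (e/3)"
    using sets_lebesgue_outer_open[OF EL, of "e/3"] e by auto
  have cK: "compact K" using K U'(2) by (meson bounded_subset compact_eq_bounded_closed le_infE)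
  have KL: "K \<in> lmeasurable" using cK by (rule lmeasurable_compact)
  have mEK: "measure lebesgue (?E - K) < e / 3"
    using K(4) e emeasure_eq_measure2[OF K(3)] by (simp add: ennreal_less_iff)
  have mTE: "measure lebesgue (T - ?E) < e / 3"
    using T(4) e emeasure_eq_measure2[OF T(3)] by (simp add: ennreal_less_iff)
  define V where "V = T \<inter> U'"
  have V: "open V" "K \<subseteq> V" using T U' K by (auto simp: V_def)
  have VL: "V \<in> lmeasurable" using V U' by (intro bounded_set_imp_lmeasurable) (auto simp: V_def bounded_Int)
  obtain \<psi> g C where \<psi>:
    "\<And>x. (\<psi> has_derivative (\<lambda>h. g x \<bullet> h)) (at x)" "continuous_on UNIV g"
    "\<And>x. 0 \<le> \<psi> x" "\<And>x. \<psi> x \<le> 1" "\<And>x. x \<in> K \<Longrightarrow> \<psi> x = 1"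
    "compact C" "C \<subseteq> V" "\<And>x. x \<notin> C \<Longrightarrow> \<psi> x = 0"
    using C1_bump[OF cK V] by metis
  have CU: "x - (s * t) *\<^sub>R j \<in> U" if "x \<in> C" "0 \<le> s" "s \<le> 1" for x s
    using UU[of x s] that \<psi>(7) by (auto simp: V_def)
  have c\<psi>: "continuous_on UNIV \<psi>"
    using \<psi>(1) has_derivative_continuous by (blast intro: continuous_at_imp_continuous_on)
  then have [measurable]: "\<psi> \<in> borel_measurable borel" by (rule borel_measurable_continuous_onI)
  then have \<psi>m: "\<psi> \<in> borel_measurable lebesgue" "(\<lambda>x. \<psi> (x + t *\<^sub>R j)) \<in> borel_measurable lebesgue"
    by (auto intro!: measurable_completion)
  have CL: "C \<in> lmeasurable" using \<psi>(6) by (rule lmeasurable_compact)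
  have int1: "integrable lebesgue (\<lambda>x. indicator B x * \<psi> x)" if "B \<in> sets lebesgue" for B :: "'a set"
  proof (rule Bochner_Integration.integrable_bound[of _ "indicator C :: 'a \<Rightarrow> real"])
    show "integrable lebesgue (indicator C :: 'a \<Rightarrow> real)" using CL by (simp add: lmeasurable_iff_integrable)
    show "AE x in lebesgue. norm (indicator B x * \<psi> x) \<le> norm (indicator C x :: real)"
      using \<psi>(3,4,8) by (intro AE_I2) (auto simp: indicator_def)
  qed (use that \<psi>m in auto)
  have tr: "indicator A x * \<psi> (x + t *\<^sub>R j) = (\<lambda>x. indicator (transl (t *\<^sub>R j) A) x * \<psi> x) (t *\<^sub>R j + x)" for x
    by (auto simp: indicator_def transl_iff add.commute)
  have AtL: "transl (t *\<^sub>R j) A \<in> sets lebesgue" using A by (rule transl_lebesgue)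
  have int2: "integrable lebesgue (\<lambda>x. indicator A x * \<psi> (x + t *\<^sub>R j))"
    unfolding tr using int1[OF AtL] integrable_distr_eq[OF measurable_translation_lebesgue[of "t *\<^sub>R j"], of "\<lambda>x. indicator (transl (t *\<^sub>R j) A) x * \<psi> x"]
    by (simp add: distr_lebesgue_translation)
  have VKL: "V - K \<in> lmeasurable" using VL KL by auto
  have "measure lebesgue ?E \<le> measure lebesgue K + measure lebesgue (?E - K)"
    using K KL E by (subst measure_Un2[symmetric]) (auto intro!: measure_mono_fmeasurable)
  moreover have "measure lebesgue (V - K) \<le> measure lebesgue (T - ?E) + measure lebesgue (?E - K)"
    using K T VL KL E
    by (intro order_trans[OF measure_mono_fmeasurable measure_Un_le]) (auto simp: V_def intro: fmeasurableD)
  moreover have "measure lebesgue K - measure lebesgue (V - K) \<le> (\<integral>x. indicator A x * (\<psi> x - \<psi> (x + t *\<^sub>R j)) \<partial>lebesgue)"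
  proof -
    have "measure lebesgue K - measure lebesgue (V - K) = (\<integral>x. indicator K x - indicator (V - K) x \<partial>lebesgue)"
      using KL VKL by (subst Bochner_Integration.integral_diff) (auto simp: lmeasurable_iff_integrable)
    also have "\<dots> \<le> (\<integral>x. indicator A x * \<psi> x - indicator (transl (t *\<^sub>R j) A) x * \<psi> x \<partial>lebesgue)"
    proof (rule integral_mono)
      show "integrable lebesgue (\<lambda>x. indicator K x - indicator (V - K) x :: real)"
        using KL VKL by (intro Bochner_Integration.integrable_diff) (auto simp: lmeasurable_iff_integrable)
      show "integrable lebesgue (\<lambda>x. indicator A x * \<psi> x - indicator (transl (t *\<^sub>R j) A) x * \<psi> x)"
        by (intro Bochner_Integration.integrable_diff int1 A AtL)
      fix x :: 'a
      \<comment> \<open>On \<open>K\<close> the right side is 1, since \<open>K\<close> lies in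
        \<open>A\<close> and misses the translate; on \<open>V - K\<close> it is at least -1;
        outside \<open>V\<close> the cut-off vanishes.\<close>
      show "indicator K x - indicator (V - K) x \<le> indicator A x * \<psi> x - indicator (transl (t *\<^sub>R j) A) x * \<psi> x"
        using \<psi>(3,4)[of x] \<psi>(5,8)[of x] \<psi>(7) K(2) by (auto simp: indicator_def)
    qed
    also have "\<dots> = (\<integral>x. indicator A x * \<psi> x \<partial>lebesgue) - (\<integral>x. indicator (transl (t *\<^sub>R j) A) x * \<psi> x \<partial>lebesgue)"
      by (intro Bochner_Integration.integral_diff int1 A AtL)
    also have "(\<integral>x. indicator (transl (t *\<^sub>R j) A) x * \<psi> x \<partial>lebesgue) = (\<integral>x. indicator A x * \<psi> (x + t *\<^sub>R j) \<partial>lebesgue)"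
      unfolding tr using int1[OF AtL]
      by (subst integral_lebesgue_translation[of "\<lambda>x. indicator (transl (t *\<^sub>R j) A) x * \<psi> x"]) auto
    also have "(\<integral>x. indicator A x * \<psi> x \<partial>lebesgue) - (\<integral>x. indicator A x * \<psi> (x + t *\<^sub>R j) \<partial>lebesgue)
        = (\<integral>x. indicator A x * (\<psi> x - \<psi> (x + t *\<^sub>R j)) \<partial>lebesgue)"
      by (subst Bochner_Integration.integral_diff[symmetric]) (auto simp: int1 int2 A right_diff_distrib)
    finally show ?thesis .
  qed
  ultimately have "measure lebesgue ?E \<le> (\<integral>x. indicator A x * (\<psi> x - \<psi> (x + t *\<^sub>R j)) \<partial>lebesgue) + e"
    using mEK mTE by linarith
  then have "ennreal (measure lebesgue ?E) \<le> ennreal ((\<integral>x. indicator A x * (\<psi> x - \<psi> (x + t *\<^sub>R j)) \<partial>lebesgue) + e)"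
    by (rule ennreal_leI)
  also have "\<dots> \<le> ennreal (\<integral>x. indicator A x * (\<psi> x - \<psi> (x + t *\<^sub>R j)) \<partial>lebesgue) + ennreal e"
    using e by (cases "0 \<le> (\<integral>x. indicator A x * (\<psi> x - \<psi> (x + t *\<^sub>R j)) \<partial>lebesgue)")
      (auto simp: ennreal_neg intro!: ennreal_leI)
  also have "\<dots> \<le> ennreal \<bar>t\<bar> * Per A U + ennreal e"
    using Per_test_difference[OF U j t \<psi>(1,2,3,4,6,8) CU, of A] by (rule add_right_mono)
  finally show "ennreal (measure lebesgue ?E) \<le> ennreal \<bar>t\<bar> * Per A U + ennreal e" .
qed

lemma spec_cov_bounds:
  assumes st: "stationary_rams M X"
  shows "0 \<le> spec_cov M X y" "spec_cov M X y \<le> 1"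
proof -
  have X[measurable]: "X \<in> M \<rightarrow>\<^sub>M rams_space" using st by (auto simp: stationary_rams_def)
  interpret prob_space M using st by (auto simp: stationary_rams_def)
  have XL: "X \<omega> \<in> sets lebesgue" if "\<omega> \<in> space M" for \<omega>
    using measurable_space[OF X that] by simp
  show "0 \<le> spec_cov M X y" unfolding spec_cov_def by (intro integral_nonneg_AE AE_I2) simp
  have b: "measure lebesgue (X \<omega> \<inter> transl y (X \<omega>) \<inter> box 0 One) \<le> 1" if "\<omega> \<in> space M" for \<omega>
  proof -
    have "measure lebesgue (X \<omega> \<inter> transl y (X \<omega>) \<inter> box 0 One) \<le> measure lebesgue (box 0 (One::'b))"
      using XL[OF that] by (intro measure_mono_fmeasurable) (auto intro!: sets.Int transl_lebesgue)
    then show ?thesis by simp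
  qed
  have "integrable M (\<lambda>\<omega>. measure lebesgue (X \<omega> \<inter> transl y (X \<omega>) \<inter> box 0 One))"
    by (rule integrable_window[OF prob_space_axioms X]) auto
  then have "spec_cov M X y \<le> (\<integral>\<omega>. 1 \<partial>M)"
    unfolding spec_cov_def using b by (intro integral_mono) auto
  then show "spec_cov M X y \<le> 1" by (simp add: prob_space)
qed

text \<open>By stationarity, the mean volume of \<open>X - transl (t *\<^sub>R j) X\<close> in the
  trimmed cube \<open>U'\<close> is the covariogram decrement times
  \<open>1 - \<bar>t\<bar>\<close>, and \<open>measure_diff_transl_le_Per\<close> bounds it by
  \<open>\<bar>t\<bar>\<close> times the specific perimeter. For
  \<open>\<bar>t\<bar> \<le> 1 / 2\<close> the volume factor is at least 1/2, which accounts for the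
  2 in the bound.\<close>

lemma spec_cov_increment:
  fixes X :: "'w \<Rightarrow> 'a::euclidean_space set"
  assumes st: "stationary_rams M X" and per: "spec_per M X < \<infinity>" and j: "j \<in> Basis"
    and t: "t \<noteq> 0" "\<bar>t\<bar> \<le> 1 / 2"
  shows "\<bar>spec_cov M X (t *\<^sub>R j) - spec_cov M X 0\<bar> \<le> 2 * enn2real (spec_per M X) * \<bar>t\<bar>"
proof -
  have X[measurable]: "X \<in> M \<rightarrow>\<^sub>M rams_space" using st by (auto simp: stationary_rams_def)
  interpret prob_space M using st by (auto simp: stationary_rams_def)
  have XL: "X \<omega> \<in> sets lebesgue" if "\<omega> \<in> space M" for \<omega>
    using measurable_space[OF X that] by simp
  \<comment> \<open>The unit cube is trimmed by \<open>\<bar>t\<bar>\<close> on the one face,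
    depending on the sign of \<open>t\<close>, through which \<open>x - (s * t) *\<^sub>R j\<close>
    could escape.\<close>
  define U' where "U' = box (max 0 t *\<^sub>R j) (One + min 0 t *\<^sub>R j)"
  have inn: "(One + min 0 t *\<^sub>R j) \<bullet> i - (max 0 t *\<^sub>R j) \<bullet> i = (if i = j then 1 - \<bar>t\<bar> else 1)" if "i \<in> Basis" for i
    using that j by (auto simp: inner_add_left inner_Basis)
  have mU': "measure lebesgue U' = 1 - \<bar>t\<bar>"
  proof -
    have le: "(max 0 t *\<^sub>R j) \<bullet> i \<le> (One + min 0 t *\<^sub>R j) \<bullet> i" if "i \<in> Basis" for i
      using inn[OF that] t by (auto split: if_splits)
    have "measure lborel U' = (\<Prod>i\<in>Basis. (One + min 0 t *\<^sub>R j) \<bullet> i - (max 0 t *\<^sub>R j) \<bullet> i)"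
      unfolding U'_def using le by (subst measure_lborel_box_eq) (auto simp: inner_diff_left)
    also have "\<dots> = (\<Prod>i\<in>Basis. if i = j then 1 - \<bar>t\<bar> else 1)" by (intro prod.cong refl inn)
    also have "\<dots> = 1 - \<bar>t\<bar>" using j by simp
    finally show ?thesis unfolding U'_def by simp
  qed
  have U': "open U'" "bounded U'" by (auto simp: U'_def)
  have UU: "x - (s * t) *\<^sub>R j \<in> box 0 One" if x: "x \<in> U'" and s: "0 \<le> s" "s \<le> 1" for x s
    unfolding mem_box
  proof
    fix i :: 'a assume i: "i \<in> Basis"
    have bd: "(max 0 t *\<^sub>R j) \<bullet> i < x \<bullet> i" "x \<bullet> i < (One + min 0 t *\<^sub>R j) \<bullet> i"
      using x i by (auto simp: U'_def mem_box)
    show "0 \<bullet> i < (x - (s * t) *\<^sub>R j) \<bullet> i \<and> (x - (s * t) *\<^sub>R j) \<bullet> i < One \<bullet> i"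
    proof (cases "i = j")
      case True
      have "min 0 t \<le> s * t" "s * t \<le> max 0 t"
        using s mult_right_mono[of s 1 t] mult_right_mono_neg[of s 1 t] mult_nonneg_nonneg[of s t] mult_nonneg_nonpos[of s t]
        by (auto simp: min_def max_def)
      then show ?thesis using bd True j by (auto simp: inner_diff_left inner_add_left)
    next
      case False
      then show ?thesis using bd i j by (auto simp: inner_diff_left inner_add_left inner_Basis)
    qed
  qed
  define f where "f \<omega> = measure lebesgue ((X \<omega> - transl (t *\<^sub>R j) (X \<omega>)) \<inter> U')" for \<omega>
  define a where "a y \<omega> = measure lebesgue (X \<omega> \<inter> transl y (X \<omega>) \<inter> U')" for y \<omega>
  have lm: "X \<omega> \<inter> transl y (X \<omega>) \<inter> U' \<in> lmeasurable" if "\<omega> \<in> space M" for y \<omega>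
    using XL[OF that] U' by (intro lmeasurable_Int_bounded) (auto intro: transl_lebesgue)
  have inta: "integrable M (a y)" for y
    unfolding a_def using U' by (intro integrable_window[OF prob_space_axioms X]) auto
  have fa: "f \<omega> = a 0 \<omega> - a (t *\<^sub>R j) \<omega>" if w: "\<omega> \<in> space M" for \<omega>
  proof -
    have "f \<omega> = measure lebesgue ((X \<omega> \<inter> transl 0 (X \<omega>) \<inter> U') - (X \<omega> \<inter> transl (t *\<^sub>R j) (X \<omega>) \<inter> U'))"
      unfolding f_def by (intro arg_cong[where f="measure lebesgue"]) (auto simp: transl_0)
    also have "\<dots> = a 0 \<omega> - a (t *\<^sub>R j) \<omega>"
      unfolding a_def
      by (intro measurable_measure_Diff lm[OF w] fmeasurableD[OF lm[OF w]]) (auto simp: transl_0)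
    finally show ?thesis .
  qed
  have "integrable M (\<lambda>\<omega>. a 0 \<omega> - a (t *\<^sub>R j) \<omega>)" by (intro Bochner_Integration.integrable_diff inta)
  then have intf: "integrable M f" by (subst Bochner_Integration.integrable_cong[OF refl fa]) auto
  have "(\<integral>\<omega>. f \<omega> \<partial>M) = (\<integral>\<omega>. a 0 \<omega> - a (t *\<^sub>R j) \<omega> \<partial>M)" by (intro Bochner_Integration.integral_cong refl fa)
  also have "\<dots> = (\<integral>\<omega>. a 0 \<omega> \<partial>M) - (\<integral>\<omega>. a (t *\<^sub>R j) \<omega> \<partial>M)" by (intro Bochner_Integration.integral_diff inta)
  also have "\<dots> = (spec_cov M X 0 - spec_cov M X (t *\<^sub>R j)) * (1 - \<bar>t\<bar>)"
    unfolding a_def using spec_cov_window[OF st _ U'(2)] U'(1) by (simp add: mU' left_diff_distrib)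
  finally have F: "(\<integral>\<omega>. f \<omega> \<partial>M) = (spec_cov M X 0 - spec_cov M X (t *\<^sub>R j)) * (1 - \<bar>t\<bar>)" .
  have fnn: "0 \<le> f \<omega>" for \<omega> by (simp add: f_def)
  have If: "0 \<le> (\<integral>\<omega>. f \<omega> \<partial>M)" using fnn by simp
  have "ennreal ((\<integral>\<omega>. f \<omega> \<partial>M) / \<bar>t\<bar>) = (\<integral>\<^sup>+\<omega>. ennreal (f \<omega> / \<bar>t\<bar>) \<partial>M)"
    using intf fnn by (subst nn_integral_eq_integral) auto
  also have "\<dots> \<le> spec_per M X"
    unfolding spec_per_def
  proof (rule nn_integral_mono)
    fix \<omega> assume w: "\<omega> \<in> space M"
    have "ennreal (f \<omega>) \<le> ennreal \<bar>t\<bar> * Per (X \<omega>) (box 0 One)"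
      unfolding f_def by (rule measure_diff_transl_le_Per) (use XL[OF w] U' j t UU in auto)
    then have "ennreal (f \<omega>) / ennreal \<bar>t\<bar> \<le> Per (X \<omega>) (box 0 One)"
      using t by (subst divide_le_posI_ennreal) auto
    then show "ennreal (f \<omega> / \<bar>t\<bar>) \<le> Per (X \<omega>) (box 0 One)"
      using t fnn by (simp add: divide_ennreal)
  qed
  finally have "(\<integral>\<omega>. f \<omega> \<partial>M) / \<bar>t\<bar> \<le> enn2real (spec_per M X)"
    using If per by (metis enn2real_ennreal enn2real_mono divide_nonneg_nonneg abs_ge_zero infinity_ennreal_def)
  then have "(spec_cov M X 0 - spec_cov M X (t *\<^sub>R j)) * (1 - \<bar>t\<bar>) \<le> enn2real (spec_per M X) * \<bar>t\<bar>"
    using t F by (simp add: field_simps)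
  moreover have nn: "0 \<le> spec_cov M X 0 - spec_cov M X (t *\<^sub>R j)"
    using If t unfolding F by (simp add: zero_le_mult_iff)
  moreover have "(spec_cov M X 0 - spec_cov M X (t *\<^sub>R j)) * (1 / 2) \<le> (spec_cov M X 0 - spec_cov M X (t *\<^sub>R j)) * (1 - \<bar>t\<bar>)"
    using nn t by (intro mult_left_mono) auto
  ultimately have "(spec_cov M X 0 - spec_cov M X (t *\<^sub>R j)) * (1 / 2) \<le> enn2real (spec_per M X) * \<bar>t\<bar>"
    by (meson order_trans)
  then show ?thesis using nn by (simp add: abs_if mult.assoc)
qed

lemma spec_per_finite_imp_Lip:
  fixes X :: "'w \<Rightarrow> 'a::euclidean_space set"
  assumes st: "stationary_rams M X" and per: "spec_per M X < \<infinity>" and j: "j \<in> Basis"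
    and S2: "\<And>y. S2 y = spec_cov M X y"
  shows "Lip_dir S2 0 j < \<infinity>"
proof -
  \<comment> \<open>The 2 covers \<open>\<bar>t\<bar> > 1 / 2\<close>, where the quotient is at most
    \<open>1 / \<bar>t\<bar>\<close> because the covariogram takes values between 0 and 1.\<close>
  define C where "C = max 2 (2 * enn2real (spec_per M X))"
  have "\<bar>S2 (0 + t *\<^sub>R j) - S2 0\<bar> / \<bar>t\<bar> \<le> C" if t: "t \<noteq> 0" for t
  proof (cases "\<bar>t\<bar> \<le> 1 / 2")
    case True
    have "\<bar>S2 (0 + t *\<^sub>R j) - S2 0\<bar> \<le> 2 * enn2real (spec_per M X) * \<bar>t\<bar>"
      using spec_cov_increment[OF st per j t True] by (simp add: S2)
    then have "\<bar>S2 (0 + t *\<^sub>R j) - S2 0\<bar> / \<bar>t\<bar> \<le> 2 * enn2real (spec_per M X)"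
      using t by (simp add: field_simps)
    then show ?thesis by (simp add: C_def)
  next
    case False
    have "\<bar>S2 (0 + t *\<^sub>R j) - S2 0\<bar> \<le> 1"
      using spec_cov_bounds[OF st, of "0 + t *\<^sub>R j"] spec_cov_bounds[OF st, of 0] by (simp add: S2)
    also have "1 \<le> 2 * \<bar>t\<bar>" using False by simp
    finally have "\<bar>S2 (0 + t *\<^sub>R j) - S2 0\<bar> / \<bar>t\<bar> \<le> 2" using t by (simp add: field_simps)
    then show ?thesis by (simp add: C_def)
  qed
  then have "Lip_dir S2 0 j \<le> ereal C"
    unfolding Lip_dir_def by (intro SUP_least) auto
  then show ?thesis by auto
qed

section \<open>Finiteness of the specific perimeter\<close>

text \<open>Inclusion and exclusion, with the volume of the translate in \<open>B\<close> rewritten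
  as the volume of \<open>A\<close> in the shifted window. Writing \<open>A\<close> as
  \<open>A \<inter> transl 0 A\<close> puts every term into the form whose expectation
  \<open>spec_cov_window\<close> evaluates.\<close>

lemma measure_sym_diff_transl:
  fixes A :: "'a::euclidean_space set"
  assumes A: "A \<in> sets lebesgue" and B: "B \<in> sets lebesgue" "bounded B"
  shows "measure lebesgue (sym_diff A (transl y A) \<inter> B)
    = measure lebesgue (A \<inter> transl 0 A \<inter> B) + measure lebesgue (A \<inter> transl 0 A \<inter> transl (- y) B)
      - 2 * measure lebesgue (A \<inter> transl y A \<inter> B)"
proof -
  let ?P = "A \<inter> B" and ?Q = "transl y A \<inter> B" and ?R = "A \<inter> transl y A \<inter> B"
  have yA: "transl y A \<in> sets lebesgue" using A by (rule transl_lebesgue)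
  have m: "?P \<in> lmeasurable" "?Q \<in> lmeasurable" "?R \<in> lmeasurable"
    using A yA B by (auto intro!: lmeasurable_Int_bounded)
  have "measure lebesgue (sym_diff A (transl y A) \<inter> B) = measure lebesgue ((?P - ?R) \<union> (?Q - ?R))"
    by (intro arg_cong[where f="measure lebesgue"]) auto
  also have "\<dots> = measure lebesgue (?P - ?R) + measure lebesgue ((?Q - ?R) - (?P - ?R))"
    using m by (intro measure_Un2) auto
  also have "(?Q - ?R) - (?P - ?R) = ?Q - ?R" by auto
  also have "measure lebesgue (?P - ?R) = measure lebesgue ?P - measure lebesgue ?R"
    using m by (intro measurable_measure_Diff) (auto simp: fmeasurableD)
  also have "measure lebesgue (?Q - ?R) = measure lebesgue ?Q - measure lebesgue ?R"
    using m by (intro measurable_measure_Diff) (auto simp: fmeasurableD)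
  also have "measure lebesgue ?Q = measure lebesgue (transl y (A \<inter> transl (- y) B))"
    by (intro arg_cong[where f="measure lebesgue"]) (auto simp: transl_iff)
  finally show ?thesis by (simp add: measure_transl transl_0)
qed

text \<open>Membership in \<open>C1c_unit U\<close> controls the derivative on \<open>U\<close>
  only. Off the compact support the field vanishes on an open set, which settles the rest of the
  space.\<close>

lemma C1c_unit_derivative:
  fixes \<phi> :: "'a::euclidean_space \<Rightarrow> 'a"
  assumes \<phi>: "\<phi> \<in> C1c_unit U" and U: "open U"
  obtains K where "compact K" "K \<subseteq> U" "\<And>x. x \<notin> K \<Longrightarrow> \<phi> x = 0"
    "\<And>x. (\<phi> has_derivative frechet_derivative \<phi> (at x)) (at x)"
    "\<And>x i. x \<notin> K \<Longrightarrow> frechet_derivative \<phi> (at x) i = 0"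
proof -
  obtain K where K: "compact K" "K \<subseteq> U" "\<And>x. x \<notin> K \<Longrightarrow> \<phi> x = 0"
    using \<phi> unfolding C1c_unit_def by blast
  have out: "(\<phi> has_derivative (\<lambda>_. 0)) (at x)" if "x \<notin> K" for x
  proof (rule has_derivative_transform_within_open[of "\<lambda>_. 0" _ _ _ "- K"])
    show "open (- K)" using K(1) by (simp add: compact_imp_closed open_Compl)
  qed (use K that in auto)
  have "(\<phi> has_derivative frechet_derivative \<phi> (at x)) (at x)" for x
  proof (cases "x \<in> K")
    case True
    then have "\<phi> differentiable (at x)" using \<phi> K unfolding C1c_unit_def by blast
    then show ?thesis by (simp add: frechet_derivative_works)
  next
    case False
    then show ?thesis using out[OF False] frechet_derivative_at by metis
  qed
  moreover have "frechet_derivative \<phi> (at x) i = 0" if "x \<notin> K" for x i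
    using frechet_derivative_at[OF out[OF that]] by metis
  ultimately show ?thesis using K that by blast
qed

text \<open>For one test field, the divergence is the limit of the sums of forward difference
  quotients \<open>q\<close>. A change of variables moves each difference from the field to the
  indicator of \<open>A\<close>; as \<open>\<bar>\<phi> x \<bullet> j\<bar> \<le> 1\<close>, only
  the volume of the symmetric difference inside \<open>U\<close> remains. Since the bound does not
  involve the field, the supremum may be taken.\<close>

lemma Per_le_liminf:
  fixes A :: "'a::euclidean_space set"
  assumes A: "A \<in> sets lebesgue" and U: "open U" "bounded U"
  shows "Per A U \<le> liminf (\<lambda>k. ennreal (\<Sum>j\<in>Basis. 2 ^ k * measure lebesgue (sym_diff A (transl ((1 / 2 ^ k) *\<^sub>R j) A) \<inter> U)))"
  unfolding Per_def
proof (rule SUP_least)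
  fix \<phi> :: "'a \<Rightarrow> 'a" assume \<phi>: "\<phi> \<in> C1c_unit U"
  obtain K where K: "compact K" "K \<subseteq> U" "\<And>x. x \<notin> K \<Longrightarrow> \<phi> x = 0"
    and d: "\<And>x. (\<phi> has_derivative frechet_derivative \<phi> (at x)) (at x)"
    and d0: "\<And>x i. x \<notin> K \<Longrightarrow> frechet_derivative \<phi> (at x) i = 0"
    using C1c_unit_derivative[OF \<phi> U(1)] by metis
  have \<phi>1: "norm (\<phi> x) \<le> 1" for x using \<phi> by (simp add: C1c_unit_def)
  have \<phi>U: "\<phi> x = 0" if "x \<notin> U" for x using K(2,3) that by blast
  define D where "D j x = frechet_derivative \<phi> (at x) j \<bullet> j" for j x
  have div: "divergence \<phi> x = (\<Sum>j\<in>Basis. D j x)" for x by (simp add: divergence_def D_def)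
  have "\<exists>B. \<forall>x. \<bar>D j x\<bar> \<le> B" if j: "j \<in> Basis" for j
  proof -
    have "continuous_on U (D j)" using \<phi> j unfolding C1c_unit_def D_def by (auto intro!: continuous_intros)
    then have "compact (D j ` K)"
      using compact_continuous_image[OF continuous_on_subset[OF _ K(2)] K(1)] by blast
    then obtain B where "\<forall>z\<in>D j ` K. norm z \<le> B" using compact_imp_bounded bounded_iff by blast
    then have "\<bar>D j x\<bar> \<le> B" if "x \<in> K" for x using that by simp
    then have "\<bar>D j x\<bar> \<le> max B 0" for x using d0[of x j] by (cases "x \<in> K") (auto simp: D_def intro: max.coboundedI1)
    then show ?thesis by blast
  qed
  then obtain B where B: "\<And>j x. j \<in> Basis \<Longrightarrow> \<bar>D j x\<bar> \<le> B j" by metis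
  have DU: "D j x = 0" if "x \<notin> U" for j x
  proof -
    have "x \<notin> K" using K(2) that by blast
    then show ?thesis by (simp add: D_def d0)
  qed
  define h where "h k = (1 / 2 ^ k :: real)" for k
  have hpos: "0 < h k" for k by (simp add: h_def)
  have hle: "h k \<le> 1" for k by (simp add: h_def)
  have h0: "h \<longlonglongrightarrow> 0" unfolding h_def by (rule LIMSEQ_divide_realpow_zero) simp
  define q where "q k j x = (\<phi> (x + h k *\<^sub>R j) \<bullet> j - \<phi> x \<bullet> j) / h k" for k j x
  have gd: "((\<lambda>s. \<phi> (x + s *\<^sub>R j) \<bullet> j) has_real_derivative D j (x + s *\<^sub>R j)) (at s)" for x j s
  proof -
    have "((\<lambda>s. x + s *\<^sub>R j) has_derivative (\<lambda>r. r *\<^sub>R j)) (at s)" by (auto intro!: derivative_eq_intros)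
    from has_derivative_compose[OF this d]
    have "((\<lambda>s. \<phi> (x + s *\<^sub>R j)) has_derivative (\<lambda>r. frechet_derivative \<phi> (at (x + s *\<^sub>R j)) (r *\<^sub>R j))) (at s)" .
    then have "((\<lambda>s. \<phi> (x + s *\<^sub>R j) \<bullet> j) has_derivative (\<lambda>r. frechet_derivative \<phi> (at (x + s *\<^sub>R j)) (r *\<^sub>R j) \<bullet> j)) (at s)"
      by (intro has_derivative_inner_left)
    moreover have "frechet_derivative \<phi> (at (x + s *\<^sub>R j)) (r *\<^sub>R j) \<bullet> j = D j (x + s *\<^sub>R j) * r" for r
      using linear_scale[OF has_derivative_linear[OF d]] by (simp add: D_def)
    ultimately show ?thesis by (simp add: has_field_derivative_def)
  qed
  \<comment> \<open>The mean value theorem bounds the quotients uniformly in \<open>k\<close> by the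
    bound for the derivative; this supplies the dominating function.\<close>
  have qB: "\<bar>q k j x\<bar> \<le> B j" if j: "j \<in> Basis" for k j x
  proof -
    obtain z where "0 < z" "z < h k" "\<phi> (x + h k *\<^sub>R j) \<bullet> j - \<phi> (x + 0 *\<^sub>R j) \<bullet> j = (h k - 0) * D j (x + z *\<^sub>R j)"
      using MVT2[OF hpos[of k], of "\<lambda>s. \<phi> (x + s *\<^sub>R j) \<bullet> j" "\<lambda>s. D j (x + s *\<^sub>R j)"] gd by blast
    then have "q k j x = D j (x + z *\<^sub>R j)" using hpos[of k] by (simp add: q_def)
    then show ?thesis using B[OF j] by simp
  qed
  have qlim: "(\<lambda>k. q k j x) \<longlonglongrightarrow> D j x" for j x
  proof -
    have "((\<lambda>s. (\<phi> (x + (0 + s) *\<^sub>R j) \<bullet> j - \<phi> (x + 0 *\<^sub>R j) \<bullet> j) / s) \<longlongrightarrow> D j (x + 0 *\<^sub>R j)) (at 0)"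
      using gd[of x j 0] unfolding DERIV_def .
    moreover have "filterlim h (at 0) sequentially"
      using h0 hpos by (auto simp: filterlim_at intro!: always_eventually) (metis less_irrefl)
    ultimately have "(\<lambda>k. (\<phi> (x + (0 + h k) *\<^sub>R j) \<bullet> j - \<phi> (x + 0 *\<^sub>R j) \<bullet> j) / h k) \<longlonglongrightarrow> D j (x + 0 *\<^sub>R j)"
      by (rule filterlim_compose)
    then show ?thesis by (simp add: q_def)
  qed
  have c\<phi>: "continuous_on UNIV \<phi>" using d has_derivative_continuous by (blast intro: continuous_at_imp_continuous_on)
  have \<phi>m: "(\<lambda>x. \<phi> x \<bullet> j) \<in> borel_measurable lebesgue" for j
    by (intro measurable_completion) (use c\<phi> in \<open>auto intro!: borel_measurable_continuous_onI continuous_intros\<close>)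
  have UL: "U \<in> lmeasurable" using U by (intro bounded_set_imp_lmeasurable) auto
  have int: "integrable lebesgue (\<lambda>x. indicator C x * (\<phi> x \<bullet> j))" if "C \<in> sets lebesgue" "j \<in> Basis" for C :: "'a set" and j
  proof (rule Bochner_Integration.integrable_bound[of _ "indicator U :: 'a \<Rightarrow> real"])
    show "integrable lebesgue (indicator U :: 'a \<Rightarrow> real)" using UL by (simp add: lmeasurable_iff_integrable)
    show "(\<lambda>x. indicator C x * (\<phi> x \<bullet> j)) \<in> borel_measurable lebesgue" using that \<phi>m by simp
    have "\<bar>indicator C x * (\<phi> x \<bullet> j)\<bar> \<le> indicator U x" for x
    proof (cases "x \<in> U")
      case True
      have "\<bar>\<phi> x \<bullet> j\<bar> \<le> 1" using Basis_le_norm[OF that(2), of "\<phi> x"] \<phi>1[of x] by linarith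
      then show ?thesis using True by (auto simp: indicator_def)
    next
      case False
      then show ?thesis by (simp add: \<phi>U)
    qed
    then show "AE x in lebesgue. norm (indicator C x * (\<phi> x \<bullet> j)) \<le> norm (indicator U x :: real)" by (intro AE_I2) simp
  qed
  have tr: "indicator A x * (\<phi> (x + v) \<bullet> j) = (\<lambda>x. indicator (transl v A) x * (\<phi> x \<bullet> j)) (v + x)" for x v j
    by (auto simp: indicator_def transl_iff add.commute)
  have int2: "integrable lebesgue (\<lambda>x. indicator A x * (\<phi> (x + v) \<bullet> j))" if "j \<in> Basis" for j v
    unfolding tr using int[OF transl_lebesgue[OF A] that] integrable_distr_eq[OF measurable_translation_lebesgue[of v], of "\<lambda>x. indicator (transl v A) x * (\<phi> x \<bullet> j)"]
    by (simp add: distr_lebesgue_translation)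
  have qint: "(\<integral>x. indicator A x * q k j x \<partial>lebesgue) \<le> 2 ^ k * measure lebesgue (sym_diff A (transl (h k *\<^sub>R j) A) \<inter> U)"
    and qi: "integrable lebesgue (\<lambda>x. indicator A x * q k j x)" if j: "j \<in> Basis" for k j
  proof -
    let ?v = "h k *\<^sub>R j" and ?S = "sym_diff A (transl (h k *\<^sub>R j) A) \<inter> U"
    have vA: "transl ?v A \<in> sets lebesgue" using A by (rule transl_lebesgue)
    have S: "?S \<in> lmeasurable" using A vA U by (intro lmeasurable_Int_bounded) auto
    have qe: "indicator A x * q k j x = (indicator A x * (\<phi> (x + ?v) \<bullet> j) - indicator A x * (\<phi> x \<bullet> j)) / h k" for x
      by (simp add: q_def right_diff_distrib)
    show "integrable lebesgue (\<lambda>x. indicator A x * q k j x)"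
      unfolding qe by (intro integrable_divide_zero Bochner_Integration.integrable_diff int2 int A j)
    have "(\<integral>x. indicator A x * q k j x \<partial>lebesgue) = ((\<integral>x. indicator A x * (\<phi> (x + ?v) \<bullet> j) \<partial>lebesgue) - (\<integral>x. indicator A x * (\<phi> x \<bullet> j) \<partial>lebesgue)) / h k"
      unfolding qe using int2[OF j, of ?v] int[OF A j] by simp
    also have "(\<integral>x. indicator A x * (\<phi> (x + ?v) \<bullet> j) \<partial>lebesgue) = (\<integral>x. indicator (transl ?v A) x * (\<phi> x \<bullet> j) \<partial>lebesgue)"
      unfolding tr using int[OF vA j]
      by (subst integral_lebesgue_translation[of "\<lambda>x. indicator (transl ?v A) x * (\<phi> x \<bullet> j)"]) auto
    also have "(\<integral>x. indicator (transl ?v A) x * (\<phi> x \<bullet> j) \<partial>lebesgue) - (\<integral>x. indicator A x * (\<phi> x \<bullet> j) \<partial>lebesgue)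
       = (\<integral>x. indicator (transl ?v A) x * (\<phi> x \<bullet> j) - indicator A x * (\<phi> x \<bullet> j) \<partial>lebesgue)"
      using int[OF vA j] int[OF A j] by simp
    also have "\<dots> \<le> (\<integral>x. indicator ?S x \<partial>lebesgue)"
    proof (rule integral_mono)
      show "integrable lebesgue (\<lambda>x. indicator (transl ?v A) x * (\<phi> x \<bullet> j) - indicator A x * (\<phi> x \<bullet> j))"
        using int[OF vA j] int[OF A j] by simp
      show "integrable lebesgue (indicator ?S :: 'a \<Rightarrow> real)" using S by (simp add: lmeasurable_iff_integrable)
      fix x
      have "\<bar>\<phi> x \<bullet> j\<bar> \<le> 1" using Basis_le_norm[OF j, of "\<phi> x"] \<phi>1[of x] by linarith
      moreover have "\<phi> x \<bullet> j = 0" if "x \<notin> U" using \<phi>U[OF that] by simp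
      ultimately show "indicator (transl ?v A) x * (\<phi> x \<bullet> j) - indicator A x * (\<phi> x \<bullet> j) \<le> indicator ?S x"
        by (auto simp: indicator_def abs_le_iff)
    qed
    also have "\<dots> = measure lebesgue ?S" using S by simp
    finally show "(\<integral>x. indicator A x * q k j x \<partial>lebesgue) \<le> 2 ^ k * measure lebesgue ?S"
      using hpos[of k] by (simp add: h_def divide_right_mono mult.commute)
  qed
  \<comment> \<open>Steps are at most 1, so for \<open>norm x > r + 1\<close> neither
    \<open>x\<close> nor \<open>x + h k *\<^sub>R j\<close> meets the support.\<close>
  obtain r where r: "\<And>x. x \<in> K \<Longrightarrow> norm x \<le> r" using compact_imp_bounded[OF K(1)] unfolding bounded_iff by blast
  have q0: "q k j x = 0" if "r + 1 < norm x" "j \<in> Basis" for k j x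
  proof -
    have "norm x \<le> norm (x + h k *\<^sub>R j) + norm (h k *\<^sub>R j)" using norm_triangle_ineq4[of "x + h k *\<^sub>R j" "h k *\<^sub>R j"] by simp
    also have "norm (h k *\<^sub>R j) \<le> 1" using hle[of k] hpos[of k] that by simp
    finally have "x + h k *\<^sub>R j \<notin> K" using r that by fastforce
    moreover have "x \<notin> K" using r that by fastforce
    ultimately show ?thesis using K(3) by (simp add: q_def)
  qed
  have "(\<lambda>k. \<integral>x. indicator A x * (\<Sum>j\<in>Basis. q k j x) \<partial>lebesgue) \<longlonglongrightarrow> (\<integral>x. indicator (A \<inter> U) x * divergence \<phi> x \<partial>lebesgue)"
  proof (rule integral_dominated_convergence[where w="\<lambda>x. (\<Sum>j\<in>Basis. B j) * indicator (cball 0 (r + 1)) x"])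
    have qm: "(\<lambda>x. indicator A x * (\<Sum>j\<in>Basis. q k j x)) \<in> borel_measurable lebesgue" for k
      unfolding sum_distrib_left by (intro borel_measurable_sum borel_measurable_integrable qi)
    then show "(\<lambda>x. indicator A x * (\<Sum>j\<in>Basis. q k j x)) \<in> borel_measurable lebesgue" for k .
    have lim: "(\<lambda>k. indicator A x * (\<Sum>j\<in>Basis. q k j x)) \<longlonglongrightarrow> indicator (A \<inter> U) x * divergence \<phi> x" for x
    proof -
      have "(\<lambda>k. indicator A x * (\<Sum>j\<in>Basis. q k j x)) \<longlonglongrightarrow> indicator A x * (\<Sum>j\<in>Basis. D j x)"
        by (intro tendsto_intros qlim)
      moreover have "indicator A x * (\<Sum>j\<in>Basis. D j x) = indicator (A \<inter> U) x * divergence \<phi> x"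
        by (cases "x \<in> U") (simp_all add: indicator_def div DU)
      ultimately show ?thesis by simp
    qed
    then show "AE x in lebesgue. (\<lambda>k. indicator A x * (\<Sum>j\<in>Basis. q k j x)) \<longlonglongrightarrow> indicator (A \<inter> U) x * divergence \<phi> x" by simp
    show "(\<lambda>x. indicator (A \<inter> U) x * divergence \<phi> x) \<in> borel_measurable lebesgue"
      by (rule borel_measurable_LIMSEQ_real[OF lim qm])
    show "integrable lebesgue (\<lambda>x. (\<Sum>j\<in>Basis. B j) * indicator (cball 0 (r + 1)) x)"
      by (intro integrable_mult_right) (simp add: lmeasurable_iff_integrable[symmetric])
    have "norm (indicator A x * (\<Sum>j\<in>Basis. q k j x)) \<le> (\<Sum>j\<in>Basis. B j) * indicator (cball 0 (r + 1)) x" for k x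
    proof (cases "r + 1 < norm x")
      case True
      then show ?thesis using q0 by (simp add: indicator_def)
    next
      case False
      have "\<bar>\<Sum>j\<in>Basis. q k j x\<bar> \<le> (\<Sum>j\<in>Basis. B j)"
        by (rule order_trans[OF sum_abs sum_mono]) (rule qB)
      then show ?thesis using False by (auto simp: indicator_def abs_mult)
    qed
    then show "AE x in lebesgue. norm (indicator A x * (\<Sum>j\<in>Basis. q k j x)) \<le> (\<Sum>j\<in>Basis. B j) * indicator (cball 0 (r + 1)) x" for k by simp
  qed
  then have "(\<lambda>k. ennreal (\<integral>x. indicator A x * (\<Sum>j\<in>Basis. q k j x) \<partial>lebesgue)) \<longlonglongrightarrow> ennreal (\<integral>x. indicator (A \<inter> U) x * divergence \<phi> x \<partial>lebesgue)"
    by (rule tendsto_ennrealI)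
  then have "ennreal (\<integral>x. indicator (A \<inter> U) x * divergence \<phi> x \<partial>lebesgue) = liminf (\<lambda>k. ennreal (\<integral>x. indicator A x * (\<Sum>j\<in>Basis. q k j x) \<partial>lebesgue))"
    by (intro lim_imp_Liminf[symmetric]) auto
  also have "\<dots> \<le> liminf (\<lambda>k. ennreal (\<Sum>j\<in>Basis. 2 ^ k * measure lebesgue (sym_diff A (transl ((1 / 2 ^ k) *\<^sub>R j) A) \<inter> U)))"
  proof (intro Liminf_mono always_eventually allI ennreal_leI)
    fix k
    have "(\<integral>x. indicator A x * (\<Sum>j\<in>Basis. q k j x) \<partial>lebesgue) = (\<Sum>j\<in>Basis. \<integral>x. indicator A x * q k j x \<partial>lebesgue)"
      unfolding sum_distrib_left by (rule Bochner_Integration.integral_sum) (rule qi)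
    also have "\<dots> \<le> (\<Sum>j\<in>Basis. 2 ^ k * measure lebesgue (sym_diff A (transl (h k *\<^sub>R j) A) \<inter> U))"
      by (intro sum_mono qint)
    finally show "(\<integral>x. indicator A x * (\<Sum>j\<in>Basis. q k j x) \<partial>lebesgue) \<le> (\<Sum>j\<in>Basis. 2 ^ k * measure lebesgue (sym_diff A (transl ((1 / 2 ^ k) *\<^sub>R j) A) \<inter> U))"
      by (simp add: h_def)
  qed
  finally show "ennreal (\<integral>x. indicator (A \<inter> U) x * divergence \<phi> x \<partial>lebesgue)
    \<le> liminf (\<lambda>k. ennreal (\<Sum>j\<in>Basis. 2 ^ k * measure lebesgue (sym_diff A (transl ((1 / 2 ^ k) *\<^sub>R j) A) \<inter> U)))" .
qed

text \<open>The mean volume of the symmetric difference of \<open>X\<close> and its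
  \<open>y\<close>-translate in the unit cube is
  \<open>2 * (spec_cov M X 0 - spec_cov M X y)\<close>. For \<open>y\<close> of length
  \<open>1 / 2 ^ k\<close> the Lipschitz bound cancels the factor \<open>2 ^ k\<close> in
  \<open>G\<close>, so the expectations of \<open>G k\<close> are bounded uniformly in
  \<open>k\<close>.\<close>

lemma spec_per_finite:
  fixes X :: "'w \<Rightarrow> 'a::euclidean_space set"
  assumes st: "stationary_rams M X" and C: "0 \<le> C"
    and lip: "\<And>j t. j \<in> Basis \<Longrightarrow> spec_cov M X 0 - spec_cov M X (t *\<^sub>R j) \<le> C * \<bar>t\<bar>"
  shows "spec_per M X < \<infinity>"
proof -
  have X[measurable]: "X \<in> M \<rightarrow>\<^sub>M rams_space" using st by (auto simp: stationary_rams_def)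
  interpret prob_space M using st by (auto simp: stationary_rams_def)
  have XL: "X \<omega> \<in> sets lebesgue" if "\<omega> \<in> space M" for \<omega>
    using measurable_space[OF X that] by simp
  let ?Q = "box 0 One :: 'a set"
  define V where "V y \<omega> = measure lebesgue (sym_diff (X \<omega>) (transl y (X \<omega>)) \<inter> ?Q)" for y \<omega>
  define a where "a y B \<omega> = measure lebesgue (X \<omega> \<inter> transl y (X \<omega>) \<inter> B)" for y B \<omega>
  have Va: "V y \<omega> = a 0 ?Q \<omega> + a 0 (transl (- y) ?Q) \<omega> - 2 * a y ?Q \<omega>" if "\<omega> \<in> space M" for y \<omega>
    unfolding V_def a_def by (rule measure_sym_diff_transl[OF XL[OF that]]) auto
  have Qb: "transl v ?Q \<in> sets borel" "bounded (transl v ?Q)" for v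
    by (auto intro!: borel_open open_transl bounded_transl)
  have ia: "integrable M (a y B)" if "B \<in> sets borel" "bounded B" for y B
    unfolding a_def by (rule integrable_window[OF prob_space_axioms X that])
  have Ea: "expectation (a y B) = spec_cov M X y * measure lebesgue B" if "B \<in> sets borel" "bounded B" for y B
    unfolding a_def by (rule spec_cov_window[OF st that])
  have iV: "integrable M (V y)" and EV: "expectation (V y) = 2 * (spec_cov M X 0 - spec_cov M X y)" for y
  proof -
    have i: "integrable M (\<lambda>\<omega>. a 0 ?Q \<omega> + a 0 (transl (- y) ?Q) \<omega> - 2 * a y ?Q \<omega>)"
      using ia[of ?Q] ia[OF Qb] by auto
    then show "integrable M (V y)" by (subst Bochner_Integration.integrable_cong[OF refl Va]) auto
    have "expectation (V y) = expectation (\<lambda>\<omega>. a 0 ?Q \<omega> + a 0 (transl (- y) ?Q) \<omega> - 2 * a y ?Q \<omega>)"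
      by (intro Bochner_Integration.integral_cong refl Va)
    also have "\<dots> = expectation (a 0 ?Q) + expectation (a 0 (transl (- y) ?Q)) - 2 * expectation (a y ?Q)"
      using ia[of ?Q] ia[OF Qb] by simp
    also have "\<dots> = 2 * (spec_cov M X 0 - spec_cov M X y)"
      using Ea[of ?Q] Ea[OF Qb] by (simp add: measure_transl)
    finally show "expectation (V y) = 2 * (spec_cov M X 0 - spec_cov M X y)" .
  qed
  define G where "G k \<omega> = (\<Sum>j\<in>Basis. 2 ^ k * V ((1 / 2 ^ k) *\<^sub>R j) \<omega>)" for k \<omega>
  have Gnn: "0 \<le> G k \<omega>" for k \<omega> unfolding G_def V_def by (intro sum_nonneg) auto
  have Gi: "integrable M (G k)" for k unfolding G_def using iV by auto
  have EG: "(\<integral>\<^sup>+\<omega>. ennreal (G k \<omega>) \<partial>M) \<le> ennreal (\<Sum>j\<in>(Basis::'a set). 2 * C)" for k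
  proof -
    have "(\<integral>\<^sup>+\<omega>. ennreal (G k \<omega>) \<partial>M) = ennreal (expectation (G k))"
      using Gi Gnn by (intro nn_integral_eq_integral) auto
    also have "expectation (G k) = (\<Sum>j\<in>Basis. 2 ^ k * expectation (V ((1 / 2 ^ k) *\<^sub>R j)))"
      unfolding G_def using iV by (subst Bochner_Integration.integral_sum) auto
    also have "\<dots> \<le> (\<Sum>j\<in>(Basis::'a set). 2 * C)"
    proof (rule sum_mono)
      fix j :: 'a assume "j \<in> Basis"
      then have "2 ^ k * expectation (V ((1 / 2 ^ k) *\<^sub>R j)) \<le> 2 ^ k * (2 * (C * (1 / 2 ^ k)))"
        using lip[of j "1 / 2 ^ k"] unfolding EV by (intro mult_left_mono) auto
      then show "2 ^ k * expectation (V ((1 / 2 ^ k) *\<^sub>R j)) \<le> 2 * C" by simp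
    qed
    finally show ?thesis by (simp add: ennreal_leI)
  qed
  have "spec_per M X \<le> (\<integral>\<^sup>+\<omega>. liminf (\<lambda>k. ennreal (G k \<omega>)) \<partial>M)"
    unfolding spec_per_def
  proof (rule nn_integral_mono)
    fix \<omega> assume "\<omega> \<in> space M"
    then show "Per (X \<omega>) ?Q \<le> liminf (\<lambda>k. ennreal (G k \<omega>))"
      unfolding G_def V_def by (intro Per_le_liminf XL) auto
  qed
  also have "\<dots> \<le> liminf (\<lambda>k. \<integral>\<^sup>+\<omega>. ennreal (G k \<omega>) \<partial>M)"
    using Gi by (intro nn_integral_liminf) auto
  also have "\<dots> \<le> liminf (\<lambda>k::nat. ennreal (\<Sum>j\<in>(Basis::'a set). 2 * C))"
    by (intro Liminf_mono always_eventually allI EG)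
  also have "\<dots> = ennreal (\<Sum>j\<in>(Basis::'a set). 2 * C)" by (rule Liminf_const) simp
  also have "\<dots> < \<infinity>" by simp
  finally show ?thesis .
qed

section \<open>Consequences of admissibility\<close>

text \<open>\<open>admissible\<close> is phrased with nonempty initial segments of the naturals;
  concrete tests are easier to state over arbitrary finite index sets. For the empty one, the test
  set \<open>{}\<close> already gives \<open>0 \<le> c\<close>.\<close>

lemma admissible_S2_finite:
  fixes S2 :: "'a::euclidean_space \<Rightarrow> real"
  assumes adm: "admissible_S2 S2" and I: "finite I" and W: "\<And>i. i \<in> I \<Longrightarrow> W i \<in> Wsets"
    and nn: "\<And>A. A \<in> sets lebesgue \<Longrightarrow> 0 \<le> c + (\<Sum>i\<in>I. a i * delta (y i) (W i) A)"
  shows "0 \<le> c + (\<Sum>i\<in>I. a i * (S2 (y i) * measure lebesgue (W i)))"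
proof (cases "I = {}")
  case True
  then show ?thesis using nn[of "{}"] by simp
next
  case False
  obtain h where h: "bij_betw h {0..<card I} I" using ex_bij_betw_nat_finite[OF I] by blast
  then have h': "bij_betw h {..<card I} I" by (simp add: lessThan_atLeast0)
  have W': "\<forall>i<card I. W (h i) \<in> Wsets" using bij_betwE[OF h'] W by auto
  have re: "(\<Sum>i<card I. f (h i)) = sum f I" for f :: "_ \<Rightarrow> real" by (rule sum.reindex_bij_betw[OF h'])
  have "\<forall>A\<in>sets lebesgue. 0 \<le> c + (\<Sum>i<card I. (a \<circ> h) i * delta ((y \<circ> h) i) ((W \<circ> h) i) A)"
    using nn re[of "\<lambda>i. a i * delta (y i) (W i) _"] by simp
  moreover have "1 \<le> card I" using False I by (simp add: Suc_le_eq card_gt_0_iff)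
  ultimately have "0 \<le> c + (\<Sum>i<card I. (a \<circ> h) i * (S2 ((y \<circ> h) i) * measure lebesgue ((W \<circ> h) i)))"
    using adm[unfolded admissible_S2_def admissible_def, rule_format, of "card I" "W \<circ> h" c "a \<circ> h" "y \<circ> h"] W' by simp
  then show ?thesis using re[of "\<lambda>i. a i * (S2 (y i) * measure lebesgue (W i))"] by simp
qed

lemma box_Wsets: "box a b \<in> Wsets"
  by (auto simp: Wsets_def negligible_iff_null_sets[symmetric] intro!: negligible_convex_frontier)

lemma transl_Wsets: "W \<in> Wsets \<Longrightarrow> transl v W \<in> Wsets"
  unfolding Wsets_def negligible_iff_null_sets[symmetric]
  using open_transl[of W v] bounded_transl[of W v]
  by (auto simp: transl_eq_image frontier_translation negligible_translation)

text \<open>Brings tests on different windows back to one common window, where they can be compared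
  pointwise.\<close>

lemma delta_transl: "delta y (transl v W) A = measure lebesgue (transl (- v) A \<inter> transl (y - v) A \<inter> W)"
proof -
  have "delta y (transl v W) A = measure lebesgue (transl v (transl (- v) A \<inter> transl (y - v) A \<inter> W))"
    unfolding delta_def by (intro arg_cong[where f="measure lebesgue"]) (auto simp: transl_iff)
  then show ?thesis by (simp add: measure_transl)
qed

lemma admissible_S2_bounds:
  fixes S2 :: "'a::euclidean_space \<Rightarrow> real"
  assumes adm: "admissible_S2 S2"
  shows "0 \<le> S2 y" "S2 y \<le> 1"
proof -
  have d: "0 \<le> delta y (box 0 One) A" "delta y (box 0 One) A \<le> 1" if "A \<in> sets lebesgue" for A :: "'a set"
  proof -
    have "delta y (box 0 One) A \<le> measure lebesgue (box 0 (One::'a))"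
      unfolding delta_def using that
      by (intro measure_mono_fmeasurable) (auto intro!: sets.Int transl_lebesgue)
    then show "delta y (box 0 One) A \<le> 1" by simp
  qed (simp add: delta_def)
  show "0 \<le> S2 y"
    using admissible_S2_finite[OF adm, of "{()}" "\<lambda>_. box 0 One" 0 "\<lambda>_. 1" "\<lambda>_. y"] d by (simp add: box_Wsets)
  show "S2 y \<le> 1"
    using admissible_S2_finite[OF adm, of "{()}" "\<lambda>_. box 0 One" 1 "\<lambda>_. -1" "\<lambda>_. y"] d by (simp add: box_Wsets)
qed

text \<open>After adding the volume of \<open>A\<close> in \<open>W\<close> and rearranging, this is
  the one-sided triangle inequality for \<open>A - C\<close>, \<open>A - B\<close> and
  \<open>B - C\<close> inside \<open>W\<close>. The form with intersections is the one that
  \<open>delta\<close> can express.\<close>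

lemma measure_Int_triangle:
  assumes "A \<in> sets lebesgue" "B \<in> sets lebesgue" "C \<in> sets lebesgue" "W \<in> lmeasurable"
  shows "measure lebesgue (A \<inter> B \<inter> W) + measure lebesgue (C \<inter> B \<inter> W)
    \<le> measure lebesgue (B \<inter> W) + measure lebesgue (A \<inter> C \<inter> W)"
proof -
  let ?P = "A \<inter> B \<inter> W" and ?T = "C \<inter> B \<inter> W"
  have lm: "Z \<inter> W \<in> lmeasurable" if "Z \<in> sets lebesgue" for Z
    using that assms(4) by (metis fmeasurable_Int_fmeasurable inf_commute)
  have m: "?P \<in> lmeasurable" "?T \<in> lmeasurable" "B \<inter> W \<in> lmeasurable" "A \<inter> C \<inter> W \<in> lmeasurable"
    using assms lm by auto
  have "measure lebesgue ?P + measure lebesgue ?T = measure lebesgue (?P \<union> ?T) + measure lebesgue (?P \<inter> ?T)"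
    using measure_Un3[OF m(1,2)] by simp
  also have "\<dots> \<le> measure lebesgue (B \<inter> W) + measure lebesgue (A \<inter> C \<inter> W)"
    using m by (intro add_mono measure_mono_fmeasurable) (auto simp: fmeasurableD intro!: sets.Un)
  finally show ?thesis .
qed

text \<open>For a random set with pair probabilities \<open>S2\<close>, the number
  \<open>S2 0 - S2 h\<close> is the chance that a point belongs to it while its
  \<open>h\<close>-shift does not, and the estimate is a triangle inequality for such chances. No
  random set is available at this stage, so the inequality is tested on every deterministic
  \<open>A\<close>, with windows shifted to imitate stationarity.\<close>

lemma admissible_S2_increment:
  fixes S2 :: "'a::euclidean_space \<Rightarrow> real"
  assumes adm: "admissible_S2 S2"
  shows "\<bar>S2 (y + h) - S2 y\<bar> \<le> S2 0 - S2 h"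
proof -
  let ?Q = "box 0 One :: 'a set"
  have QW: "?Q \<in> Wsets" by (rule box_Wsets)
  have QL: "?Q \<in> lmeasurable" by simp
  \<comment> \<open>Signs for the shifts \<open>v\<close>, \<open>u\<close>, \<open>0\<close>,
    \<open>h\<close> listed in \<open>Y\<close> below. The last two windows are shifted so that all
    four tests refer to \<open>?Q\<close> after \<open>delta_transl\<close>.\<close>
  define a where "a i = [1, -1, 1, -1::real] ! i" for i
  have D0: "delta 0 (transl (- u) ?Q) A = measure lebesgue (transl u A \<inter> ?Q)" for u A
    unfolding delta_transl by simp
  have D1: "delta h (transl (- y) ?Q) A = measure lebesgue (transl y A \<inter> transl (y + h) A \<inter> ?Q)" for A
    unfolding delta_transl by (simp add: add.commute)
  have main: "0 \<le> S2 v - S2 u + S2 0 - S2 h" if uv: "(u, v) = (y, y + h) \<or> (u, v) = (y + h, y)" for u v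
  proof -
    define Y where "Y i = [v, u, 0, h] ! i" for i
    define W where "W i = [?Q, ?Q, transl (- u) ?Q, transl (- y) ?Q] ! i" for i
    have "0 \<le> 0 + (\<Sum>i\<in>{0..<4}. a i * (S2 (Y i) * measure lebesgue (W i)))"
    proof (rule admissible_S2_finite[OF adm])
      show "W i \<in> Wsets" if "i \<in> {0..<4}" for i
      proof -
        have "i = 0 \<or> i = 1 \<or> i = 2 \<or> i = 3" using that by auto
        then show ?thesis by (auto simp: W_def QW transl_Wsets)
      qed
      fix A :: "'a set" assume A: "A \<in> sets lebesgue"
      have "measure lebesgue (A \<inter> transl u A \<inter> ?Q) + measure lebesgue (transl v A \<inter> transl u A \<inter> ?Q)
        \<le> measure lebesgue (transl u A \<inter> ?Q) + measure lebesgue (A \<inter> transl v A \<inter> ?Q)"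
        by (intro measure_Int_triangle A transl_lebesgue QL)
      moreover have "transl v A \<inter> transl u A = transl y A \<inter> transl (y + h) A" using uv by auto
      ultimately have "delta u ?Q A + delta h (transl (- y) ?Q) A \<le> delta 0 (transl (- u) ?Q) A + delta v ?Q A"
        unfolding D0 D1 by (simp add: delta_def)
      then show "0 \<le> 0 + (\<Sum>i\<in>{0..<4}. a i * delta (Y i) (W i) A)"
        by (simp add: a_def Y_def W_def numeral_eq_Suc)
    qed simp
    then show ?thesis by (simp add: a_def Y_def W_def numeral_eq_Suc measure_transl)
  qed
  show ?thesis using main[of y "y + h"] main[of "y + h" y] by (auto simp: abs_le_iff)
qed

lemma admissible_Lip_imp_Lipschitz:
  fixes S2 :: "'a::euclidean_space \<Rightarrow> real"
  assumes adm: "admissible_S2 S2" and lip: "\<And>j. j \<in> Basis \<Longrightarrow> Lip_dir S2 0 j < \<infinity>"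
  obtains C where "0 \<le> C" "\<And>x y. \<bar>S2 x - S2 y\<bar> \<le> C * norm (x - y)"
proof -
  have "\<exists>c\<ge>0. \<forall>t. \<bar>S2 (t *\<^sub>R j) - S2 0\<bar> \<le> c * \<bar>t\<bar>" if j: "j \<in> Basis" for j
  proof -
    obtain c where c: "Lip_dir S2 0 j \<le> ereal c"
      using lip[OF j] by (cases "Lip_dir S2 0 j") auto
    have "\<bar>S2 (t *\<^sub>R j) - S2 0\<bar> \<le> max c 0 * \<bar>t\<bar>" for t
    proof (cases "t = 0")
      case False
      have "ereal (\<bar>S2 (0 + t *\<^sub>R j) - S2 0\<bar> / \<bar>t\<bar>) \<le> Lip_dir S2 0 j"
        unfolding Lip_dir_def using False by (intro SUP_upper) auto
      then have "\<bar>S2 (t *\<^sub>R j) - S2 0\<bar> / \<bar>t\<bar> \<le> c" using c order_trans by fastforce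
      then have "\<bar>S2 (t *\<^sub>R j) - S2 0\<bar> \<le> c * \<bar>t\<bar>" using False by (simp add: field_simps)
      also have "\<dots> \<le> max c 0 * \<bar>t\<bar>" by (intro mult_right_mono) auto
      finally show ?thesis .
    qed simp
    then show ?thesis by (intro exI[of _ "max c 0"]) auto
  qed
  then obtain c where c: "\<And>j. j \<in> Basis \<Longrightarrow> 0 \<le> c j"
    "\<And>j t. j \<in> Basis \<Longrightarrow> \<bar>S2 (t *\<^sub>R j) - S2 0\<bar> \<le> c j * \<bar>t\<bar>" by metis
  \<comment> \<open>One coordinate is changed at a time; \<open>admissible_S2_increment\<close>
    replaces each change, wherever it takes place, by a change at 0 along a canonical
    direction.\<close>
  have step: "\<bar>S2 (y + (\<Sum>b\<in>B. (w \<bullet> b) *\<^sub>R b)) - S2 y\<bar> \<le> (\<Sum>b\<in>B. c b * norm w)" if "finite B" "B \<subseteq> Basis" for B y w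
    using that
  proof (induction B)
    case (insert b B)
    have "\<bar>S2 (y + (\<Sum>b\<in>B. (w \<bullet> b) *\<^sub>R b) + (w \<bullet> b) *\<^sub>R b) - S2 (y + (\<Sum>b\<in>B. (w \<bullet> b) *\<^sub>R b))\<bar> \<le> S2 0 - S2 ((w \<bullet> b) *\<^sub>R b)"
      by (rule admissible_S2_increment[OF adm])
    also have "\<dots> \<le> c b * \<bar>w \<bullet> b\<bar>" using c(2)[of b "w \<bullet> b"] insert by auto
    also have "\<dots> \<le> c b * norm w" using c(1)[of b] insert by (intro mult_left_mono Basis_le_norm) auto
    finally show ?case using insert by (simp add: algebra_simps)
  qed simp
  show ?thesis
  proof (rule that[of "\<Sum>b\<in>Basis. c b"])
    show "0 \<le> (\<Sum>b\<in>Basis. c b)" using c by (intro sum_nonneg) auto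
    show "\<bar>S2 x - S2 y\<bar> \<le> (\<Sum>b\<in>Basis. c b) * norm (x - y)" for x y
      using step[of Basis y "x - y"] by (simp add: euclidean_representation sum_distrib_right)
  qed
qed

section \<open>Approximate solution of a moment problem\<close>

lemma expectation_bind_pmf:
  fixes f :: "'b \<Rightarrow> real"
  assumes "\<And>x. \<bar>f x\<bar> \<le> B"
  shows "measure_pmf.expectation (bind_pmf p q) f = measure_pmf.expectation p (\<lambda>x. measure_pmf.expectation (q x) f)"
  unfolding measure_pmf_bind
  by (rule integral_bind[where K="count_space UNIV" and B=B and B'=1])
     (use assms in \<open>auto simp: measure_pmf.emeasure_space_1 measure_pmf.finite_measure_axioms intro: measure_pmf_in_subprob_space\<close>)

text \<open>A separation argument without compactness: if the target is not approximable, an almost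
  minimiser of the squared distance yields a forbidden linear inequality.\<close>
lemma approx_moments_pmf:
  fixes g :: "'i \<Rightarrow> 's \<Rightarrow> real" and s :: "'i \<Rightarrow> real"
  assumes Y: "finite Y" and S: "S \<noteq> {}"
    and bd: "\<And>y \<sigma>. y \<in> Y \<Longrightarrow> \<bar>g y \<sigma>\<bar> \<le> 1"
    and adm: "\<And>c a. (\<And>\<sigma>. \<sigma> \<in> S \<Longrightarrow> 0 \<le> c + (\<Sum>y\<in>Y. a y * g y \<sigma>)) \<Longrightarrow> 0 \<le> c + (\<Sum>y\<in>Y. a y * s y)"
    and e: "0 < \<epsilon>"
  shows "\<exists>p. set_pmf p \<subseteq> S \<and> (\<forall>y\<in>Y. \<bar>measure_pmf.expectation p (g y) - s y\<bar> < \<epsilon>)"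
proof (rule ccontr)
  assume contr: "\<not> ?thesis"
  define E where "E p y = measure_pmf.expectation p (g y)" for p y
  define \<Phi> where "\<Phi> p = (\<Sum>y\<in>Y. (s y - E p y)\<^sup>2)" for p
  define P where "P = {p. set_pmf p \<subseteq> S}"
  define d where "d = Inf (\<Phi> ` P)"
  have \<Phi>e: "\<epsilon>\<^sup>2 \<le> \<Phi> p" if "p \<in> P" for p
  proof -
    obtain y where y: "y \<in> Y" "\<epsilon> \<le> \<bar>E p y - s y\<bar>"
      using contr \<open>p \<in> P\<close> unfolding P_def E_def by (auto simp: not_less)
    then have "\<epsilon>\<^sup>2 \<le> (s y - E p y)\<^sup>2"
      using e power_mono[of \<epsilon> "\<bar>E p y - s y\<bar>" 2] by (simp add: power2_commute)
    also have "\<dots> \<le> \<Phi> p" unfolding \<Phi>_def using Y y by (intro member_le_sum) auto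
    finally show ?thesis .
  qed
  obtain \<sigma>0 where "\<sigma>0 \<in> S" using S by blast
  then have Pne: "\<Phi> ` P \<noteq> {}" unfolding P_def by (auto intro!: exI[of _ "return_pmf \<sigma>0"])
  have bb: "bdd_below (\<Phi> ` P)" by (intro bdd_belowI2[of _ "\<epsilon>\<^sup>2"] \<Phi>e)
  have "\<epsilon>\<^sup>2 \<le> d" unfolding d_def using Pne \<Phi>e by (intro cInf_greatest) auto
  then have dpos: "0 < d" using e by (meson less_le_trans zero_less_power)
  \<comment> \<open>\<open>K\<close> balances the expansion below: the linear gain carries
    \<open>2 * t\<close>, while the costs are \<open>t\<^sup>2\<close> for not being an exact
    minimiser and \<open>4 * t\<^sup>2\<close> per coordinate for the quadratic term.
    \<open>t\<close> is then chosen so that \<open>t * K \<le> d / 2\<close>.\<close>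
  define K :: real where "K = (1 + 4 * card Y) / 2"
  have Kpos: "0 < K" by (simp add: K_def)
  define t where "t = min 1 (d / (2 * K))"
  have t: "0 < t" "t \<le> 1" "t * K \<le> d / 2" using dpos Kpos by (auto simp: t_def min_def field_simps)
  \<comment> \<open>The infimum need not be attained; a slack of \<open>t\<^sup>2\<close> has the
    order of the quadratic error and does no harm.\<close>
  obtain p where p: "p \<in> P" "\<Phi> p < d + t\<^sup>2"
    using cInf_lessD[OF Pne, of "d + t\<^sup>2"] t unfolding d_def by auto
  define r where "r y = s y - E p y" for y
  have gint: "integrable (measure_pmf q) (g y)" if "y \<in> Y" for q y
    using bd[OF that] by (intro measure_pmf.integrable_const_bound[of _ 1]) auto
  have Ebd: "\<bar>E p y\<bar> \<le> 1" if y: "y \<in> Y" for y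
  proof -
    have "norm (E p y) \<le> measure_pmf.expectation p (\<lambda>x. norm (g y x))" unfolding E_def by (rule integral_norm_bound)
    also have "\<dots> \<le> measure_pmf.expectation p (\<lambda>x. 1)"
      using bd[OF y] gint[OF y] by (intro integral_mono) auto
    finally show ?thesis by simp
  qed
  have var: "(\<Sum>y\<in>Y. r y * (g y \<sigma> - E p y)) \<le> t * K" if \<sigma>: "\<sigma> \<in> S" for \<sigma>
  proof -
    \<comment> \<open>Mixing a mass \<open>t\<close> of the configuration \<open>\<sigma>\<close>
      into \<open>p\<close> moves the moment vector towards \<open>g _ \<sigma>\<close>. As
      \<open>q\<close> cannot lie closer to the target than \<open>d\<close>, the residual
      \<open>r\<close> has nearly nonpositive inner product with that direction.\<close>
    define q where "q = bernoulli_pmf t \<bind> (\<lambda>b. if b then return_pmf \<sigma> else p)"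
    have q: "q \<in> P" using \<sigma> p t by (auto simp: q_def P_def split: if_splits)
    have Eq: "E q y = t * g y \<sigma> + (1 - t) * E p y" if y: "y \<in> Y" for y
    proof -
      have "E q y = measure_pmf.expectation (bernoulli_pmf t) (\<lambda>b. E (if b then return_pmf \<sigma> else p) y)"
        unfolding q_def E_def using bd[OF y] by (rule expectation_bind_pmf)
      then show ?thesis using t by (simp add: E_def)
    qed
    have "d \<le> \<Phi> q" unfolding d_def using bb q by (intro cInf_lower) auto
    also have "\<Phi> q = (\<Sum>y\<in>Y. (r y)\<^sup>2 - 2 * t * (r y * (g y \<sigma> - E p y)) + t\<^sup>2 * (g y \<sigma> - E p y)\<^sup>2)"
      unfolding \<Phi>_def by (intro sum.cong refl) (auto simp: Eq r_def power2_eq_square algebra_simps)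
    also have "\<dots> = \<Phi> p - 2 * t * (\<Sum>y\<in>Y. r y * (g y \<sigma> - E p y)) + t\<^sup>2 * (\<Sum>y\<in>Y. (g y \<sigma> - E p y)\<^sup>2)"
      by (simp add: \<Phi>_def r_def sum.distrib sum_subtractf sum_distrib_left)
    also have "(\<Sum>y\<in>Y. (g y \<sigma> - E p y)\<^sup>2) \<le> (\<Sum>y\<in>Y. 4)"
    proof (intro sum_mono)
      fix y assume y: "y \<in> Y"
      have "\<bar>g y \<sigma> - E p y\<bar> \<le> 2" using bd[OF y, of \<sigma>] Ebd[OF y] by linarith
      then have "\<bar>g y \<sigma> - E p y\<bar>\<^sup>2 \<le> 2\<^sup>2" by (intro power_mono) auto
      then show "(g y \<sigma> - E p y)\<^sup>2 \<le> 4" by simp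
    qed
    finally have "d \<le> \<Phi> p - 2 * t * (\<Sum>y\<in>Y. r y * (g y \<sigma> - E p y)) + t\<^sup>2 * (4 * card Y)"
      using t by (simp add: mult.commute)
    then have "2 * t * (\<Sum>y\<in>Y. r y * (g y \<sigma> - E p y)) \<le> t\<^sup>2 + t\<^sup>2 * (4 * card Y)" using p(2) by linarith
    also have "\<dots> = 2 * t * (t * K)" by (simp add: K_def power2_eq_square algebra_simps)
    finally show ?thesis using t by simp
  qed
  \<comment> \<open>The approximate optimality condition is an affine inequality on
    \<open>S\<close>; evaluated at the target it reads
    \<open>\<Phi> p \<le> t * K \<le> d / 2\<close>, although
    \<open>\<Phi> p \<ge> d > 0\<close>.\<close>
  have "0 \<le> ((\<Sum>y\<in>Y. r y * E p y) + t * K) + (\<Sum>y\<in>Y. (- r y) * s y)"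
  proof (rule adm)
    fix \<sigma> assume "\<sigma> \<in> S"
    then show "0 \<le> ((\<Sum>y\<in>Y. r y * E p y) + t * K) + (\<Sum>y\<in>Y. (- r y) * g y \<sigma>)"
      using var[of \<sigma>] by (simp add: right_diff_distrib sum_subtractf sum_negf)
  qed
  also have "\<dots> = t * K - \<Phi> p"
  proof -
    have "(\<Sum>y\<in>Y. r y * E p y) + (\<Sum>y\<in>Y. (- r y) * s y) = - \<Phi> p"
      unfolding \<Phi>_def r_def sum.distrib[symmetric] sum_negf[symmetric]
      by (intro sum.cong refl) (simp add: power2_eq_square algebra_simps)
    then show ?thesis by simp
  qed
  finally have "\<Phi> p \<le> t * K" by simp
  moreover have "d \<le> \<Phi> p" unfolding d_def using bb p by (intro cInf_lower) auto
  ultimately show False using t dpos by linarith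
qed

section \<open>Dyadic lattices\<close>

definition dyadic_lattice :: "nat \<Rightarrow> 'a::euclidean_space set" where
  "dyadic_lattice n = {x. \<forall>b\<in>Basis. 2 ^ n * (x \<bullet> b) \<in> \<int>}"

definition dyadic_floor :: "nat \<Rightarrow> 'a::euclidean_space \<Rightarrow> 'a" where
  "dyadic_floor n x = (\<Sum>b\<in>Basis. (of_int \<lfloor>2 ^ n * (x \<bullet> b)\<rfloor> / 2 ^ n) *\<^sub>R b)"

text \<open>Mesh \<open>1 / 2 ^ n\<close> and side length \<open>2 ^ n\<close> are driven by the
  same parameter: there are \<open>4 ^ n\<close> points per axis, and a fixed shift loses only a
  fraction of order \<open>1 / 2 ^ n\<close> of them.\<close>

definition dyadic_cube :: "nat \<Rightarrow> 'a::euclidean_space set" where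
  "dyadic_cube n = {z \<in> dyadic_lattice n. \<forall>b\<in>Basis. 0 \<le> z \<bullet> b \<and> z \<bullet> b < 2 ^ n}"

lemma dyadic_lattice_add: "x \<in> dyadic_lattice n \<Longrightarrow> y \<in> dyadic_lattice n \<Longrightarrow> x + y \<in> dyadic_lattice n"
  by (auto simp: dyadic_lattice_def inner_add_left distrib_left)

lemma dyadic_lattice_minus: "x \<in> dyadic_lattice n \<Longrightarrow> - x \<in> dyadic_lattice n"
  by (auto simp: dyadic_lattice_def)

lemma dyadic_lattice_diff: "x \<in> dyadic_lattice n \<Longrightarrow> y \<in> dyadic_lattice n \<Longrightarrow> x - y \<in> dyadic_lattice n"
  using dyadic_lattice_add[of x n "- y"] dyadic_lattice_minus[of y n] by simp

lemma dyadic_lattice_mono: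
  assumes "m \<le> n" "x \<in> dyadic_lattice m"
  shows "x \<in> dyadic_lattice n"
  unfolding dyadic_lattice_def mem_Collect_eq
proof
  fix b :: 'a assume "b \<in> Basis"
  then have "2 ^ m * (x \<bullet> b) \<in> \<int>" using assms by (auto simp: dyadic_lattice_def)
  then have "2 ^ (n - m) * (2 ^ m * (x \<bullet> b)) \<in> \<int>"
    by (rule Ints_mult[OF Ints_power[OF Ints_numeral]])
  also have "2 ^ (n - m) * (2 ^ m * (x \<bullet> b)) = 2 ^ n * (x \<bullet> b)"
    using assms(1) by (simp add: power_add[symmetric] mult.assoc[symmetric])
  finally show "2 ^ n * (x \<bullet> b) \<in> \<int>" .
qed

lemma dyadic_floor_inner: "b \<in> Basis \<Longrightarrow> dyadic_floor n x \<bullet> b = of_int \<lfloor>2 ^ n * (x \<bullet> b)\<rfloor> / 2 ^ n"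
  by (simp add: dyadic_floor_def)

lemma dyadic_floor_in_lattice: "dyadic_floor n x \<in> dyadic_lattice n"
  by (auto simp: dyadic_lattice_def dyadic_floor_inner)

lemma norm_diff_dyadic_floor: "norm (x - dyadic_floor n (x :: 'a::euclidean_space)) \<le> DIM('a) / 2 ^ n"
proof -
  have "norm (x - dyadic_floor n x) \<le> (\<Sum>b\<in>Basis. \<bar>(x - dyadic_floor n x) \<bullet> b\<bar>)" by (rule norm_le_l1)
  also have "\<dots> \<le> (\<Sum>b\<in>(Basis::'a set). 1 / 2 ^ n)"
  proof (rule sum_mono)
    fix b :: 'a assume b: "b \<in> Basis"
    have "(x - dyadic_floor n x) \<bullet> b = frac (2 ^ n * (x \<bullet> b)) / 2 ^ n"
      using b by (simp add: inner_diff_left dyadic_floor_inner frac_def field_simps)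
    then show "\<bar>(x - dyadic_floor n x) \<bullet> b\<bar> \<le> 1 / 2 ^ n"
      using frac_lt_1[of "2 ^ n * (x \<bullet> b)"] by (simp add: divide_right_mono)
  qed
  finally show ?thesis by simp
qed

lemma measurable_dyadic_floor [measurable]: "dyadic_floor n \<in> borel_measurable borel"
  unfolding dyadic_floor_def[abs_def] by measurable

text \<open>Integer coordinates for lattice points, so that finiteness and cardinality reduce to the
  function spaces \<open>PiE Basis F\<close>.\<close>

definition lattice_vec :: "nat \<Rightarrow> ('a::euclidean_space \<Rightarrow> int) \<Rightarrow> 'a" where
  "lattice_vec n f = (\<Sum>b\<in>Basis. (of_int (f b) / 2 ^ n) *\<^sub>R b)"

lemma lattice_vec_inner: "b \<in> Basis \<Longrightarrow> lattice_vec n f \<bullet> b = of_int (f b) / 2 ^ n"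
  by (simp add: lattice_vec_def)

lemma lattice_vec_in_lattice: "lattice_vec n f \<in> dyadic_lattice n"
  by (auto simp: dyadic_lattice_def lattice_vec_inner)

lemma inj_on_lattice_vec: "inj_on (lattice_vec n) (PiE Basis F)"
proof (rule inj_onI)
  fix f g :: "'a \<Rightarrow> int" assume fg: "f \<in> PiE Basis F" "g \<in> PiE Basis F" and eq: "lattice_vec n f = lattice_vec n g"
  have "f b = g b" if "b \<in> Basis" for b
    using lattice_vec_inner[OF that, of n f] lattice_vec_inner[OF that, of n g] eq by simp
  then show "f = g" using fg by (intro PiE_ext) auto
qed

lemma lattice_as_vec:
  assumes "x \<in> dyadic_lattice n"
  obtains f where "f \<in> extensional Basis" "x = lattice_vec n f" "\<And>b. b \<in> Basis \<Longrightarrow> of_int (f b) = 2 ^ n * (x \<bullet> b)"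
proof -
  have "\<forall>b\<in>Basis. \<exists>k. 2 ^ n * (x \<bullet> b) = of_int k" using assms by (auto simp: dyadic_lattice_def Ints_def)
  then obtain k where k: "\<And>b. b \<in> Basis \<Longrightarrow> 2 ^ n * (x \<bullet> b) = of_int (k b)" by metis
  have "x = lattice_vec n (restrict k Basis)"
  proof (rule euclidean_eqI)
    fix b :: 'a assume b: "b \<in> Basis"
    have "x \<bullet> b = (2 ^ n * (x \<bullet> b)) / 2 ^ n" by simp
    also have "\<dots> = lattice_vec n (restrict k Basis) \<bullet> b" using b by (simp only: k lattice_vec_inner) simp
    finally show "x \<bullet> b = lattice_vec n (restrict k Basis) \<bullet> b" .
  qed
  then show ?thesis using k by (intro that[of "restrict k Basis"]) auto
qed

lemma lattice_vec_image:
  "lattice_vec n ` PiE Basis F = {x \<in> dyadic_lattice n. \<forall>b\<in>Basis. \<exists>i\<in>F b. 2 ^ n * (x \<bullet> b) = of_int i}"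
proof (intro equalityI subsetI)
  fix x assume "x \<in> lattice_vec n ` PiE Basis F"
  then show "x \<in> {x \<in> dyadic_lattice n. \<forall>b\<in>Basis. \<exists>i\<in>F b. 2 ^ n * (x \<bullet> b) = of_int i}"
    by (auto simp: lattice_vec_in_lattice lattice_vec_inner)
next
  fix x :: 'a assume "x \<in> {x \<in> dyadic_lattice n. \<forall>b\<in>Basis. \<exists>i\<in>F b. 2 ^ n * (x \<bullet> b) = of_int i}"
  then have x: "x \<in> dyadic_lattice n" "\<And>b. b \<in> Basis \<Longrightarrow> \<exists>i\<in>F b. 2 ^ n * (x \<bullet> b) = of_int i" by auto
  obtain f where f: "f \<in> extensional Basis" "x = lattice_vec n f" "\<And>b. b \<in> Basis \<Longrightarrow> of_int (f b) = 2 ^ n * (x \<bullet> b)"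
    using lattice_as_vec[OF x(1)] by metis
  have "f b \<in> F b" if b: "b \<in> Basis" for b
  proof -
    obtain i where "i \<in> F b" "2 ^ n * (x \<bullet> b) = of_int i" using x(2)[OF b] by auto
    then have "f b = i" using f(3)[OF b] by simp
    then show ?thesis using \<open>i \<in> F b\<close> by simp
  qed
  then have "f \<in> PiE Basis F" using f(1) by (auto simp: PiE_def)
  then show "x \<in> lattice_vec n ` PiE Basis F" using f(2) by blast
qed

lemma countable_dyadic_lattice: "countable (dyadic_lattice n :: 'a::euclidean_space set)"
proof -
  have "dyadic_lattice n \<subseteq> lattice_vec n ` PiE (Basis :: 'a set) (\<lambda>_. UNIV)"
    unfolding lattice_vec_image by (auto simp: dyadic_lattice_def elim!: Ints_cases)
  moreover have "countable (PiE (Basis :: 'a set) (\<lambda>_. UNIV :: int set))" by (intro countable_PiE) auto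
  ultimately show ?thesis by (meson countable_image countable_subset)
qed

lemma finite_dyadic_lattice_bounded:
  "finite {x \<in> dyadic_lattice n. \<forall>b\<in>(Basis :: 'a::euclidean_space set). \<bar>x \<bullet> b\<bar> \<le> R}"
proof -
  let ?K = "\<lceil>2 ^ n * R\<rceil>"
  have "{x \<in> dyadic_lattice n. \<forall>b\<in>(Basis::'a set). \<bar>x \<bullet> b\<bar> \<le> R} \<subseteq> lattice_vec n ` PiE Basis (\<lambda>_. {- ?K..?K})"
    unfolding lattice_vec_image
  proof clarify
    fix x b :: 'a assume x: "x \<in> dyadic_lattice n" "\<forall>b\<in>Basis. \<bar>x \<bullet> b\<bar> \<le> R" and b: "b \<in> Basis"
    obtain i where i: "2 ^ n * (x \<bullet> b) = of_int i" using x(1) b by (auto simp: dyadic_lattice_def Ints_def)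
    have "\<bar>2 ^ n * (x \<bullet> b)\<bar> \<le> 2 ^ n * R" using x(2) b by (simp add: abs_mult)
    then have "i \<in> {- ?K..?K}" unfolding i by (auto simp: abs_le_iff) linarith+
    then show "\<exists>i\<in>{- ?K..?K}. 2 ^ n * (x \<bullet> b) = of_int i" using i by blast
  qed
  moreover have "finite (PiE (Basis::'a set) (\<lambda>_. {- ?K..?K}))" by (intro finite_PiE) auto
  ultimately show ?thesis by (meson finite_imageI finite_subset)
qed

lemma finite_dyadic_cube: "finite (dyadic_cube n :: 'a::euclidean_space set)"
  by (rule finite_subset[OF _ finite_dyadic_lattice_bounded[of n "2 ^ n"]]) (auto simp: dyadic_cube_def)

lemma zero_in_dyadic_cube: "0 \<in> dyadic_cube n"
  by (auto simp: dyadic_cube_def dyadic_lattice_def)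

lemma dyadic_cube_eq: "dyadic_cube n = lattice_vec n ` PiE Basis (\<lambda>_. {0..<4 ^ n})"
  unfolding lattice_vec_image
proof (intro equalityI subsetI)
  fix x :: 'a assume x: "x \<in> dyadic_cube n"
  show "x \<in> {x \<in> dyadic_lattice n. \<forall>b\<in>Basis. \<exists>i\<in>{0..<4 ^ n}. 2 ^ n * (x \<bullet> b) = of_int i}"
  proof (intro CollectI conjI ballI)
    show "x \<in> dyadic_lattice n" using x by (simp add: dyadic_cube_def)
    fix b :: 'a assume b: "b \<in> Basis"
    obtain i where i: "2 ^ n * (x \<bullet> b) = of_int i" using x b by (auto simp: dyadic_cube_def dyadic_lattice_def Ints_def)
    have "0 \<le> x \<bullet> b" "x \<bullet> b < 2 ^ n" using x b by (auto simp: dyadic_cube_def)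
    then have "0 \<le> 2 ^ n * (x \<bullet> b)" "2 ^ n * (x \<bullet> b) < 2 ^ n * 2 ^ n" by auto
    then have "0 \<le> (of_int i :: real)" "(of_int i :: real) < of_int (4 ^ n)"
      unfolding i by (auto simp: power_mult_distrib[symmetric])
    then have "i \<in> {0..<4 ^ n}" by (simp only: of_int_less_iff of_int_0_le_iff atLeastLessThan_iff)
    then show "\<exists>i\<in>{0..<4 ^ n}. 2 ^ n * (x \<bullet> b) = of_int i" using i by blast
  qed
next
  fix x :: 'a assume "x \<in> {x \<in> dyadic_lattice n. \<forall>b\<in>Basis. \<exists>i\<in>{0..<4 ^ n}. 2 ^ n * (x \<bullet> b) = of_int i}"
  then have x: "x \<in> dyadic_lattice n" "\<And>b. b \<in> Basis \<Longrightarrow> \<exists>i\<in>{0..<4 ^ n}. 2 ^ n * (x \<bullet> b) = of_int i" by auto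
  have "0 \<le> x \<bullet> b \<and> x \<bullet> b < 2 ^ n" if b: "b \<in> Basis" for b
  proof -
    obtain i where i: "0 \<le> i" "i < 4 ^ n" "2 ^ n * (x \<bullet> b) = of_int i" using x(2)[OF b] by auto
    have "(of_int i :: real) < of_int (4 ^ n)" using i(2) by (simp only: of_int_less_iff)
    then have "2 ^ n * (x \<bullet> b) < 2 ^ n * 2 ^ n" unfolding i(3) by (simp add: power_mult_distrib[symmetric])
    moreover have "0 \<le> 2 ^ n * (x \<bullet> b)" unfolding i(3) using i(1) by simp
    ultimately show ?thesis using mult_le_cancel_left_pos[of "2 ^ n" 0 "x \<bullet> b"] by simp
  qed
  then show "x \<in> dyadic_cube n" using x(1) by (auto simp: dyadic_cube_def)
qed

text \<open>If \<open>z - v\<close> leaves the cube, some coordinate does. In direction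
  \<open>b\<close> at most \<open>2 ^ n * \<bar>v \<bullet> b\<bar>\<close> of the
  \<open>4 ^ n\<close> integer coordinates are affected, a fraction
  \<open>\<bar>v \<bullet> b\<bar> / 2 ^ n\<close>; the fractions are added over the
  directions.\<close>

lemma card_dyadic_cube_boundary:
  fixes v :: "'a::euclidean_space"
  assumes v: "v \<in> dyadic_lattice n"
  shows "real (card {z \<in> dyadic_cube n. z - v \<notin> dyadic_cube n}) / real (card (dyadic_cube n :: 'a set))
    \<le> (\<Sum>b\<in>Basis. \<bar>v \<bullet> b\<bar>) / 2 ^ n"
proof -
  let ?L = "dyadic_cube n :: 'a set"
  obtain m where m: "\<And>b. b \<in> Basis \<Longrightarrow> of_int (m b) = 2 ^ n * (v \<bullet> b)" using lattice_as_vec[OF v] by metis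
  \<comment> \<open>\<open>J b\<close> collects the integer coordinates that the shift pushes out in
    direction \<open>b\<close>; \<open>B b\<close> is the corresponding slab of the cube.\<close>
  define J where "J b = {i \<in> {0..<4 ^ n}. i - m b \<notin> {0..<4 ^ n}}" for b
  define B where "B b = lattice_vec n ` PiE Basis (\<lambda>i. if i = b then J b else {0..<4 ^ n})" for b :: 'a
  have cJ: "real (card (J b)) \<le> \<bar>of_int (m b)\<bar>" for b
  proof (cases "0 \<le> m b")
    case True
    then have "J b \<subseteq> {0..<m b}" by (auto simp: J_def)
    then have "card (J b) \<le> card {0..<m b}" by (intro card_mono) auto
    then show ?thesis using True by simp
  next
    case False
    then have "J b \<subseteq> {4 ^ n + m b..<4 ^ n}" by (auto simp: J_def)
    then have "card (J b) \<le> card {4 ^ n + m b..<4 ^ n}" by (intro card_mono) auto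
    then show ?thesis using False by simp
  qed
  have sub: "{z \<in> ?L. z - v \<notin> ?L} \<subseteq> (\<Union>b\<in>Basis. B b)"
  proof
    fix z assume z: "z \<in> {z \<in> ?L. z - v \<notin> ?L}"
    then have zL: "z \<in> dyadic_lattice n" by (auto simp: dyadic_cube_def)
    obtain f where f: "\<And>b. b \<in> Basis \<Longrightarrow> of_int (f b) = 2 ^ n * (z \<bullet> b)" using lattice_as_vec[OF zL] by metis
    have fr: "f b \<in> {0..<4 ^ n}" if b: "b \<in> Basis" for b
    proof -
      obtain i where "i \<in> {0..<4 ^ n}" "2 ^ n * (z \<bullet> b) = of_int i"
        using z b unfolding dyadic_cube_eq lattice_vec_image by auto
      then show ?thesis using f[OF b] by simp
    qed
    have d: "2 ^ n * ((z - v) \<bullet> b) = of_int (f b - m b)" if "b \<in> Basis" for b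
      using f[OF that] m[OF that] by (simp add: inner_diff_left right_diff_distrib)
    have "\<exists>b\<in>Basis. f b - m b \<notin> {0..<4 ^ n}"
    proof (rule ccontr)
      assume "\<not> ?thesis"
      then have "z - v \<in> ?L"
        unfolding dyadic_cube_eq lattice_vec_image using d dyadic_lattice_diff[OF zL v] by blast
      then show False using z by simp
    qed
    then obtain b where b: "b \<in> Basis" "f b - m b \<notin> {0..<4 ^ n}" by blast
    then have "f b \<in> J b" using fr by (auto simp: J_def)
    then have "z \<in> B b"
      unfolding B_def lattice_vec_image using zL f fr by (auto intro!: bexI[of _ "f _"] simp: f[symmetric] split: if_splits)
    then show "z \<in> (\<Union>b\<in>Basis. B b)" using b by blast
  qed
  have cL: "card ?L = (\<Prod>i\<in>(Basis::'a set). 4 ^ n)"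
    unfolding dyadic_cube_eq by (subst card_image[OF inj_on_lattice_vec]) (simp add: card_PiE nat_power_eq)
  have cB: "real (card (B b)) * 2 ^ n \<le> \<bar>v \<bullet> b\<bar> * real (card ?L)" if b: "b \<in> Basis" for b
  proof -
    have "card (B b) = (\<Prod>i\<in>Basis. card (if i = b then J b else {0..<4 ^ n :: int}))"
      unfolding B_def by (subst card_image[OF inj_on_lattice_vec]) (simp add: card_PiE)
    also have "\<dots> = card (J b) * (\<Prod>i\<in>Basis - {b}. card (if i = b then J b else {0..<4 ^ n :: int}))"
      using b by (subst prod.remove[of _ b]) auto
    also have "(\<Prod>i\<in>Basis - {b}. card (if i = b then J b else {0..<4 ^ n :: int})) = (\<Prod>i\<in>Basis - {b}. 4 ^ n)"
      by (intro prod.cong refl) (auto simp: nat_power_eq)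
    finally have 1: "card (B b) = card (J b) * (\<Prod>i\<in>Basis - {b}. 4 ^ n)" .
    have 2: "card ?L = 4 ^ n * (\<Prod>i\<in>Basis - {b}. 4 ^ n)"
      unfolding cL using b by (subst prod.remove[of _ b]) auto
    have "real (card (J b)) \<le> 2 ^ n * \<bar>v \<bullet> b\<bar>" using cJ[of b] m[OF b] by (simp add: abs_mult)
    then have "real (card (J b)) * 2 ^ n \<le> 2 ^ n * \<bar>v \<bullet> b\<bar> * 2 ^ n" by (rule mult_right_mono) simp
    also have "\<dots> = \<bar>v \<bullet> b\<bar> * 4 ^ n" by (simp add: power_mult_distrib[symmetric])
    finally have "(real (card (J b)) * 2 ^ n) * (\<Prod>i\<in>Basis - {b}. 4 ^ n) \<le> (\<bar>v \<bullet> b\<bar> * 4 ^ n) * (\<Prod>i\<in>Basis - {b}. 4 ^ n)"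
      by (rule mult_right_mono) (simp add: prod_nonneg)
    then show ?thesis unfolding 1 2 by (simp add: mult_ac)
  qed
  have "finite (J b)" for b by (rule finite_subset[of _ "{0..<4 ^ n}"]) (auto simp: J_def)
  then have finB: "finite (B b)" for b unfolding B_def by (intro finite_imageI finite_PiE) auto
  have "real (card {z \<in> ?L. z - v \<notin> ?L}) \<le> real (card (\<Union>b\<in>Basis. B b))"
    using sub finB by (intro of_nat_mono card_mono) auto
  also have "\<dots> \<le> (\<Sum>b\<in>Basis. real (card (B b)))"
    using card_UN_le[OF finite_Basis, of B] by (metis of_nat_mono of_nat_sum)
  finally have "real (card {z \<in> ?L. z - v \<notin> ?L}) * 2 ^ n \<le> (\<Sum>b\<in>Basis. real (card (B b))) * 2 ^ n"
    by (rule mult_right_mono) simp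
  also have "\<dots> = (\<Sum>b\<in>Basis. real (card (B b)) * 2 ^ n)" by (rule sum_distrib_right)
  also have "\<dots> \<le> (\<Sum>b\<in>Basis. \<bar>v \<bullet> b\<bar> * real (card ?L))" by (intro sum_mono cB)
  also have "\<dots> = (\<Sum>b\<in>Basis. \<bar>v \<bullet> b\<bar>) * real (card ?L)" by (rule sum_distrib_right[symmetric])
  finally have "real (card {z \<in> ?L. z - v \<notin> ?L}) * 2 ^ n \<le> (\<Sum>b\<in>Basis. \<bar>v \<bullet> b\<bar>) * real (card ?L)" .
  moreover have "0 < card ?L" using finite_dyadic_cube zero_in_dyadic_cube by (auto simp: card_gt_0_iff)
  ultimately show ?thesis by (simp add: field_simps)
qed

section \<open>Random lattice configurations\<close>

text \<open>By \<open>approx_moments_pmf\<close> it suffices that a linear inequality for all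
  subsets of \<open>L\<close> passes to the targets. Averaged over offsets in the cell
  \<open>W0\<close>, it becomes an inequality between values of \<open>delta\<close>, to which
  admissibility applies. The factor in front of \<open>S2 y\<close> appears because only pairs with
  both points in \<open>L\<close> are counted.\<close>

lemma lattice_pmf_exists:
  fixes S2 :: "'a::euclidean_space \<Rightarrow> real" and n :: nat
  assumes adm: "admissible_S2 S2" and Y: "finite Y" and e: "0 < \<epsilon>"
  defines "L \<equiv> (dyadic_cube n :: 'a set)"
  shows "\<exists>p. set_pmf p \<subseteq> Pow L \<and> (\<forall>y\<in>Y.
    \<bar>measure_pmf.expectation p (\<lambda>\<sigma>. real (card {z\<in>L. z \<in> \<sigma> \<and> z - y \<in> \<sigma>}) / real (card L))
      - real (card {z\<in>L. z - y \<in> L}) / real (card L) * S2 y\<bar> < \<epsilon>)"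
proof (rule approx_moments_pmf[OF Y _ _ _ e])
  have fL: "finite L" unfolding L_def by (rule finite_dyadic_cube)
  have N: "0 < card L" using fL zero_in_dyadic_cube by (auto simp: L_def card_gt_0_iff)
  show "Pow L \<noteq> {}" by blast
  show "\<bar>real (card {z\<in>L. z \<in> \<sigma> \<and> z - y \<in> \<sigma>}) / real (card L)\<bar> \<le> 1" for y \<sigma>
    using N fL by (auto intro!: card_mono)
  fix c :: real and a :: "'a \<Rightarrow> real"
  assume nn: "\<And>\<sigma>. \<sigma> \<in> Pow L \<Longrightarrow> 0 \<le> c + (\<Sum>y\<in>Y. a y * (real (card {z\<in>L. z \<in> \<sigma> \<and> z - y \<in> \<sigma>}) / real (card L)))"
  define W0 where "W0 = box 0 ((1 / 2 ^ n) *\<^sub>R (One :: 'a))"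
  define m where "m = measure lebesgue W0"
  have W0: "W0 \<in> lmeasurable" "W0 \<in> Wsets" by (auto simp: W0_def box_Wsets)
  have m: "0 < m"
    unfolding m_def W0_def by (simp add: measure_lborel_box_eq prod_pos)
  define I where "I = Sigma Y (\<lambda>y. {z\<in>L. z - y \<in> L})"
  have fI: "finite I" using Y fL by (auto simp: I_def)
  have "0 \<le> c + (\<Sum>i\<in>I. a (fst i) / (real (card L) * m) * (S2 (fst i) * measure lebesgue (transl (snd i) W0)))"
  proof (rule admissible_S2_finite[OF adm fI])
    show "transl (snd i) W0 \<in> Wsets" for i using W0 by (intro transl_Wsets)
    fix A :: "'a set" assume A: "A \<in> sets lebesgue"
    \<comment> \<open>Sampling \<open>A\<close> on the lattice shifted by \<open>u\<close> yields a
      configuration for each \<open>u\<close>, so the assumed inequality holds pointwise in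
      \<open>u\<close> and can be integrated over \<open>W0\<close>. The integral of
      \<open>k (y, z)\<close> is \<open>delta y\<close> on the cell at \<open>z\<close>.\<close>
    define s where "s u = {z\<in>L. z + u \<in> A}" for u
    define k where "k i u = (indicator (transl (- snd i) A \<inter> transl (fst i - snd i) A \<inter> W0) u :: real)" for i u
    have klm: "transl (- snd i) A \<inter> transl (fst i - snd i) A \<inter> W0 \<in> lmeasurable" for i
      using A W0(1) by (metis fmeasurable_Int_fmeasurable inf_commute sets.Int transl_lebesgue)
    have kint: "integrable lebesgue (k i)" for i
      unfolding k_def using klm[of i] by (simp add: lmeasurable_iff_integrable)
    have kI: "(\<integral>u. k i u \<partial>lebesgue) = delta (fst i) (transl (snd i) W0) A" for i
      unfolding k_def delta_transl using klm[of i] by simp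
    have eq: "indicator W0 u * (c + (\<Sum>y\<in>Y. a y * (real (card {z\<in>L. z \<in> s u \<and> z - y \<in> s u}) / real (card L))))
       = c * indicator W0 u + (\<Sum>i\<in>I. a (fst i) / real (card L) * k i u)" for u
    proof (cases "u \<in> W0")
      case True
      have "real (card {z\<in>L. z \<in> s u \<and> z - y \<in> s u}) = (\<Sum>z\<in>{z\<in>L. z - y \<in> L}. k (y, z) u)" for y
      proof -
        have "(\<Sum>z\<in>{z\<in>L. z - y \<in> L}. k (y, z) u) = (\<Sum>z\<in>{z\<in>L. z - y \<in> L}. if z + u \<in> A \<and> z - y + u \<in> A then 1 else 0)"
          unfolding k_def using True by (intro sum.cong refl) (auto simp: indicator_def transl_iff algebra_simps)
        also have "\<dots> = real (card {z\<in>L. z \<in> s u \<and> z - y \<in> s u})"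
          using fL by (subst sum.inter_filter[symmetric]) (auto simp: s_def intro!: arg_cong[where f=card])
        finally show ?thesis by simp
      qed
      then have "(\<Sum>y\<in>Y. a y * (real (card {z\<in>L. z \<in> s u \<and> z - y \<in> s u}) / real (card L)))
         = (\<Sum>y\<in>Y. \<Sum>z\<in>{z\<in>L. z - y \<in> L}. a y / real (card L) * k (y, z) u)"
        by (simp add: sum_distrib_left sum_divide_distrib)
      also have "\<dots> = (\<Sum>i\<in>I. a (fst i) / real (card L) * k i u)"
        unfolding I_def using Y fL by (subst sum.Sigma) (auto simp: case_prod_beta)
      finally show ?thesis using True by simp
    qed (simp add: k_def)
    have "0 \<le> (\<integral>u. indicator W0 u * (c + (\<Sum>y\<in>Y. a y * (real (card {z\<in>L. z \<in> s u \<and> z - y \<in> s u}) / real (card L)))) \<partial>lebesgue)"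
      using nn[of "s _"] by (intro integral_nonneg_AE AE_I2) (auto simp: s_def)
    also have "\<dots> = (\<integral>u. c * indicator W0 u + (\<Sum>i\<in>I. a (fst i) / real (card L) * k i u) \<partial>lebesgue)"
      unfolding eq ..
    also have "\<dots> = c * m + (\<Sum>i\<in>I. a (fst i) / real (card L) * delta (fst i) (transl (snd i) W0) A)"
      using kint kI W0 by (subst Bochner_Integration.integral_add) (auto simp: m_def lmeasurable_iff_integrable)
    finally have "0 \<le> (c * m + (\<Sum>i\<in>I. a (fst i) / real (card L) * delta (fst i) (transl (snd i) W0) A)) / m"
      using m by simp
    also have "\<dots> = c + (\<Sum>i\<in>I. a (fst i) / (real (card L) * m) * delta (fst i) (transl (snd i) W0) A)"
      using m by (simp add: add_divide_distrib sum_divide_distrib)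
    finally show "0 \<le> c + (\<Sum>i\<in>I. a (fst i) / (real (card L) * m) * delta (fst i) (transl (snd i) W0) A)" .
  qed
  also have "(\<Sum>i\<in>I. a (fst i) / (real (card L) * m) * (S2 (fst i) * measure lebesgue (transl (snd i) W0)))
     = (\<Sum>y\<in>Y. \<Sum>z\<in>{z\<in>L. z - y \<in> L}. a y / real (card L) * S2 y)"
    unfolding I_def using Y fL m by (subst sum.Sigma) (auto simp: case_prod_beta measure_transl m_def intro!: sum.cong)
  also have "\<dots> = (\<Sum>y\<in>Y. a y * (real (card {z\<in>L. z - y \<in> L}) / real (card L) * S2 y))"
    by (intro sum.cong refl) simp
  finally show "0 \<le> c + (\<Sum>y\<in>Y. a y * (real (card {z\<in>L. z - y \<in> L}) / real (card L) * S2 y))" .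
qed

lemma prob_shifted_pmf:
  fixes L :: "'a::euclidean_space set"
  assumes L: "finite L" "L \<noteq> {}"
  shows "measure_pmf.prob (map_pmf (\<lambda>(\<sigma>, u). {x. x + u \<in> \<sigma>}) (pair_pmf p (pmf_of_set L))) {B. T B}
    = measure_pmf.expectation p (\<lambda>\<sigma>. real (card {u\<in>L. T {x. x + u \<in> \<sigma>}}) / real (card L))"
proof -
  have *: "map_pmf (\<lambda>(\<sigma>, u). {x. x + u \<in> \<sigma>}) (pair_pmf p (pmf_of_set L))
     = bind_pmf p (\<lambda>\<sigma>. map_pmf (\<lambda>u. {x. x + u \<in> \<sigma>}) (pmf_of_set L))"
    by (simp add: pair_pmf_def map_bind_pmf map_pmf_def bind_assoc_pmf bind_return_pmf)
  have "measure_pmf.prob (bind_pmf p (\<lambda>\<sigma>. map_pmf (\<lambda>u. {x. x + u \<in> \<sigma>}) (pmf_of_set L))) {B. T B}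
    = measure_pmf.expectation (bind_pmf p (\<lambda>\<sigma>. map_pmf (\<lambda>u. {x. x + u \<in> \<sigma>}) (pmf_of_set L))) (indicator {B. T B})"
    by simp
  also have "\<dots> = measure_pmf.expectation p (\<lambda>\<sigma>. measure_pmf.prob (map_pmf (\<lambda>u. {x. x + u \<in> \<sigma>}) (pmf_of_set L)) {B. T B})"
    by (subst expectation_bind_pmf[of _ 1]) (auto simp: indicator_def)
  also have "\<dots> = measure_pmf.expectation p (\<lambda>\<sigma>. real (card {u\<in>L. T {x. x + u \<in> \<sigma>}}) / real (card L))"
    using L by (simp add: measure_pmf_of_set Int_def vimage_def)
  finally show ?thesis unfolding * .
qed

lemma expectation_diff_le:
  fixes f g :: "'s \<Rightarrow> real"
  assumes "\<And>x. x \<in> set_pmf p \<Longrightarrow> f x \<le> g x + d" "\<And>x. \<bar>f x\<bar> \<le> B" "\<And>x. \<bar>g x\<bar> \<le> B"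
  shows "measure_pmf.expectation p f \<le> measure_pmf.expectation p g + d"
proof -
  have int: "integrable (measure_pmf p) f" "integrable (measure_pmf p) g"
    using assms by (auto intro!: measure_pmf.integrable_const_bound[of _ B])
  then have "measure_pmf.expectation p f \<le> measure_pmf.expectation p (\<lambda>x. g x + d)"
    using assms(1) by (intro integral_mono_AE) (auto simp: AE_measure_pmf_iff)
  then show ?thesis using int by simp
qed

text \<open>\<open>q\<close> shifts the configuration of \<open>lattice_pmf_exists\<close> by a
  uniform point of \<open>L\<close>. The first bound adds the moment error \<open>1 / 2 ^ n\<close>,
  the fraction of pairs at distance \<open>z - z'\<close> missing from \<open>L\<close>, and the
  boundary loss for the shift by \<open>z\<close>. The second holds because translating by
  \<open>v\<close> only permutes the uniform shifts, up to those leaving \<open>L\<close>.\<close>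

lemma dyadic_pmf_exists:
  fixes S2 :: "'a::euclidean_space \<Rightarrow> real"
  assumes adm: "admissible_S2 S2"
  shows "\<exists>q :: 'a set pmf.
    (\<forall>z\<in>dyadic_lattice n. \<forall>z'\<in>dyadic_lattice n. (\<forall>b\<in>Basis. \<bar>(z - z') \<bullet> b\<bar> \<le> real n) \<longrightarrow>
      \<bar>measure_pmf.prob q {B. z \<in> B \<and> z' \<in> B} - S2 (z - z')\<bar>
        \<le> (1 + (\<Sum>b\<in>Basis. \<bar>(z - z') \<bullet> b\<bar>) + (\<Sum>b\<in>Basis. \<bar>z \<bullet> b\<bar>)) / 2 ^ n) \<and>
    (\<forall>F. \<forall>v\<in>dyadic_lattice n.
      \<bar>measure_pmf.prob q {B. \<forall>x\<in>F. x + v \<in> B} - measure_pmf.prob q {B. F \<subseteq> B}\<bar> \<le> (\<Sum>b\<in>Basis. \<bar>v \<bullet> b\<bar>) / 2 ^ n)"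
proof -
  define L where "L = (dyadic_cube n :: 'a set)"
  have fL: "finite L" unfolding L_def by (rule finite_dyadic_cube)
  have Lne: "L \<noteq> {}" using zero_in_dyadic_cube by (auto simp: L_def)
  have N: "0 < card L" using fL Lne by (auto simp: card_gt_0_iff)
  \<comment> \<open>Only finitely many moments can be matched at once; the range
    \<open>real n\<close> grows so that every fixed difference is included eventually.\<close>
  define Y where "Y = {y \<in> dyadic_lattice n. \<forall>b\<in>(Basis :: 'a set). \<bar>y \<bullet> b\<bar> \<le> real n}"
  have Y: "finite Y" unfolding Y_def by (rule finite_dyadic_lattice_bounded)
  obtain p where p: "set_pmf p \<subseteq> Pow L" and pE: "\<And>y. y \<in> Y \<Longrightarrow>
    \<bar>measure_pmf.expectation p (\<lambda>\<sigma>. real (card {z\<in>L. z \<in> \<sigma> \<and> z - y \<in> \<sigma>}) / real (card L))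
      - real (card {z\<in>L. z - y \<in> L}) / real (card L) * S2 y\<bar> < 1 / 2 ^ n"
    using lattice_pmf_exists[OF adm Y, of "1 / 2 ^ n" n] unfolding L_def by auto
  define q where "q = map_pmf (\<lambda>(\<sigma>, u). {x. x + u \<in> \<sigma>}) (pair_pmf p (pmf_of_set L))"
  have prob: "measure_pmf.prob q {B. T B} = measure_pmf.expectation p (\<lambda>\<sigma>. real (card {u\<in>L. T {x. x + u \<in> \<sigma>}}) / real (card L))" for T
    unfolding q_def by (rule prob_shifted_pmf[OF fL Lne])
  define \<beta> where "\<beta> v = real (card {z\<in>L. z - v \<notin> L}) / real (card L)" for v
  have \<beta>: "\<beta> v \<le> (\<Sum>b\<in>Basis. \<bar>v \<bullet> b\<bar>) / 2 ^ n" if "v \<in> dyadic_lattice n" for v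
    unfolding \<beta>_def L_def using that by (rule card_dyadic_cube_boundary)
  have bd1: "\<bar>real (card {u\<in>L. R u}) / real (card L)\<bar> \<le> 1" for R
    using N fL by (auto intro!: card_mono)
  have cdiv: "real (card A) / real (card L) \<le> real (card B) / real (card L) + real (card C) / real (card L)"
    if "card A \<le> card B + card C" for A B C :: "'a set"
    using that N unfolding add_divide_distrib[symmetric] by (intro divide_right_mono) auto
  have 1: "\<bar>measure_pmf.prob q {B. z \<in> B \<and> z' \<in> B} - S2 (z - z')\<bar>
        \<le> (1 + (\<Sum>b\<in>Basis. \<bar>(z - z') \<bullet> b\<bar>) + (\<Sum>b\<in>Basis. \<bar>z \<bullet> b\<bar>)) / 2 ^ n"
    if z: "z \<in> dyadic_lattice n" "z' \<in> dyadic_lattice n" "\<forall>b\<in>Basis. \<bar>(z - z') \<bullet> b\<bar> \<le> real n" for z z'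
  proof -
    define y where "y = z - z'"
    have yl: "y \<in> dyadic_lattice n" unfolding y_def using z by (intro dyadic_lattice_diff)
    have yY: "y \<in> Y" using yl z(3) by (auto simp: Y_def y_def)
    define G where "G = measure_pmf.expectation p (\<lambda>\<sigma>. real (card {z\<in>L. z \<in> \<sigma> \<and> z - y \<in> \<sigma>}) / real (card L))"
    define Q where "Q = measure_pmf.prob q {B. z \<in> B \<and> z' \<in> B}"
    have Q: "Q = measure_pmf.expectation p (\<lambda>\<sigma>. real (card {u\<in>L. z + u \<in> \<sigma> \<and> z' + u \<in> \<sigma>}) / real (card L))"
      unfolding Q_def prob by simp
    \<comment> \<open>The map \<open>u \<mapsto> z + u\<close> injects the good shifts into the
      counted pairs, because a configuration stays inside \<open>L\<close>. In the converse estimate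
      \<open>lo\<close> only pairs whose preimage \<open>w - z\<close> falls outside
      \<open>L\<close> are missed.\<close>
    have up: "Q \<le> G + 0"
      unfolding Q G_def
    proof (rule expectation_diff_le[of _ _ _ _ 1])
      fix \<sigma> assume "\<sigma> \<in> set_pmf p"
      then have s: "\<sigma> \<subseteq> L" using p by auto
      have "card {u\<in>L. z + u \<in> \<sigma> \<and> z' + u \<in> \<sigma>} = card ((\<lambda>u. z + u) ` {u\<in>L. z + u \<in> \<sigma> \<and> z' + u \<in> \<sigma>})"
        by (intro card_image[symmetric] inj_onI) auto
      also have "\<dots> \<le> card {z\<in>L. z \<in> \<sigma> \<and> z - y \<in> \<sigma>}"
        using s fL by (intro card_mono) (auto simp: y_def algebra_simps)
      finally show "real (card {u\<in>L. z + u \<in> \<sigma> \<and> z' + u \<in> \<sigma>}) / real (card L)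
         \<le> real (card {z\<in>L. z \<in> \<sigma> \<and> z - y \<in> \<sigma>}) / real (card L) + 0"
        by (auto intro!: divide_right_mono)
    qed (rule bd1)+
    have lo: "G \<le> Q + \<beta> z"
      unfolding Q G_def
    proof (rule expectation_diff_le[of _ _ _ _ 1])
      fix \<sigma> assume "\<sigma> \<in> set_pmf p"
      then have s: "\<sigma> \<subseteq> L" using p by auto
      have "{w\<in>L. w \<in> \<sigma> \<and> w - y \<in> \<sigma>} \<subseteq> (\<lambda>u. z + u) ` {u\<in>L. z + u \<in> \<sigma> \<and> z' + u \<in> \<sigma>} \<union> {w\<in>L. w - z \<notin> L}"
      proof
        fix w assume w: "w \<in> {w\<in>L. w \<in> \<sigma> \<and> w - y \<in> \<sigma>}"
        have e: "z' + (w - z) = w - y" by (simp add: y_def)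
        have "z' + (w - z) \<in> \<sigma>" unfolding e using w by simp
        then show "w \<in> (\<lambda>u. z + u) ` {u\<in>L. z + u \<in> \<sigma> \<and> z' + u \<in> \<sigma>} \<union> {w\<in>L. w - z \<notin> L}"
          using w by (cases "w - z \<in> L") (auto intro!: image_eqI[of _ _ "w - z"])
      qed
      then have "card {w\<in>L. w \<in> \<sigma> \<and> w - y \<in> \<sigma>} \<le> card ((\<lambda>u. z + u) ` {u\<in>L. z + u \<in> \<sigma> \<and> z' + u \<in> \<sigma>} \<union> {w\<in>L. w - z \<notin> L})"
        using fL by (intro card_mono) auto
      also have "\<dots> \<le> card ((\<lambda>u. z + u) ` {u\<in>L. z + u \<in> \<sigma> \<and> z' + u \<in> \<sigma>}) + card {w\<in>L. w - z \<notin> L}"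
        by (rule card_Un_le)
      also have "card ((\<lambda>u. z + u) ` {u\<in>L. z + u \<in> \<sigma> \<and> z' + u \<in> \<sigma>}) = card {u\<in>L. z + u \<in> \<sigma> \<and> z' + u \<in> \<sigma>}"
        by (intro card_image inj_onI) auto
      finally show "real (card {w\<in>L. w \<in> \<sigma> \<and> w - y \<in> \<sigma>}) / real (card L)
         \<le> real (card {u\<in>L. z + u \<in> \<sigma> \<and> z' + u \<in> \<sigma>}) / real (card L) + \<beta> z"
        unfolding \<beta>_def by (rule cdiv)
    qed (rule bd1)+
    have "card L = card {z\<in>L. z - y \<in> L} + card {z\<in>L. z - y \<notin> L}"
      using fL by (subst card_Un_disjoint[symmetric]) (auto intro!: arg_cong[where f=card])
    then have "real (card {z\<in>L. z - y \<in> L}) / real (card L) + \<beta> y = 1"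
      using N unfolding \<beta>_def by (simp add: add_divide_distrib[symmetric] del: of_nat_add flip: of_nat_add)
    then have \<rho>: "real (card {z\<in>L. z - y \<in> L}) / real (card L) = 1 - \<beta> y" by simp
    have "\<bar>G - (1 - \<beta> y) * S2 y\<bar> < 1 / 2 ^ n" using pE[OF yY] unfolding G_def \<rho> .
    moreover have "0 \<le> \<beta> y * S2 y" "\<beta> y * S2 y \<le> \<beta> y"
      using admissible_S2_bounds[OF adm, of y] mult_left_le[of "S2 y" "\<beta> y"] by (simp_all add: \<beta>_def)
    moreover have "(1 - \<beta> y) * S2 y = S2 y - \<beta> y * S2 y" by (simp add: left_diff_distrib)
    ultimately have "\<bar>Q - S2 y\<bar> \<le> 1 / 2 ^ n + \<beta> y + \<beta> z" using up lo by linarith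
    also have "\<dots> \<le> 1 / 2 ^ n + (\<Sum>b\<in>Basis. \<bar>y \<bullet> b\<bar>) / 2 ^ n + (\<Sum>b\<in>Basis. \<bar>z \<bullet> b\<bar>) / 2 ^ n"
      using \<beta>[OF yl] \<beta>[OF z(1)] by linarith
    finally show ?thesis unfolding Q_def y_def by (simp add: add_divide_distrib)
  qed
  \<comment> \<open>The substitution \<open>u \<mapsto> u - (w - v)\<close> carries the condition
    for \<open>v\<close> into the one for \<open>w\<close>; shifts pushed out of \<open>L\<close>
    cost \<open>\<beta> (w - v)\<close>.\<close>
  have 2: "measure_pmf.prob q {B. \<forall>x\<in>F. x + v \<in> B} \<le> measure_pmf.prob q {B. \<forall>x\<in>F. x + w \<in> B} + (\<Sum>b\<in>Basis. \<bar>(v - w) \<bullet> b\<bar>) / 2 ^ n"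
    if v: "v \<in> dyadic_lattice n" "w \<in> dyadic_lattice n" for F v w
  proof -
    have "measure_pmf.prob q {B. \<forall>x\<in>F. x + v \<in> B} \<le> measure_pmf.prob q {B. \<forall>x\<in>F. x + w \<in> B} + \<beta> (w - v)"
      unfolding prob
    proof (rule expectation_diff_le[of _ _ _ _ 1])
      fix \<sigma> assume "\<sigma> \<in> set_pmf p"
      have "card {u \<in> L. \<forall>x\<in>F. x + v \<in> {x. x + u \<in> \<sigma>}} = card ((\<lambda>u. u) ` {u \<in> L. \<forall>x\<in>F. x + v + u \<in> \<sigma>})" by simp
      also have "\<dots> \<le> card ({u \<in> L. u - (w - v) \<in> L \<and> (\<forall>x\<in>F. x + v + u \<in> \<sigma>)} \<union> {u\<in>L. u - (w - v) \<notin> L})"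
        using fL by (intro card_mono) auto
      also have "\<dots> \<le> card {u \<in> L. u - (w - v) \<in> L \<and> (\<forall>x\<in>F. x + v + u \<in> \<sigma>)} + card {u\<in>L. u - (w - v) \<notin> L}"
        by (rule card_Un_le)
      also have "card {u \<in> L. u - (w - v) \<in> L \<and> (\<forall>x\<in>F. x + v + u \<in> \<sigma>)}
        = card ((\<lambda>u. u - (w - v)) ` {u \<in> L. u - (w - v) \<in> L \<and> (\<forall>x\<in>F. x + v + u \<in> \<sigma>)})"
        by (intro card_image[symmetric] inj_onI) auto
      also have "\<dots> \<le> card {u \<in> L. \<forall>x\<in>F. x + w \<in> {x. x + u \<in> \<sigma>}}"
        using fL by (intro card_mono) (auto simp: algebra_simps)
      finally show "real (card {u \<in> L. \<forall>x\<in>F. x + v \<in> {x. x + u \<in> \<sigma>}}) / real (card L)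
        \<le> real (card {u \<in> L. \<forall>x\<in>F. x + w \<in> {x. x + u \<in> \<sigma>}}) / real (card L) + \<beta> (w - v)"
        unfolding \<beta>_def by (intro cdiv) simp
    qed (rule bd1)+
    also have "\<beta> (w - v) \<le> (\<Sum>b\<in>Basis. \<bar>(w - v) \<bullet> b\<bar>) / 2 ^ n" using v by (intro \<beta> dyadic_lattice_diff)
    also have "(\<Sum>b\<in>Basis. \<bar>(w - v) \<bullet> b\<bar>) = (\<Sum>b\<in>Basis. \<bar>(v - w) \<bullet> b\<bar>)"
      by (intro sum.cong refl) (simp add: inner_diff_left abs_minus_commute)
    finally show ?thesis by simp
  qed
  have z0: "0 \<in> dyadic_lattice n" by (simp add: dyadic_lattice_def)
  have 3: "\<bar>measure_pmf.prob q {B. \<forall>x\<in>F. x + v \<in> B} - measure_pmf.prob q {B. F \<subseteq> B}\<bar> \<le> (\<Sum>b\<in>Basis. \<bar>v \<bullet> b\<bar>) / 2 ^ n"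
    if v: "v \<in> dyadic_lattice n" for F v
  proof -
    have "{B. F \<subseteq> B} = {B. \<forall>x\<in>F. x + 0 \<in> B}" by auto
    then show ?thesis using 2[OF v z0, of F] 2[OF z0 v, of F] by (simp add: abs_le_iff)
  qed
  show ?thesis using 1 3 by blast
qed

section \<open>Limits of random subsets of a countable set\<close>

text \<open>Ternary digits 0 and 2: unlike in binary expansions, the first differing digit outweighs
  all later ones, so every bit can be read off the code with a definite margin.\<close>

definition cantor_real :: "(nat \<Rightarrow> bool) \<Rightarrow> real" where
  "cantor_real b = (\<Sum>i. if b i then 2 / 3 ^ Suc i else 0)"

lemma sums_ternary_tail: "(\<lambda>k. 2 / 3 ^ Suc (k + j)) sums (1 / 3 ^ j :: real)"
proof -
  have "(\<lambda>k. (2 / 3 ^ Suc j) * (1 / 3) ^ k) sums ((2 / 3 ^ Suc j) * (1 / (1 - 1 / 3)) :: real)"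
    by (intro sums_mult geometric_sums) simp
  moreover have "(\<lambda>k. (2 / 3 ^ Suc j) * (1 / 3) ^ k) = (\<lambda>k. 2 / 3 ^ Suc (k + j) :: real)"
    by (auto simp: power_add power_divide field_simps)
  moreover have "(2 / 3 ^ Suc j) * (1 / (1 - 1 / 3)) = (1 / 3 ^ j :: real)" by simp
  ultimately show ?thesis by simp
qed

lemma summable_cantor: "summable (\<lambda>i. if b i then 2 / 3 ^ Suc i else 0 :: real)"
  by (rule summable_comparison_test'[OF sums_summable[OF sums_ternary_tail[of 0]], of 0]) auto

lemma cantor_real_bounds: "0 \<le> cantor_real b" "cantor_real b \<le> 1"
proof -
  show "0 \<le> cantor_real b" unfolding cantor_real_def by (intro suminf_nonneg summable_cantor) auto
  have "cantor_real b \<le> (\<Sum>k. 2 / 3 ^ Suc (k + 0))"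
    unfolding cantor_real_def
    by (intro suminf_le summable_cantor sums_summable[OF sums_ternary_tail]) auto
  also have "\<dots> = 1" using sums_unique[OF sums_ternary_tail[of 0]] by simp
  finally show "cantor_real b \<le> 1" .
qed

text \<open>At the first disagreement \<open>j \<le> i\<close> the leading term is
  \<open>2 / 3 ^ Suc j\<close>, while the whole tail contributes at most half of that.\<close>

lemma cantor_real_separation:
  assumes "b i \<noteq> b' i"
  shows "1 / 3 ^ Suc i \<le> \<bar>cantor_real b - cantor_real b'\<bar>"
proof -
  define j where "j = (LEAST k. b k \<noteq> b' k)"
  have j: "b j \<noteq> b' j" unfolding j_def using assms by (rule LeastI)
  have ji: "j \<le> i" unfolding j_def using assms by (rule Least_le)
  have lt: "b k = b' k" if "k < j" for k using not_less_Least[of k "\<lambda>k. b k \<noteq> b' k"] that by (auto simp: j_def)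
  define a where "a k = (if b k then 2 / 3 ^ Suc k else 0) - (if b' k then 2 / 3 ^ Suc k else 0 :: real)" for k
  have sa: "summable a" unfolding a_def by (intro summable_diff summable_cantor)
  have diff: "cantor_real b - cantor_real b' = suminf a"
    unfolding cantor_real_def a_def by (intro suminf_diff summable_cantor)
  have "suminf a = (\<Sum>k. a (k + Suc j)) + sum a {..<Suc j}" by (rule suminf_split_initial_segment[OF sa])
  also have "sum a {..<Suc j} = a j" using lt by (simp add: a_def)
  finally have eq: "suminf a = (\<Sum>k. a (k + Suc j)) + a j" .
  have "norm (\<Sum>k. a (k + Suc j)) \<le> (\<Sum>k. 2 / 3 ^ Suc (k + Suc j))"
    by (rule norm_suminf_le[OF _ sums_summable[OF sums_ternary_tail]])
       (auto simp: a_def)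
  also have "\<dots> = 1 / 3 ^ Suc j" using sums_unique[OF sums_ternary_tail[of "Suc j"]] by simp
  finally have tail: "\<bar>\<Sum>k. a (k + Suc j)\<bar> \<le> 1 / 3 ^ Suc j" by simp
  have "\<bar>a j\<bar> = 2 / 3 ^ Suc j" using j by (auto simp: a_def)
  then have "1 / 3 ^ Suc j \<le> \<bar>suminf a\<bar>" using tail unfolding eq by linarith
  moreover have "1 / 3 ^ Suc i \<le> (1 / 3 ^ Suc j :: real)"
    using ji by (intro divide_left_mono power_increasing) auto
  ultimately show ?thesis unfolding diff by linarith
qed

text \<open>Compactness of the space of subsets of a countable set, by coding into the Cantor set and
  applying Helly selection and Skorohod representation on the line.\<close>
lemma pmf_limit_random_subset:
  fixes q :: "nat \<Rightarrow> 'a set pmf" and D :: "'a set"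
  assumes D: "countable D"
  shows "\<exists>(\<Omega> :: real measure) \<xi> r. prob_space \<Omega> \<and> strict_mono r \<and>
    (\<forall>z\<in>D. {\<omega>\<in>space \<Omega>. z \<in> \<xi> \<omega>} \<in> sets \<Omega>) \<and>
    (\<forall>F. finite F \<and> F \<subseteq> D \<longrightarrow>
      (\<lambda>n. measure_pmf.prob (q (r n)) {B. F \<subseteq> B}) \<longlonglongrightarrow> measure \<Omega> {\<omega>\<in>space \<Omega>. F \<subseteq> \<xi> \<omega>})"
proof -
  define idx where "idx = to_nat_on D"
  define code where "code B = cantor_real (\<lambda>i. \<exists>z\<in>D. idx z = i \<and> z \<in> B)" for B
  have bit: "(\<exists>z'\<in>D. idx z' = idx z \<and> z' \<in> B) \<longleftrightarrow> z \<in> B" if "z \<in> D" for z B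
    using inj_onD[OF inj_on_to_nat_on[OF D]] that unfolding idx_def by blast
  have sep: "1 / 3 ^ Suc (idx z) \<le> \<bar>code B - code B'\<bar>" if "z \<in> D" "(z \<in> B) \<noteq> (z \<in> B')" for z B B'
    unfolding code_def by (rule cantor_real_separation) (use that bit[OF that(1)] in simp)
  define \<mu> where "\<mu> n = distr (measure_pmf (q n)) borel code" for n
  have rd: "real_distribution (\<mu> n)" for n
    unfolding \<mu>_def real_distribution_def real_distribution_axioms_def
    by (auto intro!: measure_pmf.prob_space_distr)
  have "tight \<mu>"
    unfolding tight_def
  proof (intro conjI allI impI rd)
    fix \<epsilon> :: real assume "0 < \<epsilon>"
    have "measure (\<mu> n) {-1<..1} = 1" for n
    proof -
      have "- 1 < code B \<and> code B \<le> 1" for B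
        using cantor_real_bounds[of "\<lambda>i. \<exists>z\<in>D. idx z = i \<and> z \<in> B"] unfolding code_def by linarith
      then have "code -` {-1<..1} = UNIV" by auto
      then show ?thesis unfolding \<mu>_def by (subst measure_distr) auto
    qed
    then show "\<exists>a b. a < b \<and> (\<forall>n. 1 - \<epsilon> < measure (\<mu> n) {a<..b})"
      using \<open>0 < \<epsilon>\<close> by (intro exI[of _ "-1"] exI[of _ "1"]) auto
  qed
  from tight_imp_convergent_subsubsequence[OF this strict_mono_id]
  obtain r M where r: "strict_mono r" and M: "real_distribution M" "weak_conv_m (\<mu> \<circ> id \<circ> r) M" by blast
  have rd': "real_distribution ((\<mu> \<circ> id \<circ> r) n)" for n using rd by simp
  from Skorohod[OF rd' M]
  obtain \<Omega> :: "real measure" and Ys Y where \<Omega>: "prob_space \<Omega>"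
    and S: "\<forall>n. Ys n \<in> borel_measurable \<Omega>" "\<forall>n. distr \<Omega> borel (Ys n) = (\<mu> \<circ> id \<circ> r) n"
      "\<forall>x\<in>space \<Omega>. (\<lambda>n. Ys n x) \<longlonglongrightarrow> Y x"
    by blast
  have Ys[measurable]: "Ys n \<in> borel_measurable \<Omega>" and dYs: "distr \<Omega> borel (Ys n) = \<mu> (r n)" for n
    using S by auto
  have conv: "(\<lambda>n. Ys n x) \<longlonglongrightarrow> Y x" if "x \<in> space \<Omega>" for x using S(3) that by blast
  interpret prob_space \<Omega> by (rule \<Omega>)
  \<comment> \<open>An open set that contains the codes of exactly those \<open>B\<close> with
    \<open>z \<in> B\<close>, by the separation of codes. It makes the event "z belongs to the set"
    Borel on the line without inverting \<open>code\<close>.\<close>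
  define G where "G z = (\<Union>B\<in>{B. z \<in> B}. ball (code B) (1 / 3 ^ Suc (idx z)))" for z
  have Gm[measurable]: "G z \<in> sets borel" for z unfolding G_def by (intro borel_open open_UN) auto
  have G: "code B \<in> G z \<longleftrightarrow> z \<in> B" if z: "z \<in> D" for z B
  proof
    assume "code B \<in> G z"
    then obtain B' where B': "z \<in> B'" "code B \<in> ball (code B') (1 / 3 ^ Suc (idx z))" unfolding G_def by blast
    then have "\<bar>code B' - code B\<bar> < 1 / 3 ^ Suc (idx z)" by (simp add: dist_real_def)
    then show "z \<in> B" using sep[OF z, of B' B] B'(1) by linarith
  next
    assume "z \<in> B"
    then show "code B \<in> G z" unfolding G_def
      by (intro UN_I[of B] CollectI centre_in_ball[THEN iffD2]) simp_all
  qed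
  \<comment> \<open>A lower limit of the membership bits is measurable and is defined for every
    \<open>\<omega>\<close>, also where the bits do not settle.\<close>
  define \<xi> where "\<xi> \<omega> = {z\<in>D. \<exists>N. \<forall>n\<ge>N. Ys n \<omega> \<in> G z}" for \<omega>
  have "AE \<omega> in \<Omega>. Ys n \<omega> \<in> range code" for n
  proof -
    \<comment> \<open>The support of a \<open>pmf\<close> is countable, so its image under
      \<open>code\<close> is Borel, and membership in it transfers from the law to the Skorohod
      variables.\<close>
    let ?C = "code ` set_pmf (q (r n))"
    have C: "?C \<in> sets borel" by (rule sets.countable) auto
    have "AE x in \<mu> (r n). x \<in> ?C"
      unfolding \<mu>_def using C by (subst AE_distr_iff) (auto simp: AE_measure_pmf_iff)
    then have "AE \<omega> in \<Omega>. Ys n \<omega> \<in> ?C"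
      unfolding dYs[symmetric] using C by (subst (asm) AE_distr_iff) auto
    then show ?thesis by eventually_elim auto
  qed
  then have AEr: "AE \<omega> in \<Omega>. \<forall>n. Ys n \<omega> \<in> range code" by (simp add: AE_all_countable)
  \<comment> \<open>Once two codes are closer than \<open>1 / 3 ^ Suc (idx z)\<close> they agree on
    \<open>z\<close>; hence convergence of the codes makes each bit eventually constant.\<close>
  have key: "\<exists>N. \<forall>n\<ge>N. Ys n \<omega> \<in> G z \<longleftrightarrow> z \<in> \<xi> \<omega>"
    if z: "z \<in> D" and w: "\<omega> \<in> space \<Omega>" "\<forall>n. Ys n \<omega> \<in> range code" for z \<omega>
  proof -
    have "\<forall>n. \<exists>B. Ys n \<omega> = code B" using w(2) by (simp add: image_iff)
    then obtain B where B: "\<And>n. Ys n \<omega> = code (B n)" using choice[of "\<lambda>n B. Ys n \<omega> = code B"] by blast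
    have "Cauchy (\<lambda>n. Ys n \<omega>)" using conv[OF w(1)] by (rule LIMSEQ_imp_Cauchy)
    from metric_CauchyD[OF this, of "1 / 3 ^ Suc (idx z)"]
    obtain N where N: "\<And>m n. m \<ge> N \<Longrightarrow> n \<ge> N \<Longrightarrow> dist (Ys m \<omega>) (Ys n \<omega>) < 1 / 3 ^ Suc (idx z)"
      by auto
    have same: "z \<in> B m \<longleftrightarrow> z \<in> B n" if "m \<ge> N" "n \<ge> N" for m n
      using sep[OF z, of "B m" "B n"] N[OF that] unfolding B dist_real_def by linarith
    have "z \<in> \<xi> \<omega> \<longleftrightarrow> z \<in> B N"
    proof
      assume "z \<in> \<xi> \<omega>"
      then obtain N' where "\<forall>n\<ge>N'. Ys n \<omega> \<in> G z" by (auto simp: \<xi>_def)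
      then have "z \<in> B (max N N')" unfolding B using G[OF z] by auto
      then show "z \<in> B N" using same[of "max N N'" N] by auto
    next
      assume "z \<in> B N"
      then have "\<forall>n\<ge>N. Ys n \<omega> \<in> G z" unfolding B using G[OF z] same by blast
      then show "z \<in> \<xi> \<omega>" using z by (auto simp: \<xi>_def)
    qed
    then show ?thesis using same G[OF z] unfolding B by blast
  qed
  have meas: "{\<omega>\<in>space \<Omega>. z \<in> \<xi> \<omega>} \<in> sets \<Omega>" if "z \<in> D" for z
    unfolding \<xi>_def using that by simp
  have lim: "(\<lambda>n. measure_pmf.prob (q (r n)) {B. F \<subseteq> B}) \<longlonglongrightarrow> measure \<Omega> {\<omega>\<in>space \<Omega>. F \<subseteq> \<xi> \<omega>}"
    if F: "finite F" "F \<subseteq> D" for F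
  proof -
    have m1: "{\<omega>\<in>space \<Omega>. F \<subseteq> \<xi> \<omega>} \<in> sets \<Omega>"
    proof -
      have "{\<omega>\<in>space \<Omega>. F \<subseteq> \<xi> \<omega>} = {\<omega>\<in>space \<Omega>. \<forall>z\<in>F. z \<in> \<xi> \<omega>}" by auto
      also have "\<dots> \<in> sets \<Omega>" using F meas by (intro sets.sets_Collect_finite_All) auto
      finally show ?thesis .
    qed
    have m2: "{\<omega>\<in>space \<Omega>. \<forall>z\<in>F. Ys n \<omega> \<in> G z} \<in> sets \<Omega>" for n
      using F by (intro sets.sets_Collect_finite_All) auto
    have pr: "measure_pmf.prob (q (r n)) {B. F \<subseteq> B} = measure \<Omega> {\<omega>\<in>space \<Omega>. \<forall>z\<in>F. Ys n \<omega> \<in> G z}" for n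
    proof -
      have GF: "(\<Inter>z\<in>F. G z) \<in> sets borel" if "F \<noteq> {}" using F that by (intro sets.finite_INT) auto
      then have GF': "{x. \<forall>z\<in>F. x \<in> G z} \<in> sets borel" by (cases "F = {}") (auto simp: INTER_eq)
      have "measure \<Omega> {\<omega>\<in>space \<Omega>. \<forall>z\<in>F. Ys n \<omega> \<in> G z} = measure (\<mu> (r n)) {x. \<forall>z\<in>F. x \<in> G z}"
        unfolding dYs[symmetric] using GF' by (subst measure_distr) (auto intro!: arg_cong[where f="measure \<Omega>"])
      also have "\<dots> = measure_pmf.prob (q (r n)) (code -` {x. \<forall>z\<in>F. x \<in> G z})"
        unfolding \<mu>_def using GF' by (subst measure_distr) auto
      also have "code -` {x. \<forall>z\<in>F. x \<in> G z} = {B. F \<subseteq> B}" using G F by auto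
      finally show ?thesis by simp
    qed
    have "(\<lambda>n. \<integral>\<omega>. indicator {\<omega>\<in>space \<Omega>. \<forall>z\<in>F. Ys n \<omega> \<in> G z} \<omega> \<partial>\<Omega>) \<longlonglongrightarrow> (\<integral>\<omega>. indicator {\<omega>\<in>space \<Omega>. F \<subseteq> \<xi> \<omega>} \<omega> \<partial>\<Omega> :: real)"
    proof (rule integral_dominated_convergence[where w="\<lambda>_. 1"])
      show "AE \<omega> in \<Omega>. (\<lambda>n. indicator {\<omega>\<in>space \<Omega>. \<forall>z\<in>F. Ys n \<omega> \<in> G z} \<omega> :: real) \<longlonglongrightarrow> indicator {\<omega>\<in>space \<Omega>. F \<subseteq> \<xi> \<omega>} \<omega>"
        using AEr AE_space
      proof eventually_elim
        fix \<omega> assume w: "\<forall>n. Ys n \<omega> \<in> range code" "\<omega> \<in> space \<Omega>"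
        have "\<forall>z\<in>F. eventually (\<lambda>n. Ys n \<omega> \<in> G z \<longleftrightarrow> z \<in> \<xi> \<omega>) sequentially"
          using key[OF _ w(2,1)] F unfolding eventually_sequentially by blast
        then have "eventually (\<lambda>n. \<forall>z\<in>F. Ys n \<omega> \<in> G z \<longleftrightarrow> z \<in> \<xi> \<omega>) sequentially"
          using F by (simp add: eventually_ball_finite)
        then have "eventually (\<lambda>n. indicator {\<omega>\<in>space \<Omega>. \<forall>z\<in>F. Ys n \<omega> \<in> G z} \<omega> = (indicator {\<omega>\<in>space \<Omega>. F \<subseteq> \<xi> \<omega>} \<omega> :: real)) sequentially"
          by eventually_elim (auto simp: indicator_def)
        then show "(\<lambda>n. indicator {\<omega>\<in>space \<Omega>. \<forall>z\<in>F. Ys n \<omega> \<in> G z} \<omega> :: real) \<longlonglongrightarrow> indicator {\<omega>\<in>space \<Omega>. F \<subseteq> \<xi> \<omega>} \<omega>"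
          by (rule tendsto_eventually)
      qed
    qed (use m1 m2 in \<open>auto simp: indicator_def\<close>)
    then show ?thesis unfolding pr using m1 m2 by simp
  qed
  show ?thesis using \<Omega> r meas lim by blast
qed

section \<open>From lattice configurations to a measurable random field\<close>

text \<open>Fixed dyadic points lie in all sufficiently fine lattices, and for them every error in
  \<open>dyadic_pmf_exists\<close> is a constant over \<open>2 ^ n\<close>, so the identities become
  exact in the limit. Invariance is recorded only for inclusion events of finite sets; these
  determine all finite traces, as \<open>expectation_trace_eq\<close> shows.\<close>

lemma dyadic_field_exists:
  fixes S2 :: "'a::euclidean_space \<Rightarrow> real"
  assumes adm: "admissible_S2 S2"
  defines "D \<equiv> (\<Union>n. dyadic_lattice n :: 'a set)"
  shows "\<exists>(\<Omega> :: real measure) \<xi>. prob_space \<Omega> \<and>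
    (\<forall>z\<in>D. {\<omega>\<in>space \<Omega>. z \<in> \<xi> \<omega>} \<in> sets \<Omega>) \<and>
    (\<forall>z\<in>D. \<forall>z'\<in>D. measure \<Omega> {\<omega>\<in>space \<Omega>. z \<in> \<xi> \<omega> \<and> z' \<in> \<xi> \<omega>} = S2 (z - z')) \<and>
    (\<forall>F. \<forall>v\<in>D. finite F \<and> F \<subseteq> D \<longrightarrow>
      measure \<Omega> {\<omega>\<in>space \<Omega>. \<forall>x\<in>F. x + v \<in> \<xi> \<omega>} = measure \<Omega> {\<omega>\<in>space \<Omega>. F \<subseteq> \<xi> \<omega>})"
proof -
  have cD: "countable D" unfolding D_def using countable_dyadic_lattice by auto
  have Dev: "eventually (\<lambda>n. z \<in> dyadic_lattice n) sequentially" if z: "z \<in> D" for z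
  proof -
    obtain m where "z \<in> dyadic_lattice m" using z by (auto simp: D_def)
    then show ?thesis unfolding eventually_sequentially using dyadic_lattice_mono by blast
  qed
  have Dplus: "x + v \<in> D" if "x \<in> D" "v \<in> D" for x v
  proof -
    have "eventually (\<lambda>n. x \<in> dyadic_lattice n \<and> v \<in> dyadic_lattice n) sequentially"
      using Dev[OF that(1)] Dev[OF that(2)] by (rule eventually_conj)
    then obtain n where "x \<in> dyadic_lattice n" "v \<in> dyadic_lattice n"
      by (auto simp: eventually_sequentially)
    then show ?thesis using dyadic_lattice_add by (auto simp: D_def)
  qed
  define P where "P n q \<longleftrightarrow>
    (\<forall>z\<in>dyadic_lattice n. \<forall>z'\<in>dyadic_lattice n. (\<forall>b\<in>Basis. \<bar>(z - z') \<bullet> b\<bar> \<le> real n) \<longrightarrow>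
      \<bar>measure_pmf.prob q {B. z \<in> B \<and> z' \<in> B} - S2 (z - z')\<bar>
        \<le> (1 + (\<Sum>b\<in>Basis. \<bar>(z - z') \<bullet> b\<bar>) + (\<Sum>b\<in>Basis. \<bar>z \<bullet> b\<bar>)) / 2 ^ n) \<and>
    (\<forall>F. \<forall>v\<in>dyadic_lattice n.
      \<bar>measure_pmf.prob q {B. \<forall>x\<in>F. x + v \<in> B} - measure_pmf.prob q {B. F \<subseteq> B}\<bar> \<le> (\<Sum>b\<in>Basis. \<bar>v \<bullet> b\<bar>) / 2 ^ n)"
    for n and q :: "'a set pmf"
  have "\<exists>q. P n q" for n unfolding P_def by (rule dyadic_pmf_exists[OF adm])
  then obtain q where q: "\<And>n. P n (q n)" by metis
  have q1: "\<bar>measure_pmf.prob (q n) {B. z \<in> B \<and> z' \<in> B} - S2 (z - z')\<bar>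
        \<le> (1 + (\<Sum>b\<in>Basis. \<bar>(z - z') \<bullet> b\<bar>) + (\<Sum>b\<in>Basis. \<bar>z \<bullet> b\<bar>)) / 2 ^ n"
    if "z \<in> dyadic_lattice n" "z' \<in> dyadic_lattice n" "\<forall>b\<in>Basis. \<bar>(z - z') \<bullet> b\<bar> \<le> real n" for n z z'
    using q[of n] that unfolding P_def by blast
  have q2: "\<bar>measure_pmf.prob (q n) {B. \<forall>x\<in>F. x + v \<in> B} - measure_pmf.prob (q n) {B. F \<subseteq> B}\<bar>
      \<le> (\<Sum>b\<in>Basis. \<bar>v \<bullet> b\<bar>) / 2 ^ n" if "v \<in> dyadic_lattice n" for n F v
    using q[of n] that unfolding P_def by blast
  obtain \<Omega> :: "real measure" and \<xi> r where \<Omega>: "prob_space \<Omega>" and r: "strict_mono r"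
    and m': "\<forall>z\<in>D. {\<omega>\<in>space \<Omega>. z \<in> \<xi> \<omega>} \<in> sets \<Omega>"
    and lim': "\<forall>F. finite F \<and> F \<subseteq> D \<longrightarrow>
      (\<lambda>n. measure_pmf.prob (q (r n)) {B. F \<subseteq> B}) \<longlonglongrightarrow> measure \<Omega> {\<omega>\<in>space \<Omega>. F \<subseteq> \<xi> \<omega>}"
    using pmf_limit_random_subset[OF cD, of q] by (elim exE conjE)
  note m = m'[rule_format] and lim = lim'[rule_format, OF conjI]
  have K0: "(\<lambda>n. K / 2 ^ n :: real) \<longlonglongrightarrow> 0" for K by (rule LIMSEQ_divide_realpow_zero) simp
  have sub: "(\<lambda>n. f (r n)) \<longlonglongrightarrow> l" if "f \<longlonglongrightarrow> l" for f :: "nat \<Rightarrow> real" and l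
    using LIMSEQ_subseq_LIMSEQ[OF that r] by (simp add: o_def)
  have 1: "measure \<Omega> {\<omega>\<in>space \<Omega>. z \<in> \<xi> \<omega> \<and> z' \<in> \<xi> \<omega>} = S2 (z - z')" if z: "z \<in> D" "z' \<in> D" for z z'
  proof -
    define K where "K = 1 + (\<Sum>b\<in>Basis. \<bar>(z - z') \<bullet> b\<bar>) + (\<Sum>b\<in>Basis. \<bar>z \<bullet> b\<bar>)"
    obtain N where N: "norm (z - z') \<le> real N" using real_arch_simple by blast
    have "eventually (\<lambda>n. norm (measure_pmf.prob (q n) {B. z \<in> B \<and> z' \<in> B} - S2 (z - z')) \<le> K / 2 ^ n) sequentially"
      using Dev[OF z(1)] Dev[OF z(2)] eventually_ge_at_top[of N]
    proof eventually_elim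
      fix n assume n: "z \<in> dyadic_lattice n" "z' \<in> dyadic_lattice n" "N \<le> n"
      have "\<forall>b\<in>Basis. \<bar>(z - z') \<bullet> b\<bar> \<le> real n"
        using N n(3) Basis_le_norm[of _ "z - z'"] by (meson of_nat_mono order_trans)
      then show "norm (measure_pmf.prob (q n) {B. z \<in> B \<and> z' \<in> B} - S2 (z - z')) \<le> K / 2 ^ n"
        using q1[OF n(1,2)] unfolding K_def by simp
    qed
    from Lim_null_comparison[OF this K0]
    have "(\<lambda>n. measure_pmf.prob (q n) {B. z \<in> B \<and> z' \<in> B}) \<longlonglongrightarrow> S2 (z - z')"
      by (rule LIM_zero_cancel)
    from sub[OF this] have "(\<lambda>n. measure_pmf.prob (q (r n)) {B. {z, z'} \<subseteq> B}) \<longlonglongrightarrow> S2 (z - z')" by simp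
    moreover have "(\<lambda>n. measure_pmf.prob (q (r n)) {B. {z, z'} \<subseteq> B}) \<longlonglongrightarrow> measure \<Omega> {\<omega>\<in>space \<Omega>. {z, z'} \<subseteq> \<xi> \<omega>}"
      using z by (intro lim) auto
    ultimately show ?thesis using LIMSEQ_unique by fastforce
  qed
  have 2: "measure \<Omega> {\<omega>\<in>space \<Omega>. \<forall>x\<in>F. x + v \<in> \<xi> \<omega>} = measure \<Omega> {\<omega>\<in>space \<Omega>. F \<subseteq> \<xi> \<omega>}"
    if F: "finite F" "F \<subseteq> D" and v: "v \<in> D" for F v
  proof -
    have "eventually (\<lambda>n. norm (measure_pmf.prob (q n) {B. \<forall>x\<in>F. x + v \<in> B} - measure_pmf.prob (q n) {B. F \<subseteq> B}) \<le> (\<Sum>b\<in>Basis. \<bar>v \<bullet> b\<bar>) / 2 ^ n) sequentially"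
      using Dev[OF v] by eventually_elim (simp add: q2)
    from Lim_null_comparison[OF this K0]
    have d0: "(\<lambda>n. measure_pmf.prob (q (r n)) {B. \<forall>x\<in>F. x + v \<in> B} - measure_pmf.prob (q (r n)) {B. F \<subseteq> B}) \<longlonglongrightarrow> 0"
      by (rule sub)
    have eq: "{B. \<forall>x\<in>F. x + v \<in> B} = {B. (\<lambda>x. x + v) ` F \<subseteq> B}" by auto
    have "(\<lambda>n. measure_pmf.prob (q (r n)) {B. \<forall>x\<in>F. x + v \<in> B}) \<longlonglongrightarrow> measure \<Omega> {\<omega>\<in>space \<Omega>. (\<lambda>x. x + v) ` F \<subseteq> \<xi> \<omega>}"
      unfolding eq using F v Dplus by (intro lim) auto
    from tendsto_diff[OF this lim[OF F]] d0
    have "measure \<Omega> {\<omega>\<in>space \<Omega>. (\<lambda>x. x + v) ` F \<subseteq> \<xi> \<omega>} - measure \<Omega> {\<omega>\<in>space \<Omega>. F \<subseteq> \<xi> \<omega>} = 0"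
      by (rule LIMSEQ_unique)
    moreover have "{\<omega>\<in>space \<Omega>. \<forall>x\<in>F. x + v \<in> \<xi> \<omega>} = {\<omega>\<in>space \<Omega>. (\<lambda>x. x + v) ` F \<subseteq> \<xi> \<omega>}" by auto
    ultimately show ?thesis by simp
  qed
  show ?thesis using \<Omega> m 1 2 by blast
qed

section \<open>Probabilities of disagreement\<close>

lemma (in prob_space) prob_neq_le:
  assumes A: "{\<omega>\<in>space M. P \<omega>} \<in> events" and B: "{\<omega>\<in>space M. Q \<omega>} \<in> events"
  shows "prob {\<omega>\<in>space M. P \<omega> \<noteq> Q \<omega>}
    \<le> prob {\<omega>\<in>space M. P \<omega>} + prob {\<omega>\<in>space M. Q \<omega>} - 2 * prob {\<omega>\<in>space M. P \<omega> \<and> Q \<omega>}"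
proof -
  let ?A = "{\<omega>\<in>space M. P \<omega>}" and ?B = "{\<omega>\<in>space M. Q \<omega>}"
  have "prob {\<omega>\<in>space M. P \<omega> \<noteq> Q \<omega>} = prob ((?A - ?B) \<union> (?B - ?A))"
    by (intro arg_cong[where f=prob]) auto
  also have "\<dots> \<le> prob (?A - ?B) + prob (?B - ?A)" using A B by (intro measure_Un_le) auto
  also have "prob (?A - ?B) = prob ?A - prob (?A \<inter> ?B)" by (rule finite_measure_Diff'[OF A B])
  also have "prob (?B - ?A) = prob ?B - prob (?B \<inter> ?A)" by (rule finite_measure_Diff'[OF B A])
  also have "?B \<inter> ?A = ?A \<inter> ?B" by auto
  also have "?A \<inter> ?B = {\<omega>\<in>space M. P \<omega> \<and> Q \<omega>}" by auto
  finally show ?thesis by simp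
qed

lemma (in prob_space) prob_Ball_diff_le:
  assumes F: "finite F" and A: "\<And>i. i \<in> F \<Longrightarrow> {\<omega>\<in>space M. A i \<omega>} \<in> events"
    and B: "\<And>i. i \<in> F \<Longrightarrow> {\<omega>\<in>space M. B i \<omega>} \<in> events"
  shows "\<bar>prob {\<omega>\<in>space M. \<forall>i\<in>F. A i \<omega>} - prob {\<omega>\<in>space M. \<forall>i\<in>F. B i \<omega>}\<bar> \<le> (\<Sum>i\<in>F. prob {\<omega>\<in>space M. A i \<omega> \<noteq> B i \<omega>})"
proof -
  have one: "prob {\<omega>\<in>space M. \<forall>i\<in>F. A i \<omega>} \<le> prob {\<omega>\<in>space M. \<forall>i\<in>F. B i \<omega>} + (\<Sum>i\<in>F. prob {\<omega>\<in>space M. A i \<omega> \<noteq> B i \<omega>})"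
    if A: "\<And>i. i \<in> F \<Longrightarrow> {\<omega>\<in>space M. A i \<omega>} \<in> events"
    and B: "\<And>i. i \<in> F \<Longrightarrow> {\<omega>\<in>space M. B i \<omega>} \<in> events" for A B
  proof -
    have ne: "{\<omega>\<in>space M. A i \<omega> \<noteq> B i \<omega>} \<in> events" if "i \<in> F" for i
    proof -
      have "{\<omega>\<in>space M. A i \<omega> \<noteq> B i \<omega>} = sym_diff {\<omega>\<in>space M. A i \<omega>} {\<omega>\<in>space M. B i \<omega>}" by auto
      then show ?thesis using A[OF that] B[OF that] by auto
    qed
    have Bm: "{\<omega>\<in>space M. \<forall>i\<in>F. B i \<omega>} \<in> events" using F B by (intro sets.sets_Collect_finite_All) auto
    have "prob {\<omega>\<in>space M. \<forall>i\<in>F. A i \<omega>} \<le> prob ({\<omega>\<in>space M. \<forall>i\<in>F. B i \<omega>} \<union> (\<Union>i\<in>F. {\<omega>\<in>space M. A i \<omega> \<noteq> B i \<omega>}))"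
      using Bm ne F by (intro finite_measure_mono sets.Un sets.finite_UN) auto
    also have "\<dots> \<le> prob {\<omega>\<in>space M. \<forall>i\<in>F. B i \<omega>} + prob (\<Union>i\<in>F. {\<omega>\<in>space M. A i \<omega> \<noteq> B i \<omega>})"
      using Bm ne F by (intro measure_Un_le sets.finite_UN) auto
    also have "prob (\<Union>i\<in>F. {\<omega>\<in>space M. A i \<omega> \<noteq> B i \<omega>}) \<le> (\<Sum>i\<in>F. prob {\<omega>\<in>space M. A i \<omega> \<noteq> B i \<omega>})"
      using F ne by (intro measure_UNION_le) auto
    finally show ?thesis by simp
  qed
  have "{\<omega>\<in>space M. B i \<omega> \<noteq> A i \<omega>} = {\<omega>\<in>space M. A i \<omega> \<noteq> B i \<omega>}" for i by auto
  then show ?thesis using one[of A B, OF A B] one[of B A, OF B A] unfolding abs_le_iff by simp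
qed

lemma LIMSEQ_norm_diff_bound:
  fixes f :: "nat \<Rightarrow> real"
  assumes "\<And>k. norm (f k - l) \<le> g k" "g \<longlonglongrightarrow> 0"
  shows "f \<longlonglongrightarrow> l"
proof -
  have "(\<lambda>k. f k - l) \<longlonglongrightarrow> 0"
    by (rule Lim_null_comparison[OF always_eventually[OF allI] assms(2)]) (rule assms(1))
  then show ?thesis by (rule LIM_zero_cancel)
qed

text \<open>The dyadic field is extended to all points along the dyadic roundings of a point; the
  exceptional probabilities are summable because of the Lipschitz bound.\<close>
lemma measurable_field_exists:
  fixes S2 :: "'a::euclidean_space \<Rightarrow> real"
  assumes adm: "admissible_S2 S2" and C: "0 \<le> C" "\<And>x y. \<bar>S2 x - S2 y\<bar> \<le> C * norm (x - y)"
  shows "\<exists>(\<Omega> :: real measure) X. prob_space \<Omega> \<and>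
    {p\<in>space (\<Omega> \<Otimes>\<^sub>M borel). snd p \<in> X (fst p)} \<in> sets (\<Omega> \<Otimes>\<^sub>M (borel :: 'a measure)) \<and>
    (\<forall>x x'. measure \<Omega> {\<omega>\<in>space \<Omega>. x \<in> X \<omega> \<and> x' \<in> X \<omega>} = S2 (x - x')) \<and>
    (\<forall>F y. finite F \<longrightarrow>
      measure \<Omega> {\<omega>\<in>space \<Omega>. \<forall>x\<in>F. x + y \<in> X \<omega>} = measure \<Omega> {\<omega>\<in>space \<Omega>. \<forall>x\<in>F. x \<in> X \<omega>})"
proof -
  define D where "D = (\<Union>n. dyadic_lattice n :: 'a set)"
  obtain \<Omega> :: "real measure" and \<xi> where \<Omega>: "prob_space \<Omega>"
    and m': "\<forall>z\<in>D. {\<omega>\<in>space \<Omega>. z \<in> \<xi> \<omega>} \<in> sets \<Omega>"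
    and two': "\<forall>z\<in>D. \<forall>z'\<in>D. measure \<Omega> {\<omega>\<in>space \<Omega>. z \<in> \<xi> \<omega> \<and> z' \<in> \<xi> \<omega>} = S2 (z - z')"
    and shift': "\<forall>F. \<forall>v\<in>D. finite F \<and> F \<subseteq> D \<longrightarrow>
      measure \<Omega> {\<omega>\<in>space \<Omega>. \<forall>x\<in>F. x + v \<in> \<xi> \<omega>} = measure \<Omega> {\<omega>\<in>space \<Omega>. F \<subseteq> \<xi> \<omega>}"
    using dyadic_field_exists[OF adm] unfolding D_def by (elim exE conjE)
  note m = m'[rule_format] and two = two'[rule_format] and shift = shift'[rule_format, OF _ conjI]
  interpret prob_space \<Omega> by (rule \<Omega>)
  have flD: "dyadic_floor k x \<in> D" for k x unfolding D_def using dyadic_floor_in_lattice by blast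
  define X where "X \<omega> = {x. \<exists>N. \<forall>k\<ge>N. dyadic_floor k x \<in> \<xi> \<omega>}" for \<omega>
  define d :: real where "d = DIM('a)"
  have d: "0 \<le> d" by (simp add: d_def)
  have K0: "(\<lambda>n. K / 2 ^ n :: real) \<longlonglongrightarrow> 0" for K by (rule LIMSEQ_divide_realpow_zero) simp
  have fl: "norm (x - dyadic_floor k x) \<le> d / 2 ^ k" for k and x :: 'a
    unfolding d_def by (rule norm_diff_dyadic_floor)
  \<comment> \<open>The slack factor 2 lets \<open>approx\<close> serve both single roundings and
    sums of two roundings.\<close>
  have fl2: "norm (x - dyadic_floor k x) \<le> 2 * d / 2 ^ k" for k and x :: 'a
    by (rule order_trans[OF fl]) (use d in \<open>simp add: divide_right_mono\<close>)
  have joint: "{p\<in>space (\<Omega> \<Otimes>\<^sub>M borel). snd p \<in> X (fst p)} \<in> sets (\<Omega> \<Otimes>\<^sub>M (borel :: 'a measure))"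
  proof -
    have bk: "{p\<in>space (\<Omega> \<Otimes>\<^sub>M borel). dyadic_floor k (snd p) \<in> \<xi> (fst p)} \<in> sets (\<Omega> \<Otimes>\<^sub>M (borel :: 'a measure))" for k
    proof -
      have "{p\<in>space (\<Omega> \<Otimes>\<^sub>M borel). dyadic_floor k (snd p) \<in> \<xi> (fst p)}
        = (\<Union>z\<in>dyadic_lattice k. {\<omega>\<in>space \<Omega>. z \<in> \<xi> \<omega>} \<times> {x. dyadic_floor k x = z})"
        using dyadic_floor_in_lattice by (auto simp: space_pair_measure)
      also have "\<dots> \<in> sets (\<Omega> \<Otimes>\<^sub>M (borel :: 'a measure))"
      proof -
        have "{\<omega>\<in>space \<Omega>. z \<in> \<xi> \<omega>} \<times> {x. dyadic_floor k x = z} \<in> sets (\<Omega> \<Otimes>\<^sub>M (borel :: 'a measure))"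
          if "z \<in> dyadic_lattice k" for z
        proof (rule pair_measureI)
          show "{\<omega>\<in>space \<Omega>. z \<in> \<xi> \<omega>} \<in> sets \<Omega>" using that by (intro m) (auto simp: D_def)
          have "dyadic_floor k -` {z} \<inter> space borel \<in> sets (borel :: 'a measure)"
            by (rule measurable_sets[OF measurable_dyadic_floor]) simp
          then show "{x. dyadic_floor k x = z} \<in> sets borel" by (simp add: vimage_def)
        qed
        then show ?thesis by (intro sets.countable_UN'[OF countable_dyadic_lattice]) auto
      qed
      finally show ?thesis .
    qed
    have "{p\<in>space (\<Omega> \<Otimes>\<^sub>M borel). snd p \<in> X (fst p)}
      = {p\<in>space (\<Omega> \<Otimes>\<^sub>M borel). \<exists>N. \<forall>k\<in>{N..}. dyadic_floor k (snd p) \<in> \<xi> (fst p)}"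
      by (auto simp: X_def)
    also have "\<dots> \<in> sets (\<Omega> \<Otimes>\<^sub>M borel)"
      by (intro sets.sets_Collect_countable_Ex sets.sets_Collect_countable_Ball bk)
    finally show ?thesis .
  qed
  have Xm: "{\<omega>\<in>space \<Omega>. x \<in> X \<omega>} \<in> sets \<Omega>" for x
  proof -
    have "{\<omega>\<in>space \<Omega>. x \<in> X \<omega>} = {\<omega>\<in>space \<Omega>. \<exists>N. \<forall>k\<in>{N..}. dyadic_floor k x \<in> \<xi> \<omega>}"
      by (auto simp: X_def)
    also have "\<dots> \<in> sets \<Omega>"
      by (intro sets.sets_Collect_countable_Ex sets.sets_Collect_countable_Ball m flD)
    finally show ?thesis .
  qed
  have ne: "{\<omega>\<in>space \<Omega>. P \<omega> \<noteq> Q \<omega>} \<in> sets \<Omega>" if "{\<omega>\<in>space \<Omega>. P \<omega>} \<in> sets \<Omega>" "{\<omega>\<in>space \<Omega>. Q \<omega>} \<in> sets \<Omega>" for P Q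
  proof -
    have "{\<omega>\<in>space \<Omega>. P \<omega> \<noteq> Q \<omega>} = sym_diff {\<omega>\<in>space \<Omega>. P \<omega>} {\<omega>\<in>space \<Omega>. Q \<omega>}" by auto
    then show ?thesis using that by auto
  qed
  have xx: "prob {\<omega>\<in>space \<Omega>. (z \<in> \<xi> \<omega>) \<noteq> (z' \<in> \<xi> \<omega>)} \<le> 2 * C * norm (z - z')" if z: "z \<in> D" "z' \<in> D" for z z'
  proof -
    have "prob {\<omega>\<in>space \<Omega>. (z \<in> \<xi> \<omega>) \<noteq> (z' \<in> \<xi> \<omega>)} \<le> 2 * (S2 0 - S2 (z - z'))"
      using prob_neq_le[OF m[OF z(1)] m[OF z(2)]] two[OF z(1) z(1)] two[OF z(2) z(2)] two[OF z] by simp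
    also have "S2 0 - S2 (z - z') \<le> C * norm (z - z')" using C(2)[of 0 "z - z'"] by (simp add: abs_le_iff norm_minus_commute)
    finally show ?thesis by simp
  qed
  have Xfl: "prob {\<omega>\<in>space \<Omega>. (x \<in> X \<omega>) \<noteq> (dyadic_floor k x \<in> \<xi> \<omega>)} \<le> 8 * C * d / 2 ^ k" for x k
  proof -
    \<comment> \<open>If no two consecutive roundings from level \<open>k\<close> on disagree, the
      lower limit equals the value at level \<open>k\<close>. So a disagreement lies in some
      \<open>E l\<close>, and the probabilities of these form a geometric series.\<close>
    define E where "E l = {\<omega>\<in>space \<Omega>. (dyadic_floor (k + l) x \<in> \<xi> \<omega>) \<noteq> (dyadic_floor (k + Suc l) x \<in> \<xi> \<omega>)}" for l
    have Em: "E l \<in> sets \<Omega>" for l unfolding E_def using m flD by (intro ne) auto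
    have Eb: "prob (E l) \<le> (4 * C * d / 2 ^ k) * (1 / 2) ^ l" for l
    proof -
      have "prob (E l) \<le> 2 * C * norm (dyadic_floor (k + l) x - dyadic_floor (k + Suc l) x)"
        unfolding E_def by (intro xx flD)
      also have "norm (dyadic_floor (k + l) x - dyadic_floor (k + Suc l) x) \<le> 2 * d / 2 ^ (k + l)"
      proof -
        have "norm (dyadic_floor (k + l) x - dyadic_floor (k + Suc l) x)
           = norm ((x - dyadic_floor (k + Suc l) x) - (x - dyadic_floor (k + l) x))" by simp
        also have "\<dots> \<le> norm (x - dyadic_floor (k + Suc l) x) + norm (x - dyadic_floor (k + l) x)"
          by (rule norm_triangle_ineq4)
        also have "\<dots> \<le> d / 2 ^ (k + Suc l) + d / 2 ^ (k + l)" by (intro add_mono fl)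
        also have "\<dots> \<le> 2 * d / 2 ^ (k + l)" using d by (simp add: field_simps)
        finally show ?thesis .
      qed
      finally have "prob (E l) \<le> 2 * C * (2 * d / 2 ^ (k + l))" using C(1) by (simp add: mult_left_mono)
      then show ?thesis by (simp add: power_add power_divide)
    qed
    have geo: "(\<lambda>l. (4 * C * d / 2 ^ k) * (1 / 2) ^ l) sums ((4 * C * d / 2 ^ k) * (1 / (1 - 1 / 2)))"
      by (intro sums_mult geometric_sums) simp
    have sE: "summable (\<lambda>l. prob (E l))"
      by (rule summable_comparison_test'[OF sums_summable[OF geo], of 0]) (use Eb in auto)
    have "{\<omega>\<in>space \<Omega>. (x \<in> X \<omega>) \<noteq> (dyadic_floor k x \<in> \<xi> \<omega>)} \<subseteq> (\<Union>l. E l)"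
    proof
      fix \<omega> assume w: "\<omega> \<in> {\<omega>\<in>space \<Omega>. (x \<in> X \<omega>) \<noteq> (dyadic_floor k x \<in> \<xi> \<omega>)}"
      show "\<omega> \<in> (\<Union>l. E l)"
      proof (rule ccontr)
        assume "\<omega> \<notin> (\<Union>l. E l)"
        then have same: "(dyadic_floor (k + l) x \<in> \<xi> \<omega>) = (dyadic_floor (k + Suc l) x \<in> \<xi> \<omega>)" for l
          using w by (auto simp: E_def)
        have all: "(dyadic_floor (k + l) x \<in> \<xi> \<omega>) = (dyadic_floor k x \<in> \<xi> \<omega>)" for l
          by (induction l) (use same in auto)
        have "(x \<in> X \<omega>) = (dyadic_floor k x \<in> \<xi> \<omega>)"
        proof
          assume "x \<in> X \<omega>"
          then obtain N where "\<forall>k\<ge>N. dyadic_floor k x \<in> \<xi> \<omega>" by (auto simp: X_def)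
          then have "dyadic_floor (k + N) x \<in> \<xi> \<omega>" by simp
          then show "dyadic_floor k x \<in> \<xi> \<omega>" using all by blast
        next
          assume "dyadic_floor k x \<in> \<xi> \<omega>"
          then have "\<forall>j\<ge>k. dyadic_floor j x \<in> \<xi> \<omega>" using all by (metis le_Suc_ex)
          then show "x \<in> X \<omega>" by (auto simp: X_def)
        qed
        then show False using w by simp
      qed
    qed
    then have "prob {\<omega>\<in>space \<Omega>. (x \<in> X \<omega>) \<noteq> (dyadic_floor k x \<in> \<xi> \<omega>)} \<le> prob (\<Union>l. E l)"
      using Em by (intro finite_measure_mono) auto
    also have "\<dots> \<le> (\<Sum>l. prob (E l))"
      using Em sE by (intro finite_measure_subadditive_countably) auto
    also have "\<dots> \<le> (\<Sum>l. (4 * C * d / 2 ^ k) * (1 / 2) ^ l)"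
      by (intro suminf_le Eb sE sums_summable[OF geo])
    also have "\<dots> = 8 * C * d / 2 ^ k" using sums_unique[OF geo] by simp
    finally show ?thesis .
  qed
  \<comment> \<open>Passing through the rounding at level \<open>k\<close> costs a term that
    vanishes as \<open>k\<close> grows, which removes the constant 8 and recovers the modulus of the
    dyadic field.\<close>
  have Xz: "prob {\<omega>\<in>space \<Omega>. (x \<in> X \<omega>) \<noteq> (z \<in> \<xi> \<omega>)} \<le> 2 * C * norm (x - z)" if z: "z \<in> D" for x z
  proof (rule LIMSEQ_le_const)
    have "(\<lambda>k. 8 * C * d / 2 ^ k + 2 * C * (d / 2 ^ k + norm (x - z))) \<longlonglongrightarrow> 0 + 2 * C * (0 + norm (x - z))"
      by (intro tendsto_intros K0)
    then show "(\<lambda>k. 8 * C * d / 2 ^ k + 2 * C * (d / 2 ^ k + norm (x - z))) \<longlonglongrightarrow> 2 * C * norm (x - z)" by simp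
    have "prob {\<omega>\<in>space \<Omega>. (x \<in> X \<omega>) \<noteq> (z \<in> \<xi> \<omega>)} \<le> 8 * C * d / 2 ^ k + 2 * C * (d / 2 ^ k + norm (x - z))" for k
    proof -
      let ?f = "dyadic_floor k x"
      have "prob {\<omega>\<in>space \<Omega>. (x \<in> X \<omega>) \<noteq> (z \<in> \<xi> \<omega>)}
        \<le> prob ({\<omega>\<in>space \<Omega>. (x \<in> X \<omega>) \<noteq> (?f \<in> \<xi> \<omega>)} \<union> {\<omega>\<in>space \<Omega>. (?f \<in> \<xi> \<omega>) \<noteq> (z \<in> \<xi> \<omega>)})"
        using Xm m flD z by (intro finite_measure_mono sets.Un ne) auto
      also have "\<dots> \<le> prob {\<omega>\<in>space \<Omega>. (x \<in> X \<omega>) \<noteq> (?f \<in> \<xi> \<omega>)} + prob {\<omega>\<in>space \<Omega>. (?f \<in> \<xi> \<omega>) \<noteq> (z \<in> \<xi> \<omega>)}"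
        using Xm m flD z by (intro measure_Un_le ne) auto
      also have "\<dots> \<le> 8 * C * d / 2 ^ k + 2 * C * norm (?f - z)"
        by (intro add_mono Xfl xx flD z)
      also have "norm (?f - z) \<le> d / 2 ^ k + norm (x - z)"
        using norm_triangle_ineq4[of "x - z" "x - ?f"] fl[of x k] by simp
      finally show ?thesis using C(1) by (simp add: mult_left_mono)
    qed
    then show "\<exists>N. \<forall>k\<ge>N. prob {\<omega>\<in>space \<Omega>. (x \<in> X \<omega>) \<noteq> (z \<in> \<xi> \<omega>)} \<le> 8 * C * d / 2 ^ k + 2 * C * (d / 2 ^ k + norm (x - z))"
      by blast
  qed
  have approx: "(\<lambda>k. prob {\<omega>\<in>space \<Omega>. \<forall>i\<in>F. b k i \<in> \<xi> \<omega>}) \<longlonglongrightarrow> prob {\<omega>\<in>space \<Omega>. \<forall>i\<in>F. a i \<in> X \<omega>}"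
    if F: "finite F" and b: "\<And>k i. i \<in> F \<Longrightarrow> b k i \<in> D" and ab: "\<And>k i. i \<in> F \<Longrightarrow> norm (a i - b k i) \<le> 2 * d / 2 ^ k"
    for F :: "'a set" and a b
  proof -
    have "norm (prob {\<omega>\<in>space \<Omega>. \<forall>i\<in>F. b k i \<in> \<xi> \<omega>} - prob {\<omega>\<in>space \<Omega>. \<forall>i\<in>F. a i \<in> X \<omega>}) \<le> (\<Sum>i\<in>F. 2 * C * (2 * d / 2 ^ k))" for k
    proof -
      have "\<bar>prob {\<omega>\<in>space \<Omega>. \<forall>i\<in>F. a i \<in> X \<omega>} - prob {\<omega>\<in>space \<Omega>. \<forall>i\<in>F. b k i \<in> \<xi> \<omega>}\<bar>
         \<le> (\<Sum>i\<in>F. prob {\<omega>\<in>space \<Omega>. (a i \<in> X \<omega>) \<noteq> (b k i \<in> \<xi> \<omega>)})"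
        by (rule prob_Ball_diff_le[OF F Xm]) (use m b in auto)
      also have "\<dots> \<le> (\<Sum>i\<in>F. 2 * C * (2 * d / 2 ^ k))"
      proof (rule sum_mono)
        fix i assume i: "i \<in> F"
        have "prob {\<omega>\<in>space \<Omega>. (a i \<in> X \<omega>) \<noteq> (b k i \<in> \<xi> \<omega>)} \<le> 2 * C * norm (a i - b k i)"
          by (rule Xz[OF b[OF i]])
        also have "\<dots> \<le> 2 * C * (2 * d / 2 ^ k)" using C(1) by (intro mult_left_mono ab i) auto
        finally show "prob {\<omega>\<in>space \<Omega>. (a i \<in> X \<omega>) \<noteq> (b k i \<in> \<xi> \<omega>)} \<le> 2 * C * (2 * d / 2 ^ k)" .
      qed
      finally show ?thesis by (simp add: abs_minus_commute)
    qed
    moreover have "(\<lambda>k. \<Sum>i\<in>F. 2 * C * (2 * d / 2 ^ k)) \<longlonglongrightarrow> 0"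
    proof -
      have "(\<lambda>k. real (card F) * (2 * C * (2 * d / 2 ^ k))) \<longlonglongrightarrow> real (card F) * (2 * C * 0)"
        by (intro tendsto_intros K0)
      then show ?thesis by simp
    qed
    ultimately show ?thesis by (rule LIMSEQ_norm_diff_bound)
  qed
  have 1: "prob {\<omega>\<in>space \<Omega>. x \<in> X \<omega> \<and> x' \<in> X \<omega>} = S2 (x - x')" for x x'
  proof -
    have "(\<lambda>k. prob {\<omega>\<in>space \<Omega>. \<forall>i\<in>{x, x'}. dyadic_floor k i \<in> \<xi> \<omega>}) \<longlonglongrightarrow> prob {\<omega>\<in>space \<Omega>. \<forall>i\<in>{x, x'}. i \<in> X \<omega>}"
      by (intro approx) (simp_all add: flD fl2)
    then have l1: "(\<lambda>k. S2 (dyadic_floor k x - dyadic_floor k x')) \<longlonglongrightarrow> prob {\<omega>\<in>space \<Omega>. x \<in> X \<omega> \<and> x' \<in> X \<omega>}"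
      by (simp add: two flD)
    have "norm (S2 (dyadic_floor k x - dyadic_floor k x') - S2 (x - x')) \<le> C * (2 * d / 2 ^ k)" for k
    proof -
      have "norm (S2 (dyadic_floor k x - dyadic_floor k x') - S2 (x - x')) \<le> C * norm (dyadic_floor k x - dyadic_floor k x' - (x - x'))"
        using C(2) by simp
      also have "dyadic_floor k x - dyadic_floor k x' - (x - x') = (x' - dyadic_floor k x') - (x - dyadic_floor k x)" by simp
      also have "norm \<dots> \<le> d / 2 ^ k + d / 2 ^ k"
        by (rule order_trans[OF norm_triangle_ineq4]) (intro add_mono fl)
      finally show ?thesis using C(1) by (simp add: mult_left_mono)
    qed
    moreover have "(\<lambda>k. C * (2 * d / 2 ^ k)) \<longlonglongrightarrow> 0" by (intro tendsto_mult_right_zero K0)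
    ultimately have "(\<lambda>k. S2 (dyadic_floor k x - dyadic_floor k x')) \<longlonglongrightarrow> S2 (x - x')"
      by (rule LIMSEQ_norm_diff_bound)
    then show ?thesis using l1 LIMSEQ_unique by blast
  qed
  have 2: "prob {\<omega>\<in>space \<Omega>. \<forall>x\<in>F. x + y \<in> X \<omega>} = prob {\<omega>\<in>space \<Omega>. \<forall>x\<in>F. x \<in> X \<omega>}" if F: "finite F" for F y
  proof -
    have Dp: "dyadic_floor k x + dyadic_floor k y \<in> D" for k x
      unfolding D_def using dyadic_lattice_add[OF dyadic_floor_in_lattice dyadic_floor_in_lattice] by blast
    have n2: "norm (x + y - (dyadic_floor k x + dyadic_floor k y)) \<le> 2 * d / 2 ^ k" for k x
    proof -
      have "norm ((x - dyadic_floor k x) + (y - dyadic_floor k y)) \<le> d / 2 ^ k + d / 2 ^ k"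
        by (rule order_trans[OF norm_triangle_ineq]) (intro add_mono fl)
      then show ?thesis by (simp add: algebra_simps)
    qed
    have l1: "(\<lambda>k. prob {\<omega>\<in>space \<Omega>. \<forall>x\<in>F. dyadic_floor k x + dyadic_floor k y \<in> \<xi> \<omega>}) \<longlonglongrightarrow> prob {\<omega>\<in>space \<Omega>. \<forall>x\<in>F. x + y \<in> X \<omega>}"
      by (rule approx[OF F]) (rule Dp, rule n2)
    have l2: "(\<lambda>k. prob {\<omega>\<in>space \<Omega>. \<forall>x\<in>F. dyadic_floor k x \<in> \<xi> \<omega>}) \<longlonglongrightarrow> prob {\<omega>\<in>space \<Omega>. \<forall>x\<in>F. x \<in> X \<omega>}"
      by (rule approx[OF F]) (rule flD, rule fl2)
    have "prob {\<omega>\<in>space \<Omega>. \<forall>x\<in>F. dyadic_floor k x + dyadic_floor k y \<in> \<xi> \<omega>}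
        = prob {\<omega>\<in>space \<Omega>. \<forall>x\<in>F. dyadic_floor k x \<in> \<xi> \<omega>}" for k
      using shift[of "dyadic_floor k y" "dyadic_floor k ` F"] F flD by (auto simp: image_subset_iff)
    then show ?thesis using l1 l2 LIMSEQ_unique by fastforce
  qed
  show ?thesis using \<Omega> joint 1 2 by blast
qed

section \<open>A metric for local convergence in measure\<close>

text \<open>A step function of the radius. On the shell where \<open>norm x\<close> has integer part
  \<open>m\<close> the weight is \<open>c m\<close>; dividing by \<open>1 + v m\<close> offsets the
  volume \<open>v m\<close> of the enclosing ball, so the shell contributes at most
  \<open>(1 / 2) ^ Suc m\<close>. As \<open>c\<close> is decreasing and positive, the weight is
  bounded below on bounded sets.\<close>

lemma local_weight_exists:
  "\<exists>w :: 'a::euclidean_space \<Rightarrow> real. w \<in> borel_measurable borel \<and> (\<forall>x. 0 < w x) \<and> (\<forall>x. w x \<le> 1) \<and>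
    integrable lborel w \<and> (\<forall>r. \<exists>c>0. \<forall>x. norm x \<le> r \<longrightarrow> c \<le> w x)"
proof -
  define v where "v m = measure lborel (ball (0::'a) (real (Suc m)))" for m
  define c where "c m = 1 / (2 ^ Suc m * (1 + v m))" for m
  define w where "w x = c (nat \<lfloor>norm (x::'a)\<rfloor>)" for x
  have v0: "0 \<le> v m" for m by (simp add: v_def)
  have cpos: "0 < c m" for m using v0[of m] by (simp add: c_def add_pos_nonneg)
  have cle: "c m \<le> 1" for m
  proof -
    have "1 * 1 \<le> (2::real) ^ Suc m * (1 + v m)"
      by (intro mult_mono one_le_power) (simp_all add: v0)
    then have "1 / (2 ^ Suc m * (1 + v m)) \<le> 1 / 1"
      using v0[of m] by (intro divide_left_mono mult_pos_pos) auto
    then show ?thesis by (simp add: c_def)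
  qed
  have vmono: "v m \<le> v n" if "m \<le> n" for m n
  proof -
    have "ball (0::'a) r \<in> fmeasurable lborel" for r
      using emeasure_bounded_finite[OF bounded_ball, of "0::'a" r] by (intro fmeasurableI) auto
    then show ?thesis unfolding v_def using that by (intro measure_mono_fmeasurable) auto
  qed
  have cdec: "c n \<le> c m" if "m \<le> n" for m n
    unfolding c_def using that v0 vmono[OF that]
    by (intro divide_left_mono mult_mono mult_pos_pos power_increasing) (auto simp: add_pos_nonneg)
  have [measurable]: "w \<in> borel_measurable borel" unfolding w_def by measurable
  have "integrable lborel w"
  proof (rule integrableI_nonneg)
    have "(\<integral>\<^sup>+x. ennreal (w x) \<partial>lborel) = (\<integral>\<^sup>+x. (\<Sum>m. ennreal (c m) * indicator {x. nat \<lfloor>norm x\<rfloor> = m} (x::'a)) \<partial>lborel)"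
    proof (intro nn_integral_cong)
      fix x :: 'a
      have "(\<Sum>m. ennreal (c m) * indicator {x. nat \<lfloor>norm x\<rfloor> = m} x) = (\<Sum>m\<in>{nat \<lfloor>norm x\<rfloor>}. ennreal (c m) * indicator {x. nat \<lfloor>norm x\<rfloor> = m} x)"
        by (rule suminf_finite) auto
      then show "ennreal (w x) = (\<Sum>m. ennreal (c m) * indicator {x. nat \<lfloor>norm x\<rfloor> = m} x)"
        by (simp add: w_def)
    qed
    also have "\<dots> = (\<Sum>m. \<integral>\<^sup>+x. ennreal (c m) * indicator {x. nat \<lfloor>norm x\<rfloor> = m} (x::'a) \<partial>lborel)"
      by (intro nn_integral_suminf) measurable
    also have "\<dots> \<le> (\<Sum>m. ennreal ((1 / 2) ^ Suc m))"
    proof (intro suminf_le summableI)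
      fix m
      have sub: "{x::'a. nat \<lfloor>norm x\<rfloor> = m} \<subseteq> ball 0 (real (Suc m))"
      proof
        fix x :: 'a assume "x \<in> {x. nat \<lfloor>norm x\<rfloor> = m}"
        then have "\<lfloor>norm x\<rfloor> = int m" by auto
        then have "norm x < real m + 1" by linarith
        then show "x \<in> ball 0 (real (Suc m))" by simp
      qed
      have "(\<integral>\<^sup>+x. ennreal (c m) * indicator {x. nat \<lfloor>norm x\<rfloor> = m} (x::'a) \<partial>lborel) = ennreal (c m) * emeasure lborel {x::'a. nat \<lfloor>norm x\<rfloor> = m}"
        by (rule nn_integral_cmult_indicator) measurable
      also have "\<dots> \<le> ennreal (c m) * emeasure lborel (ball (0::'a) (real (Suc m)))"
        using sub by (intro mult_left_mono emeasure_mono) auto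
      also have "emeasure lborel (ball (0::'a) (real (Suc m))) = ennreal (v m)"
        unfolding v_def by (rule emeasure_eq_ennreal_measure) (use emeasure_bounded_finite[OF bounded_ball, of "0::'a" "real (Suc m)"] in auto)
      also have "ennreal (c m) * ennreal (v m) = ennreal (c m * v m)"
        using cpos[of m] v0 by (subst ennreal_mult) auto
      also have "\<dots> \<le> ennreal ((1 / 2) ^ Suc m)"
      proof (rule ennreal_leI)
        have "c m * v m = (1 / 2) ^ Suc m * (v m / (1 + v m))" by (simp add: c_def power_divide)
        also have "v m / (1 + v m) \<le> 1" using v0[of m] by (simp add: divide_le_eq_1)
        finally show "c m * v m \<le> (1 / 2) ^ Suc m" by simp
      qed
      finally show "(\<integral>\<^sup>+x. ennreal (c m) * indicator {x. nat \<lfloor>norm x\<rfloor> = m} (x::'a) \<partial>lborel) \<le> ennreal ((1 / 2) ^ Suc m)" .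
    qed
    also have "\<dots> = ennreal (\<Sum>m. (1 / 2) ^ Suc m)"
      by (rule suminf_ennreal2) (auto intro: sums_summable[OF power_half_series])
    also have "\<dots> < \<infinity>" by simp
    finally show "(\<integral>\<^sup>+x. ennreal (w x) \<partial>lborel) < \<infinity>" .
  qed (auto simp: w_def less_imp_le[OF cpos])
  moreover have "\<exists>c>0. \<forall>x. norm x \<le> r \<longrightarrow> c \<le> w x" for r
    unfolding w_def using cpos cdec by (intro exI[of _ "c (nat \<lfloor>r\<rfloor>)"]) (auto intro!: cdec nat_mono floor_mono)
  ultimately show ?thesis using cpos cle by (intro exI[of _ w]) (auto simp: w_def[abs_def])
qed

text \<open>Integrability suppresses what happens far away, and the lower bounds retain everything
  on bounded sets. Together they replace the family of windows in \<open>loc_conv\<close> by the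
  single pseudometric \<open>wdist\<close>.\<close>

locale local_weight =
  fixes w :: "'a::euclidean_space \<Rightarrow> real"
  assumes w_borel [measurable]: "w \<in> borel_measurable borel"
    and w_pos: "0 < w x" and w_le_1: "w x \<le> 1"
    and w_integrable: "integrable lborel w"
    and w_lower: "\<exists>c>0. \<forall>x. norm x \<le> r \<longrightarrow> c \<le> w x"
begin

definition wmeas :: "'a set \<Rightarrow> real" where
  "wmeas S = (\<integral>x. indicator S x * w x \<partial>lebesgue)"

definition wdist :: "'a set \<Rightarrow> 'a set \<Rightarrow> real" where
  "wdist A B = wmeas (sym_diff A B)"

lemma w_nonneg: "0 \<le> w x" by (rule less_imp_le[OF w_pos])

lemma w_lebesgue [measurable]: "w \<in> borel_measurable lebesgue"
  by (intro measurable_completion) simp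

lemma w_integrable_lebesgue: "integrable lebesgue w"
  using w_integrable by (simp add: integrable_completion)

lemma integrable_wmeas: "S \<in> sets lebesgue \<Longrightarrow> integrable lebesgue (\<lambda>x. indicator S x * w x)"
  by (rule Bochner_Integration.integrable_bound[OF w_integrable_lebesgue]) (auto simp: indicator_def)

lemma wmeas_nonneg: "0 \<le> wmeas S"
  unfolding wmeas_def by (intro integral_nonneg_AE AE_I2) (simp add: w_nonneg)

lemma wmeas_mono: "S \<in> sets lebesgue \<Longrightarrow> T \<in> sets lebesgue \<Longrightarrow> S \<subseteq> T \<Longrightarrow> wmeas S \<le> wmeas T"
  unfolding wmeas_def by (intro integral_mono integrable_wmeas) (auto simp: indicator_def w_nonneg)

lemma wmeas_Un_le:
  assumes "S \<in> sets lebesgue" "T \<in> sets lebesgue"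
  shows "wmeas (S \<union> T) \<le> wmeas S + wmeas T"
proof -
  have "wmeas (S \<union> T) \<le> (\<integral>x. indicator S x * w x + indicator T x * w x \<partial>lebesgue)"
    unfolding wmeas_def using assms
    by (intro integral_mono integrable_wmeas Bochner_Integration.integrable_add) (auto simp: indicator_def w_nonneg)
  then show ?thesis
    unfolding wmeas_def using assms by (subst (asm) Bochner_Integration.integral_add) (auto intro: integrable_wmeas)
qed

lemma wmeas_le_measure: "S \<in> lmeasurable \<Longrightarrow> wmeas S \<le> measure lebesgue S"
proof -
  assume S: "S \<in> lmeasurable"
  have "wmeas S \<le> (\<integral>x. indicator S x \<partial>lebesgue)"
    unfolding wmeas_def
  proof (rule integral_mono)
    show "integrable lebesgue (\<lambda>x. indicator S x * w x)" using S by (intro integrable_wmeas fmeasurableD)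
    show "integrable lebesgue (indicator S :: 'a \<Rightarrow> real)" using S by (simp add: lmeasurable_iff_integrable)
    show "indicator S x * w x \<le> indicator S x" for x by (simp add: indicator_def w_le_1)
  qed
  then show ?thesis using S by simp
qed

lemma wmeas_tail: "(\<lambda>n. wmeas (- cball 0 (real n))) \<longlonglongrightarrow> 0"
proof -
  have "(\<lambda>n. \<integral>x. indicator (- cball 0 (real n)) x * w x \<partial>lebesgue) \<longlonglongrightarrow> (\<integral>x. 0 \<partial>(lebesgue :: 'a measure))"
  proof (rule integral_dominated_convergence[where w=w])
    show "AE x in lebesgue. (\<lambda>n. indicator (- cball 0 (real n)) x * w x) \<longlonglongrightarrow> 0"
    proof (intro AE_I2 tendsto_eventually)
      fix x :: 'a
      obtain N where "norm x \<le> real N" using real_arch_simple by blast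
      then have "\<forall>n\<ge>N. indicator (- cball 0 (real n)) x * w x = 0" by (auto simp: indicator_def)
      then show "eventually (\<lambda>n. indicator (- cball 0 (real n)) x * w x = 0) sequentially"
        unfolding eventually_sequentially by blast
    qed
    show "(\<lambda>x. indicator (- cball 0 (real n)) x * w x) \<in> borel_measurable lebesgue" for n
      by (rule borel_measurable_integrable[OF integrable_wmeas]) simp
    show "AE x in lebesgue. norm (indicator (- cball 0 (real n)) x * w x) \<le> w x" for n
      by (intro AE_I2) (auto simp: indicator_def w_nonneg)
  qed (auto intro: w_integrable_lebesgue)
  then show ?thesis by (simp add: wmeas_def)
qed

lemma wdist_nonneg: "0 \<le> wdist A B" by (simp add: wdist_def wmeas_nonneg)

lemma wdist_commute: "wdist A B = wdist B A" by (simp add: wdist_def Un_commute)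

lemma wdist_self: "wdist A A = 0" by (simp add: wdist_def wmeas_def)

lemma wdist_triangle:
  assumes "A \<in> sets lebesgue" "B \<in> sets lebesgue" "C \<in> sets lebesgue"
  shows "wdist A C \<le> wdist A B + wdist B C"
proof -
  have "wdist A C \<le> wmeas (sym_diff A B \<union> sym_diff B C)"
    unfolding wdist_def using assms by (intro wmeas_mono) auto
  also have "\<dots> \<le> wdist A B + wdist B C" unfolding wdist_def using assms by (intro wmeas_Un_le) auto
  finally show ?thesis .
qed

text \<open>Outside a large ball the weight has small total mass; inside, \<open>w_le_1\<close>
  bounds the weighted by the Lebesgue volume.\<close>

lemma loc_conv_imp_wdist:
  assumes S: "\<And>n. S n \<in> sets lebesgue" and A: "A \<in> sets lebesgue" and conv: "loc_conv S A"
  shows "(\<lambda>n. wdist (S n) A) \<longlonglongrightarrow> 0"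
proof (rule LIMSEQ_I)
  fix e :: real assume e: "0 < e"
  obtain m where m: "wmeas (- cball 0 (real m)) < e / 2"
    using LIMSEQ_D[OF wmeas_tail, of "e / 2"] e by (auto simp: wmeas_nonneg)
  \<comment> \<open>One unit larger than the closed ball of the tail estimate, because
    \<open>loc_conv\<close> needs an open window.\<close>
  let ?U = "ball 0 (real m + 1) :: 'a set"
  have "(\<lambda>n. measure lebesgue (sym_diff (S n) A \<inter> ?U)) \<longlonglongrightarrow> 0"
    using conv unfolding loc_conv_def by blast
  then obtain N where N: "\<And>n. n \<ge> N \<Longrightarrow> measure lebesgue (sym_diff (S n) A \<inter> ?U) < e / 2"
    using LIMSEQ_D[of _ 0 "e / 2"] e by fastforce
  have "norm (wdist (S n) A - 0) < e" if n: "n \<ge> N" for n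
  proof -
    have sd: "sym_diff (S n) A \<in> sets lebesgue" using S A by auto
    have lm: "sym_diff (S n) A \<inter> ?U \<in> lmeasurable" by (rule lmeasurable_Int_bounded[OF sd]) auto
    have "wdist (S n) A \<le> wmeas ((sym_diff (S n) A \<inter> ?U) \<union> - cball 0 (real m))"
      unfolding wdist_def using sd lm by (intro wmeas_mono) (auto simp: fmeasurableD)
    also have "\<dots> \<le> wmeas (sym_diff (S n) A \<inter> ?U) + wmeas (- cball 0 (real m))"
      using lm by (intro wmeas_Un_le) (auto simp: fmeasurableD)
    also have "wmeas (sym_diff (S n) A \<inter> ?U) \<le> measure lebesgue (sym_diff (S n) A \<inter> ?U)"
      by (rule wmeas_le_measure[OF lm])
    finally show ?thesis using N[OF n] m wdist_nonneg[of "S n" A] by simp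
  qed
  then show "\<exists>N. \<forall>n\<ge>N. norm (wdist (S n) A - 0) < e" by blast
qed

text \<open>On a bounded window the weight is at least some \<open>c > 0\<close>, so the volume
  there is at most \<open>wdist / c\<close>.\<close>

lemma wdist_imp_loc_conv:
  assumes S: "\<And>n. S n \<in> sets lebesgue" and A: "A \<in> sets lebesgue" and conv: "(\<lambda>n. wdist (S n) A) \<longlonglongrightarrow> 0"
  shows "loc_conv S A"
  unfolding loc_conv_def
proof (intro allI impI)
  fix U :: "'a set" assume U: "open U \<and> bounded U"
  then obtain r where r: "\<And>x. x \<in> U \<Longrightarrow> norm x \<le> r" unfolding bounded_iff by blast
  obtain c where c: "0 < c" "\<And>x. norm x \<le> r \<Longrightarrow> c \<le> w x" using w_lower by blast
  have b: "norm (measure lebesgue (sym_diff (S n) A \<inter> U)) \<le> wdist (S n) A / c" for n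
  proof -
    have sd: "sym_diff (S n) A \<in> sets lebesgue" using S A by auto
    have lm: "sym_diff (S n) A \<inter> U \<in> lmeasurable" using U by (intro lmeasurable_Int_bounded[OF sd]) auto
    have "measure lebesgue (sym_diff (S n) A \<inter> U) * c = (\<integral>x. indicator (sym_diff (S n) A \<inter> U) x * c \<partial>lebesgue)"
      using lm by (subst Bochner_Integration.integral_mult_left) (auto simp: lmeasurable_iff_integrable)
    also have "\<dots> \<le> wdist (S n) A"
      unfolding wdist_def wmeas_def
    proof (rule integral_mono[OF _ integrable_wmeas[OF sd]])
      show "integrable lebesgue (\<lambda>x. indicator (sym_diff (S n) A \<inter> U) x * c)"
        using lm by (intro integrable_mult_left) (simp add: lmeasurable_iff_integrable)
      fix x
      show "indicator (sym_diff (S n) A \<inter> U) x * c \<le> indicator (sym_diff (S n) A) x * w x"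
        using c(2) r by (auto simp: indicator_def w_nonneg)
    qed
    finally show ?thesis using c(1) by (simp add: field_simps)
  qed
  have "(\<lambda>n. wdist (S n) A / c) \<longlonglongrightarrow> 0" using tendsto_divide[OF conv tendsto_const[of c]] c(1) by simp
  then show "(\<lambda>n. measure lebesgue (sym_diff (S n) A \<inter> U)) \<longlonglongrightarrow> 0"
    by (rule Lim_null_comparison[OF always_eventually[OF allI], rotated]) (rule b)
qed

text \<open>Test functionals for laws on \<open>rams_space\<close>: continuous for local
  convergence, and rich enough to approximate the indicators of open sets.\<close>

definition wlip :: "real \<Rightarrow> ('a set \<Rightarrow> real) \<Rightarrow> bool" where
  "wlip K F \<longleftrightarrow> (\<forall>A\<in>sets lebesgue. \<forall>B\<in>sets lebesgue. \<bar>F A - F B\<bar> \<le> K * wdist A B)"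

lemma wlip_tendsto:
  assumes F: "wlip K F" and S: "\<And>n. S n \<in> sets lebesgue" and A: "A \<in> sets lebesgue"
    and conv: "(\<lambda>n. wdist (S n) A) \<longlonglongrightarrow> 0"
  shows "(\<lambda>n. F (S n)) \<longlonglongrightarrow> F A"
proof (rule LIMSEQ_norm_diff_bound)
  show "norm (F (S n) - F A) \<le> K * wdist (S n) A" for n using F S A by (auto simp: wlip_def)
  show "(\<lambda>n. K * wdist (S n) A) \<longlonglongrightarrow> 0" using conv by (rule tendsto_mult_right_zero)
qed

lemma borel_measurable_wlip: "wlip K F \<Longrightarrow> F \<in> borel_measurable rams_space"
  by (rule borel_measurable_rams_spaceI) (rule wlip_tendsto, auto intro: loc_conv_imp_wdist)

text \<open>The distance from \<open>A\<close> to the complement of \<open>U\<close>. An infimum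
  over an empty complement carries no information, hence the separate case
  \<open>sets lebesgue - U = {}\<close> throughout.\<close>

definition wgap :: "'a set set \<Rightarrow> 'a set \<Rightarrow> real" where
  "wgap U A = (INF B\<in>sets lebesgue - U. wdist A B)"

lemma wgap_lower:
  assumes "B \<in> sets lebesgue - U"
  shows "wgap U A \<le> wdist A B"
  unfolding wgap_def using assms by (intro cINF_lower) (auto intro!: bdd_belowI2[of _ 0] wdist_nonneg)

lemma wgap_nonneg: "sets lebesgue - U \<noteq> {} \<Longrightarrow> 0 \<le> wgap U A"
  unfolding wgap_def by (intro cINF_greatest wdist_nonneg)

lemma wlip_wgap:
  assumes ne: "sets lebesgue - U \<noteq> {}"
  shows "wlip 1 (wgap U)"
proof -
  have "wgap U A - wdist A B \<le> wgap U B" if "A \<in> sets lebesgue" "B \<in> sets lebesgue" for A B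
    unfolding wgap_def[of U B]
  proof (rule cINF_greatest[OF ne])
    fix C assume C: "C \<in> sets lebesgue - U"
    have "wgap U A \<le> wdist A C" by (rule wgap_lower[OF C])
    also have "\<dots> \<le> wdist A B + wdist B C" using that C by (intro wdist_triangle) auto
    finally show "wgap U A - wdist A B \<le> wdist B C" by simp
  qed
  note step = this
  show ?thesis
    unfolding wlip_def
  proof (intro ballI)
    fix A B :: "'a set" assume AB: "A \<in> sets lebesgue" "B \<in> sets lebesgue"
    show "\<bar>wgap U A - wgap U B\<bar> \<le> 1 * wdist A B"
      using step[OF AB] step[OF AB(2,1)] wdist_commute[of A B] by (simp add: abs_le_iff)
  qed
qed

text \<open>A vanishing gap at \<open>A \<in> U\<close> would give a sequence outside
  \<open>U\<close> converging to \<open>A\<close>, which sequential openness forbids. This is where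
  the definition of \<open>rams_open\<close> meets the metric.\<close>

lemma wgap_pos_iff:
  assumes U: "rams_open U" and ne: "sets lebesgue - U \<noteq> {}" and A: "A \<in> sets lebesgue"
  shows "0 < wgap U A \<longleftrightarrow> A \<in> U"
proof
  assume "0 < wgap U A"
  then show "A \<in> U" using wgap_lower[of A U A] A by (auto simp: wdist_self)
next
  assume AU: "A \<in> U"
  show "0 < wgap U A"
  proof (rule ccontr)
    assume "\<not> 0 < wgap U A"
    then have z: "wgap U A < 1 / real (Suc n)" for n by (smt (verit) divide_pos_pos of_nat_0_less_iff zero_less_Suc)
    have "\<exists>B\<in>sets lebesgue - U. wdist A B < 1 / real (Suc n)" for n
      using z[of n] ne unfolding wgap_def by (subst (asm) cINF_less_iff) (auto intro!: bdd_belowI2[of _ 0] wdist_nonneg)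
    then obtain B where B: "\<And>n. B n \<in> sets lebesgue - U" "\<And>n. wdist A (B n) < 1 / real (Suc n)" by metis
    have "(\<lambda>n. wdist (B n) A) \<longlonglongrightarrow> 0"
    proof (rule tendsto_sandwich[OF _ _ tendsto_const LIMSEQ_inverse_real_of_nat])
      show "eventually (\<lambda>n. 0 \<le> wdist (B n) A) sequentially" by (simp add: wdist_nonneg)
      show "eventually (\<lambda>n. wdist (B n) A \<le> inverse (real (Suc n))) sequentially"
        using B(2) by (intro always_eventually allI) (simp add: wdist_commute[of _ A] less_imp_le inverse_eq_divide)
    qed
    then have "loc_conv B A" using B A by (intro wdist_imp_loc_conv) auto
    then have "eventually (\<lambda>n. B n \<in> U) sequentially" using rams_openD[OF U AU, of B] B(1) by blast
    then show False using B by (auto simp: eventually_sequentially)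
  qed
qed

lemma wlip_truncated_gap:
  assumes ne: "sets lebesgue - U \<noteq> {}"
  shows "wlip (real k) (\<lambda>A. min 1 (real k * wgap U A))"
  unfolding wlip_def
proof (intro ballI)
  fix A B :: "'a set" assume AB: "A \<in> sets lebesgue" "B \<in> sets lebesgue"
  have "\<bar>min 1 (real k * wgap U A) - min 1 (real k * wgap U B)\<bar> \<le> \<bar>real k * wgap U A - real k * wgap U B\<bar>" by linarith
  also have "\<dots> = real k * \<bar>wgap U A - wgap U B\<bar>" by (simp add: right_diff_distrib[symmetric] abs_mult)
  also have "\<dots> \<le> real k * wdist A B"
    using wlip_wgap[OF ne] AB by (intro mult_left_mono) (auto simp: wlip_def)
  finally show "\<bar>min 1 (real k * wgap U A) - min 1 (real k * wgap U B)\<bar> \<le> real k * wdist A B" .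
qed

text \<open>For an open set \<open>U\<close>, the functionals
  \<open>min 1 (real k * wgap U A)\<close> are Lipschitz and increase to the indicator of
  \<open>U\<close>; the open sets are closed under intersection and generate the
  sigma-algebra.\<close>

lemma rams_measure_eqI:
  assumes N: "prob_space N1" "prob_space N2" and s: "sets N1 = sets rams_space" "sets N2 = sets rams_space"
    and eq: "\<And>K F. wlip K F \<Longrightarrow> (\<And>A. 0 \<le> F A \<and> F A \<le> 1) \<Longrightarrow> (\<integral>A. F A \<partial>N1) = (\<integral>A. F A \<partial>N2)"
  shows "N1 = N2"
proof (rule measure_eqI_generator_eq[where E="{U. rams_open U}" and \<Omega>="sets lebesgue" and A="\<lambda>_. sets lebesgue"])
  have sp: "space N1 = sets lebesgue" "space N2 = sets lebesgue"
    using s[THEN sets_eq_imp_space_eq] by auto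
  show "Int_stable {U :: 'a set set. rams_open U}"
    unfolding Int_stable_def rams_open_def by (auto simp: eventually_conj_iff)
  show "{U :: 'a set set. rams_open U} \<subseteq> Pow (sets lebesgue)" by (auto simp: rams_open_def)
  show "sets N1 = sigma_sets (sets lebesgue) {U. rams_open U}" "sets N2 = sigma_sets (sets lebesgue) {U. rams_open U}"
    using s sets_rams_space by auto
  show "range (\<lambda>_. sets (lebesgue :: 'a measure)) \<subseteq> {U. rams_open U}" by (auto simp: rams_open_def)
  interpret N1: prob_space N1 by (rule N(1))
  show "emeasure N1 (sets lebesgue) \<noteq> \<infinity>" by simp
  fix U :: "'a set set" assume "U \<in> {U. rams_open U}"
  then have U: "rams_open U" by simp
  show "emeasure N1 U = emeasure N2 U"
  proof (cases "sets lebesgue - U = {}")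
    case True
    then have "U = sets lebesgue" using U by (auto simp: rams_open_def)
    then show ?thesis using prob_space.emeasure_space_1[OF N(1)] prob_space.emeasure_space_1[OF N(2)] sp by simp
  next
    case False
    \<comment> \<open>The outer \<open>max 0\<close> makes the bounds required of test functionals
      immediate; by \<open>Fe\<close> it changes no value.\<close>
    define F where "F k A = max 0 (min 1 (real k * wgap U A))" for k A
    have Fe: "F k A = min 1 (real k * wgap U A)" for k A
      using wgap_nonneg[OF False, of A] by (simp add: F_def)
    have FL: "wlip (real k) (F k)" for k unfolding Fe by (rule wlip_truncated_gap[OF False])
    have lim: "(\<lambda>k. \<integral>A. F k A \<partial>N) \<longlonglongrightarrow> measure N U" if N: "prob_space N" "sets N = sets rams_space" for N
    proof -
      interpret prob_space N by (rule N(1))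
      have spN: "space N = sets lebesgue" using N(2)[THEN sets_eq_imp_space_eq] by simp
      have Um: "U \<in> sets N" using rams_open_in_sets[OF U] N(2) by simp
      have "(\<lambda>k. \<integral>A. F k A \<partial>N) \<longlonglongrightarrow> (\<integral>A. indicator U A \<partial>N)"
      proof (rule integral_dominated_convergence[where w="\<lambda>_. 1"])
        show "AE A in N. (\<lambda>k. F k A) \<longlonglongrightarrow> indicator U A"
        proof (rule AE_I2)
          fix A assume "A \<in> space N"
          then have A: "A \<in> sets lebesgue" using spN by simp
          show "(\<lambda>k. F k A) \<longlonglongrightarrow> indicator U A"
          proof (cases "A \<in> U")
            case True
            then have pos: "0 < wgap U A" using wgap_pos_iff[OF U False A] by simp
            then obtain n0 where n0: "1 < real n0 * wgap U A" using reals_Archimedean3 by blast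
            have "F k A = 1" if "k \<ge> n0" for k
            proof -
              have "real n0 * wgap U A \<le> real k * wgap U A" using that pos by (intro mult_right_mono) auto
              then show ?thesis using n0 by (simp add: Fe)
            qed
            then have "eventually (\<lambda>k. F k A = indicator U A) sequentially"
              unfolding eventually_sequentially using True by auto
            then show ?thesis by (rule tendsto_eventually)
          next
            case False': False
            then have "wgap U A = 0" using wgap_pos_iff[OF U False A] wgap_nonneg[OF False, of A] by simp
            then show ?thesis using False' by (simp add: Fe)
          qed
        qed
        show "F k \<in> borel_measurable N" for k
          using borel_measurable_wlip[OF FL[of k]] N(2) by (simp cong: measurable_cong_sets)
        show "(indicator U :: _ \<Rightarrow> real) \<in> borel_measurable N" using Um by simp
      qed (auto simp: F_def)
      then show ?thesis using Um by simp
    qed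
    have "(\<integral>A. F k A \<partial>N1) = (\<integral>A. F k A \<partial>N2)" for k
      by (rule eq[OF FL]) (auto simp: F_def)
    then have "measure N1 U = measure N2 U"
      using lim[OF N(1) s(1)] lim[OF N(2) s(2)] LIMSEQ_unique by simp
    then show ?thesis
      using N1.emeasure_eq_measure finite_measure.emeasure_eq_measure[OF prob_space.finite_measure[OF N(2)]] by simp
  qed
qed (simp)

end

section \<open>Jointly measurable random fields as random measurable sets\<close>

text \<open>The events that the trace contains \<open>T\<close> form an intersection-stable family.
  Removing the strictly larger traces isolates each single trace, so on a finite \<open>Z\<close>
  the family generates everything and inclusion probabilities determine the law.\<close>

lemma (in prob_space) expectation_trace_eq:
  fixes A B :: "'a \<Rightarrow> 'b set"
  assumes Z: "finite Z" and A: "\<And>z. z \<in> Z \<Longrightarrow> {\<omega>\<in>space M. z \<in> A \<omega>} \<in> events"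
    and B: "\<And>z. z \<in> Z \<Longrightarrow> {\<omega>\<in>space M. z \<in> B \<omega>} \<in> events"
    and eq: "\<And>T. T \<subseteq> Z \<Longrightarrow> prob {\<omega>\<in>space M. \<forall>z\<in>T. z \<in> A \<omega>} = prob {\<omega>\<in>space M. \<forall>z\<in>T. z \<in> B \<omega>}"
  shows "(\<lambda>\<omega>. Z \<inter> A \<omega>) \<in> M \<rightarrow>\<^sub>M count_space (Pow Z)"
    and "expectation (\<lambda>\<omega>. f (Z \<inter> A \<omega>) :: real) = expectation (\<lambda>\<omega>. f (Z \<inter> B \<omega>))"
proof -
  have meas: "(\<lambda>\<omega>. Z \<inter> A \<omega>) \<in> M \<rightarrow>\<^sub>M count_space (Pow Z)"
    if A: "\<And>z. z \<in> Z \<Longrightarrow> {\<omega>\<in>space M. z \<in> A \<omega>} \<in> events" for A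
  proof (subst measurable_count_space_eq2)
    show "finite (Pow Z)" using Z by simp
    have "(\<lambda>\<omega>. Z \<inter> A \<omega>) -` {s} \<inter> space M \<in> events" if s: "s \<in> Pow Z" for s
    proof -
      have "(\<lambda>\<omega>. Z \<inter> A \<omega>) -` {s} \<inter> space M = {\<omega>\<in>space M. \<forall>z\<in>Z. (z \<in> A \<omega>) = (z \<in> s)}"
        using s by auto
      also have "\<dots> \<in> events"
      proof (rule sets.sets_Collect_finite_All[OF _ Z])
        fix z assume z: "z \<in> Z"
        show "{\<omega>\<in>space M. (z \<in> A \<omega>) = (z \<in> s)} \<in> events"
          using A[OF z] sets.sets_Collect_neg[OF A[OF z]] by (cases "z \<in> s") auto
      qed
      finally show ?thesis .
    qed
    then show "(\<lambda>\<omega>. Z \<inter> A \<omega>) \<in> space M \<rightarrow> Pow Z \<and> (\<forall>a\<in>Pow Z. (\<lambda>\<omega>. Z \<inter> A \<omega>) -` {a} \<inter> space M \<in> events)"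
      by auto
  qed
  note mA[measurable] = meas[of A, OF A] and mB[measurable] = meas[of B, OF B]
  show "(\<lambda>\<omega>. Z \<inter> A \<omega>) \<in> M \<rightarrow>\<^sub>M count_space (Pow Z)" by (rule mA)
  let ?E = "{{s\<in>Pow Z. T \<subseteq> s} |T. T \<subseteq> Z}"
  have EP: "?E \<subseteq> Pow (Pow Z)" by auto
  have sg: "sigma_sets (Pow Z) ?E = Pow (Pow Z)"
  proof
    show "sigma_sets (Pow Z) ?E \<subseteq> Pow (Pow Z)" using sigma_sets_into_sp[OF EP] by blast
    interpret S: sigma_algebra "Pow Z" "sigma_sets (Pow Z) ?E" using EP by (rule sigma_algebra_sigma_sets)
    have up: "{s\<in>Pow Z. T \<subseteq> s} \<in> sigma_sets (Pow Z) ?E" if "T \<subseteq> Z" for T using that by (intro sigma_sets.Basic) auto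
    have single: "{s} \<in> sigma_sets (Pow Z) ?E" if s: "s \<in> Pow Z" for s
    proof -
      have "{s} = {s'\<in>Pow Z. s \<subseteq> s'} - (\<Union>z\<in>Z - s. {s'\<in>Pow Z. insert z s \<subseteq> s'})" using s by auto
      also have "\<dots> \<in> sigma_sets (Pow Z) ?E"
        using Z s by (intro S.Diff S.finite_UN up) auto
      finally show ?thesis .
    qed
    show "Pow (Pow Z) \<subseteq> sigma_sets (Pow Z) ?E"
    proof
      fix C assume C: "C \<in> Pow (Pow Z)"
      then have "finite C" using Z by (meson PowD finite_Pow_iff finite_subset)
      then have "(\<Union>s\<in>C. {s}) \<in> sigma_sets (Pow Z) ?E" using C by (intro S.finite_UN single) auto
      then show "C \<in> sigma_sets (Pow Z) ?E" by simp
    qed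
  qed
  have "distr M (count_space (Pow Z)) (\<lambda>\<omega>. Z \<inter> A \<omega>) = distr M (count_space (Pow Z)) (\<lambda>\<omega>. Z \<inter> B \<omega>)"
  proof (rule measure_eqI_generator_eq[where E="?E" and \<Omega>="Pow Z" and A="\<lambda>_. Pow Z"])
    show "Int_stable ?E"
    proof (unfold Int_stable_def, safe)
      fix T T' assume "T \<subseteq> Z" "T' \<subseteq> Z"
      then show "\<exists>T''. {s \<in> Pow Z. T \<subseteq> s} \<inter> {s \<in> Pow Z. T' \<subseteq> s} = {s \<in> Pow Z. T'' \<subseteq> s} \<and> T'' \<subseteq> Z"
        by (intro exI[of _ "T \<union> T'"]) auto
    qed
    show "range (\<lambda>_::nat. Pow Z) \<subseteq> ?E" by (auto intro!: exI[of _ "{}"])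
    fix C assume "C \<in> ?E"
    then obtain T where T: "T \<subseteq> Z" "C = {s\<in>Pow Z. T \<subseteq> s}" by blast
    have e: "emeasure (distr M (count_space (Pow Z)) (\<lambda>\<omega>. Z \<inter> A \<omega>)) C = ennreal (prob {\<omega>\<in>space M. \<forall>z\<in>T. z \<in> A \<omega>})"
      if "(\<lambda>\<omega>. Z \<inter> A \<omega>) \<in> M \<rightarrow>\<^sub>M count_space (Pow Z)" for A
    proof -
      have "(\<lambda>\<omega>. Z \<inter> A \<omega>) -` C \<inter> space M = {\<omega>\<in>space M. \<forall>z\<in>T. z \<in> A \<omega>}" using T by auto
      then show ?thesis using that T by (subst emeasure_distr) (auto simp: emeasure_eq_measure)
    qed
    show "emeasure (distr M (count_space (Pow Z)) (\<lambda>\<omega>. Z \<inter> A \<omega>)) C = emeasure (distr M (count_space (Pow Z)) (\<lambda>\<omega>. Z \<inter> B \<omega>)) C"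
      using e[of A, OF mA] e[of B, OF mB] eq[OF T(1)] by (simp only:)
  qed (use EP sg in \<open>auto simp: emeasure_distr\<close>)
  then have "integral\<^sup>L (distr M (count_space (Pow Z)) (\<lambda>\<omega>. Z \<inter> A \<omega>)) f = integral\<^sup>L (distr M (count_space (Pow Z)) (\<lambda>\<omega>. Z \<inter> B \<omega>)) f" by simp
  then show "expectation (\<lambda>\<omega>. f (Z \<inter> A \<omega>)) = expectation (\<lambda>\<omega>. f (Z \<inter> B \<omega>))"
    by (subst (asm) (1 2) integral_distr) auto
qed

text \<open>\<open>joint\<close> makes sections measurable and Fubini applicable;
  \<open>modulus\<close> says that nearby points rarely disagree, so dyadic sampling recovers the
  set.\<close>

locale random_field = local_weight w + prob_space \<Omega>
  for w :: "'a::euclidean_space \<Rightarrow> real" and \<Omega> :: "'w measure" +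
  fixes X :: "'w \<Rightarrow> 'a set" and K :: real
  assumes joint: "{p\<in>space (\<Omega> \<Otimes>\<^sub>M borel). snd p \<in> X (fst p)} \<in> sets (\<Omega> \<Otimes>\<^sub>M (borel :: 'a measure))"
    and modulus: "prob {\<omega>\<in>space \<Omega>. (x \<in> X \<omega>) \<noteq> (y \<in> X \<omega>)} \<le> K * norm (x - y)"
    and K_nonneg: "0 \<le> K"
begin

lemma pred_X [measurable]:
  assumes [measurable]: "f \<in> N \<rightarrow>\<^sub>M \<Omega>" "g \<in> N \<rightarrow>\<^sub>M (borel :: 'a measure)"
  shows "Measurable.pred N (\<lambda>p. g p \<in> X (f p))"
proof -
  have "(\<lambda>p. (f p, g p)) \<in> N \<rightarrow>\<^sub>M (\<Omega> \<Otimes>\<^sub>M borel)" by measurable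
  moreover have "Measurable.pred (\<Omega> \<Otimes>\<^sub>M borel) (\<lambda>p. snd p \<in> X (fst p))"
    using joint by (simp add: pred_def)
  ultimately have "Measurable.pred N (\<lambda>p. snd (f p, g p) \<in> X (fst (f p, g p)))"
    by (rule measurable_compose)
  then show ?thesis by simp
qed

lemma X_borel: "\<omega> \<in> space \<Omega> \<Longrightarrow> X \<omega> \<in> sets borel"
  using pred_X[of "\<lambda>_. \<omega>" borel "\<lambda>x. x"] by (simp add: pred_def)

lemma X_lebesgue: "\<omega> \<in> space \<Omega> \<Longrightarrow> X \<omega> \<in> sets lebesgue"
  using X_borel[of \<omega>] by (simp add: sets_completionI_sets)

lemma event_X: "{\<omega>\<in>space \<Omega>. x \<in> X \<omega>} \<in> events"
  using pred_X[of "\<lambda>\<omega>. \<omega>" \<Omega> "\<lambda>_. x"] by (simp add: pred_def)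

text \<open>The truncation makes the sampled trace take finitely many values; it grows with
  \<open>k\<close> so that the rounding of every point is eventually a node.\<close>

definition node :: "nat \<Rightarrow> 'a set" where
  "node k = {z \<in> dyadic_lattice k. \<forall>b\<in>Basis. \<bar>z \<bullet> b\<bar> \<le> real k}"

text \<open>The union of the half-open dyadic cells whose lower corners lie in \<open>s\<close>: the
  set reconstructed from samples.\<close>

definition round_set :: "nat \<Rightarrow> 'a set \<Rightarrow> 'a set" where
  "round_set k s = {x. dyadic_floor k x \<in> s}"

definition mismatch :: "nat \<Rightarrow> 'w \<Rightarrow> 'a set" where
  "mismatch k \<omega> = {x. (x \<in> X \<omega>) \<noteq> (dyadic_floor k x \<in> X \<omega>)}"

text \<open>A Borel-Cantelli condition: summability can be checked in expectation, and it forces the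
  weighted mismatch to vanish along the whole sequence for each such
  \<open>\<omega>\<close>.\<close>

definition good :: "'w set" where
  "good = {\<omega>\<in>space \<Omega>. (\<Sum>k. \<integral>\<^sup>+x. ennreal (w x) * indicator (mismatch k \<omega>) x \<partial>lborel) < \<infinity>}"

lemma finite_node: "finite (node k)"
  unfolding node_def by (rule finite_dyadic_lattice_bounded)

lemma round_set_borel: "s \<subseteq> node k \<Longrightarrow> round_set k s \<in> sets borel"
proof -
  assume "s \<subseteq> node k"
  then have "finite s" using finite_node finite_subset by blast
  then have "dyadic_floor k -` s \<inter> space borel \<in> sets (borel :: 'a measure)"
    by (intro measurable_sets[OF measurable_dyadic_floor] borel_closed finite_imp_closed)
  then show ?thesis by (simp add: round_set_def vimage_def)
qed

lemma round_set_lebesgue: "s \<subseteq> node k \<Longrightarrow> round_set k s \<in> sets lebesgue"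
  using round_set_borel by (simp add: sets_completionI_sets)

lemma mismatch_borel: "\<omega> \<in> space \<Omega> \<Longrightarrow> mismatch k \<omega> \<in> sets borel"
proof -
  assume [measurable]: "\<omega> \<in> space \<Omega>"
  have "Measurable.pred borel (\<lambda>x. (x \<in> X \<omega>) \<noteq> (dyadic_floor k x \<in> X \<omega>))" by measurable
  then show ?thesis by (simp add: pred_def mismatch_def)
qed

lemma mismatch_joint [measurable]:
  "(\<lambda>p. indicator (mismatch k (fst p)) (snd p) :: ennreal) \<in> borel_measurable (\<Omega> \<Otimes>\<^sub>M borel)"
proof -
  have "(\<lambda>p. indicator (mismatch k (fst p)) (snd p) :: ennreal) = (\<lambda>p. if (snd p \<in> X (fst p)) \<noteq> (dyadic_floor k (snd p) \<in> X (fst p)) then 1 else 0)"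
    by (auto simp: mismatch_def indicator_def)
  also have "\<dots> \<in> borel_measurable (\<Omega> \<Otimes>\<^sub>M borel)" by measurable
  finally show ?thesis .
qed

lemma mismatch_integral_measurable:
  "(\<lambda>\<omega>. \<integral>\<^sup>+x. ennreal (w x) * indicator (mismatch k \<omega>) x \<partial>lborel) \<in> borel_measurable \<Omega>"
proof -
  have "(\<lambda>(\<omega>, x). ennreal (w x) * indicator (mismatch k \<omega>) x) \<in> borel_measurable (\<Omega> \<Otimes>\<^sub>M lborel)"
    using mismatch_joint[of k] by (simp add: case_prod_beta)
  then show ?thesis by (rule sigma_finite_measure.borel_measurable_nn_integral[OF sigma_finite_lborel])
qed

lemma good_event: "good \<in> events"
  unfolding good_def using mismatch_integral_measurable by measurable

text \<open>By Fubini and \<open>modulus\<close>, the expected weighted mismatch at level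
  \<open>k\<close> is at most the dimension times \<open>K\<close> times the total weight, divided
  by \<open>2 ^ k\<close>. The sum over \<open>k\<close> has finite expectation and is therefore
  finite almost surely.\<close>

lemma AE_good: "AE \<omega> in \<Omega>. \<omega> \<in> good"
proof -
  interpret P: pair_sigma_finite \<Omega> "lborel :: 'a measure" ..
  define d :: real where "d = DIM('a)"
  define W where "W = (\<integral>x. w x \<partial>lborel)"
  have W0: "0 \<le> W" unfolding W_def by (intro integral_nonneg_AE AE_I2) (rule w_nonneg)
  let ?E = "\<lambda>k \<omega>. \<integral>\<^sup>+x. ennreal (w x) * indicator (mismatch k \<omega>) x \<partial>lborel"
  have E: "(\<integral>\<^sup>+\<omega>. ?E k \<omega> \<partial>\<Omega>) \<le> ennreal (K * d * W * (1 / 2) ^ k)" for k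
  proof -
    have "(\<integral>\<^sup>+\<omega>. ?E k \<omega> \<partial>\<Omega>) = (\<integral>\<^sup>+x. (\<integral>\<^sup>+\<omega>. ennreal (w x) * indicator (mismatch k \<omega>) x \<partial>\<Omega>) \<partial>lborel)"
      using mismatch_joint[of k] by (intro P.Fubini'[symmetric]) (simp add: case_prod_beta)
    also have "\<dots> \<le> (\<integral>\<^sup>+x. ennreal (w x) * ennreal (K * (d / 2 ^ k)) \<partial>lborel)"
    proof (rule nn_integral_mono)
      fix x :: 'a
      have mm: "{\<omega>\<in>space \<Omega>. (x \<in> X \<omega>) \<noteq> (dyadic_floor k x \<in> X \<omega>)} \<in> events"
      proof -
        have "Measurable.pred \<Omega> (\<lambda>\<omega>. (x \<in> X \<omega>) \<noteq> (dyadic_floor k x \<in> X \<omega>))" by measurable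
        then show ?thesis by (simp add: pred_def)
      qed
      have "(\<integral>\<^sup>+\<omega>. ennreal (w x) * indicator (mismatch k \<omega>) x \<partial>\<Omega>)
        = (\<integral>\<^sup>+\<omega>. ennreal (w x) * indicator {\<omega>\<in>space \<Omega>. (x \<in> X \<omega>) \<noteq> (dyadic_floor k x \<in> X \<omega>)} \<omega> \<partial>\<Omega>)"
        by (intro nn_integral_cong) (auto simp: mismatch_def indicator_def)
      also have "\<dots> = ennreal (w x) * ennreal (prob {\<omega>\<in>space \<Omega>. (x \<in> X \<omega>) \<noteq> (dyadic_floor k x \<in> X \<omega>)})"
        using mm by (simp add: nn_integral_cmult_indicator emeasure_eq_measure)
      also have "\<dots> \<le> ennreal (w x) * ennreal (K * (d / 2 ^ k))"
      proof (intro mult_left_mono ennreal_leI)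
        have "prob {\<omega>\<in>space \<Omega>. (x \<in> X \<omega>) \<noteq> (dyadic_floor k x \<in> X \<omega>)} \<le> K * norm (x - dyadic_floor k x)"
          by (rule modulus)
        also have "\<dots> \<le> K * (d / 2 ^ k)"
          unfolding d_def by (intro mult_left_mono norm_diff_dyadic_floor K_nonneg)
        finally show "prob {\<omega>\<in>space \<Omega>. (x \<in> X \<omega>) \<noteq> (dyadic_floor k x \<in> X \<omega>)} \<le> K * (d / 2 ^ k)" .
      qed simp
      finally show "(\<integral>\<^sup>+\<omega>. ennreal (w x) * indicator (mismatch k \<omega>) x \<partial>\<Omega>) \<le> ennreal (w x) * ennreal (K * (d / 2 ^ k))" .
    qed
    also have "\<dots> = (\<integral>\<^sup>+x. ennreal (w x) \<partial>lborel) * ennreal (K * (d / 2 ^ k))"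
      by (rule nn_integral_multc) measurable
    also have "(\<integral>\<^sup>+x. ennreal (w x) \<partial>lborel) = ennreal W"
      unfolding W_def using w_integrable by (intro nn_integral_eq_integral) (auto simp: w_nonneg)
    also have "ennreal W * ennreal (K * (d / 2 ^ k)) = ennreal (K * d * W * (1 / 2) ^ k)"
      using W0 K_nonneg by (subst ennreal_mult[symmetric]) (auto simp: d_def power_divide mult_ac)
    finally show ?thesis .
  qed
  have "(\<integral>\<^sup>+\<omega>. (\<Sum>k. ?E k \<omega>) \<partial>\<Omega>) = (\<Sum>k. \<integral>\<^sup>+\<omega>. ?E k \<omega> \<partial>\<Omega>)"
    by (rule nn_integral_suminf[OF mismatch_integral_measurable])
  also have "\<dots> \<le> (\<Sum>k. ennreal (K * d * W * (1 / 2) ^ k))"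
    by (intro suminf_le E summableI)
  also have "\<dots> = ennreal (\<Sum>k. K * d * W * (1 / 2) ^ k)"
    using W0 K_nonneg by (intro suminf_ennreal2 summable_mult summable_geometric) (auto simp: d_def)
  also have "\<dots> < \<infinity>" by simp
  finally have "AE \<omega> in \<Omega>. (\<Sum>k. ?E k \<omega>) \<noteq> \<infinity>"
    using mismatch_integral_measurable by (intro nn_integral_noteq_infinite borel_measurable_suminf_order) auto
  then show ?thesis using AE_space by eventually_elim (auto simp: good_def less_top)
qed

text \<open>The reconstruction differs from \<open>X \<omega>\<close> only on the mismatch set and
  on cells beyond the truncation. The former is controlled by \<open>good\<close>, the latter by
  dominated convergence for the weight.\<close>

lemma good_imp_approx:
  assumes \<omega>: "\<omega> \<in> good"
  shows "(\<lambda>k. wdist (round_set k (node k \<inter> X \<omega>)) (X \<omega>)) \<longlonglongrightarrow> 0"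
proof -
  have w: "\<omega> \<in> space \<Omega>" using \<omega> by (simp add: good_def)
  have mL: "mismatch k \<omega> \<in> sets lebesgue" for k using mismatch_borel[OF w] by (simp add: sets_completionI_sets)
  have "(\<Sum>k. ennreal (wmeas (mismatch k \<omega>))) \<noteq> top"
  proof -
    have "ennreal (wmeas (mismatch k \<omega>)) = (\<integral>\<^sup>+x. ennreal (w x) * indicator (mismatch k \<omega>) x \<partial>lborel)" for k
    proof -
      have "ennreal (wmeas (mismatch k \<omega>)) = (\<integral>\<^sup>+x. ennreal (indicator (mismatch k \<omega>) x * w x) \<partial>lebesgue)"
        unfolding wmeas_def by (intro nn_integral_eq_integral[symmetric] integrable_wmeas mL) (simp add: w_nonneg)
      also have "\<dots> = (\<integral>\<^sup>+x. ennreal (indicator (mismatch k \<omega>) x * w x) \<partial>lborel)"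
        by (rule nn_integral_completion)
      also have "\<dots> = (\<integral>\<^sup>+x. ennreal (w x) * indicator (mismatch k \<omega>) x \<partial>lborel)"
        by (intro nn_integral_cong) (auto simp: indicator_def)
      finally show ?thesis .
    qed
    then show ?thesis using \<omega> by (auto simp: good_def less_top)
  qed
  then have "summable (\<lambda>k. wmeas (mismatch k \<omega>))" by (intro summable_suminf_not_top wmeas_nonneg)
  then have l1: "(\<lambda>k. wmeas (mismatch k \<omega>)) \<longlonglongrightarrow> 0" by (rule summable_LIMSEQ_zero)
  have tL: "{x. dyadic_floor k x \<notin> node k} \<in> sets lebesgue" for k
  proof -
    have "{x. dyadic_floor k x \<notin> node k} = - round_set k (node k)" by (auto simp: round_set_def)
    then show ?thesis using round_set_lebesgue[of "node k" k] by (simp add: Compl_in_sets_lebesgue)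
  qed
  have "(\<lambda>k. wmeas {x. dyadic_floor k x \<notin> node k}) \<longlonglongrightarrow> (\<integral>x. 0 \<partial>(lebesgue :: 'a measure))"
    unfolding wmeas_def
  proof (rule integral_dominated_convergence[where w=w])
    show "AE x in lebesgue. (\<lambda>k. indicator {x. dyadic_floor k x \<notin> node k} x * w x) \<longlonglongrightarrow> 0"
    proof (intro AE_I2 tendsto_eventually)
      fix x :: 'a
      \<comment> \<open>Rounding moves a point by at most the dimension, so from level
        \<open>N\<close> on the rounded coordinates stay within the truncation.\<close>
      obtain N where N: "norm x + DIM('a) \<le> real N" using real_arch_simple by blast
      have "dyadic_floor k x \<in> node k" if "k \<ge> N" for k
        unfolding node_def
      proof (intro CollectI conjI ballI dyadic_floor_in_lattice)
        fix b :: 'a assume "b \<in> Basis"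
        then have "\<bar>dyadic_floor k x \<bullet> b\<bar> \<le> norm (dyadic_floor k x)" by (rule Basis_le_norm)
        also have "\<dots> \<le> norm x + norm (x - dyadic_floor k x)"
          using norm_triangle_ineq4[of x "x - dyadic_floor k x"] by simp
        also have "norm (x - dyadic_floor k x) \<le> DIM('a)"
          by (rule order_trans[OF norm_diff_dyadic_floor]) (simp add: divide_le_eq_1 field_simps)
        also have "norm x + DIM('a) \<le> real k" using N that by linarith
        finally show "\<bar>dyadic_floor k x \<bullet> b\<bar> \<le> real k" by simp
      qed
      then show "eventually (\<lambda>k. indicator {x. dyadic_floor k x \<notin> node k} x * w x = 0) sequentially"
        unfolding eventually_sequentially by (intro exI[of _ N]) (simp add: indicator_def)
    qed
    show "(\<lambda>x. indicator {x. dyadic_floor k x \<notin> node k} x * w x) \<in> borel_measurable lebesgue" for k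
      by (rule borel_measurable_integrable[OF integrable_wmeas[OF tL]])
    show "AE x in lebesgue. norm (indicator {x. dyadic_floor k x \<notin> node k} x * w x) \<le> w x" for k
      by (intro AE_I2) (auto simp: indicator_def w_nonneg)
  qed (auto intro: w_integrable_lebesgue)
  then have l2: "(\<lambda>k. wmeas {x. dyadic_floor k x \<notin> node k}) \<longlonglongrightarrow> 0" by simp
  show ?thesis
  proof (rule LIMSEQ_norm_diff_bound)
    show "(\<lambda>k. wmeas (mismatch k \<omega>) + wmeas {x. dyadic_floor k x \<notin> node k}) \<longlonglongrightarrow> 0"
      using tendsto_add[OF l1 l2] by simp
    fix k
    have "wdist (round_set k (node k \<inter> X \<omega>)) (X \<omega>) \<le> wmeas (mismatch k \<omega> \<union> {x. dyadic_floor k x \<notin> node k})"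
      unfolding wdist_def using mL tL X_lebesgue[OF w] round_set_lebesgue[of "node k \<inter> X \<omega>" k]
      by (intro wmeas_mono) (auto simp: mismatch_def round_set_def)
    also have "\<dots> \<le> wmeas (mismatch k \<omega>) + wmeas {x. dyadic_floor k x \<notin> node k}"
      by (rule wmeas_Un_le[OF mL tL])
    finally show "norm (wdist (round_set k (node k \<inter> X \<omega>)) (X \<omega>) - 0) \<le> wmeas (mismatch k \<omega>) + wmeas {x. dyadic_floor k x \<notin> node k}"
      by (simp add: wdist_nonneg)
  qed
qed

text \<open>Off the almost sure event \<open>good\<close> the dyadic samplings need not converge, and measurability into
  \<open>rams_space\<close> could fail; there the set is replaced by a constant.\<close>
definition Xg :: "'w \<Rightarrow> 'a set" where
  "Xg \<omega> = (if \<omega> \<in> good then X \<omega> else {})"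

lemma Xg_lebesgue: "Xg \<omega> \<in> sets lebesgue"
  using X_lebesgue[of \<omega>] by (auto simp: Xg_def good_def)

text \<open>\<open>f\<close> may be arbitrary because the sampled trace takes values in a finite
  discrete space.\<close>

lemma measurable_round:
  "(\<lambda>\<omega>. f (round_set k (node k \<inter> X \<omega>)) :: real) \<in> borel_measurable \<Omega>"
proof -
  have "(\<lambda>\<omega>. node k \<inter> X \<omega>) \<in> \<Omega> \<rightarrow>\<^sub>M count_space (Pow (node k))"
    by (rule expectation_trace_eq(1)[OF finite_node event_X event_X refl])
  then show ?thesis by (rule measurable_compose) simp
qed

text \<open>Hitting an open \<open>U\<close> means positivity of \<open>wgap U\<close>, and on
  \<open>good\<close> this gap is the limit of the gaps of the reconstructions, which are
  measurable. Measurability into the space of sets is thus reduced to real functions of finite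
  traces.\<close>

lemma measurable_Xg: "Xg \<in> \<Omega> \<rightarrow>\<^sub>M rams_space"
  unfolding rams_space_def
proof (rule measurable_measure_of)
  show "{\<U> :: 'a set set. rams_open \<U>} \<subseteq> Pow (sets lebesgue)" by (auto simp: rams_open_def)
  show "Xg \<in> space \<Omega> \<rightarrow> sets lebesgue" using Xg_lebesgue by auto
  fix U :: "'a set set" assume "U \<in> {\<U>. rams_open \<U>}"
  then have U: "rams_open U" by simp
  show "Xg -` U \<inter> space \<Omega> \<in> events"
  proof (cases "sets lebesgue - U = {}")
    case True
    then have "Xg -` U \<inter> space \<Omega> = space \<Omega>" using Xg_lebesgue by auto
    then show ?thesis by simp
  next
    case False
    have "(\<lambda>\<omega>. indicator good \<omega> * wgap U (X \<omega>)) \<in> borel_measurable \<Omega>"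
    proof (rule borel_measurable_LIMSEQ_real)
      show "(\<lambda>k. indicator good \<omega> * wgap U (round_set k (node k \<inter> X \<omega>))) \<longlonglongrightarrow> indicator good \<omega> * wgap U (X \<omega>)"
        if w: "\<omega> \<in> space \<Omega>" for \<omega>
      proof (cases "\<omega> \<in> good")
        case True
        have "(\<lambda>k. wgap U (round_set k (node k \<inter> X \<omega>))) \<longlonglongrightarrow> wgap U (X \<omega>)"
          by (rule wlip_tendsto[OF wlip_wgap[OF False] round_set_lebesgue X_lebesgue[OF w] good_imp_approx[OF True]]) auto
        then show ?thesis using True by simp
      qed simp
      show "(\<lambda>\<omega>. indicator good \<omega> * wgap U (round_set k (node k \<inter> X \<omega>))) \<in> borel_measurable \<Omega>" for k
        using good_event by (intro borel_measurable_times measurable_round) simp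
    qed
    then have "{\<omega>\<in>space \<Omega>. 0 < indicator good \<omega> * wgap U (X \<omega>)} \<in> events" by measurable
    moreover have "{\<omega>\<in>space \<Omega>. 0 < indicator good \<omega> * wgap U (X \<omega>)} = {\<omega>\<in>good. X \<omega> \<in> U}"
      using wgap_pos_iff[OF U False X_lebesgue] by (auto simp: good_def indicator_def)
    ultimately have g: "{\<omega>\<in>good. X \<omega> \<in> U} \<in> events" by simp
    have "Xg -` U \<inter> space \<Omega> = {\<omega>\<in>good. X \<omega> \<in> U} \<union> (if {} \<in> U then space \<Omega> - good else {})"
      using sets.sets_into_space[OF good_event] by (auto simp: Xg_def split: if_splits)
    then show ?thesis using g good_event by auto
  qed
qed

text \<open>With \<open>rams_measure_eqI\<close> this shows that the law of \<open>Xg\<close>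
  depends only on the laws of the finite traces.\<close>

lemma expectation_Xg_limit:
  assumes F: "wlip L F" and b: "\<And>A. 0 \<le> F A \<and> F A \<le> 1"
  shows "(\<lambda>k. expectation (\<lambda>\<omega>. F (round_set k (node k \<inter> X \<omega>)))) \<longlonglongrightarrow> expectation (\<lambda>\<omega>. F (Xg \<omega>))"
proof (rule integral_dominated_convergence[where w="\<lambda>_. 1"])
  show "(\<lambda>\<omega>. F (Xg \<omega>)) \<in> borel_measurable \<Omega>"
    by (rule measurable_compose[OF measurable_Xg borel_measurable_wlip[OF F]])
  show "(\<lambda>\<omega>. F (round_set k (node k \<inter> X \<omega>))) \<in> borel_measurable \<Omega>" for k by (rule measurable_round)
  show "AE \<omega> in \<Omega>. (\<lambda>k. F (round_set k (node k \<inter> X \<omega>))) \<longlonglongrightarrow> F (Xg \<omega>)"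
    using AE_good
  proof eventually_elim
    fix \<omega> assume g: "\<omega> \<in> good"
    then have w: "\<omega> \<in> space \<Omega>" by (simp add: good_def)
    have "(\<lambda>k. F (round_set k (node k \<inter> X \<omega>))) \<longlonglongrightarrow> F (X \<omega>)"
      by (rule wlip_tendsto[OF F round_set_lebesgue X_lebesgue[OF w] good_imp_approx[OF g]]) auto
    then show "(\<lambda>k. F (round_set k (node k \<inter> X \<omega>))) \<longlonglongrightarrow> F (Xg \<omega>)" using g by (simp add: Xg_def)
  qed
qed (use b in auto)

text \<open>Fubini integrates the pair probability, which by assumption is the same at every point,
  over the window. Only here do point probabilities become mean volumes.\<close>

lemma expectation_window:
  assumes B: "B \<in> sets borel" "bounded B"
    and two: "\<And>x. prob {\<omega>\<in>space \<Omega>. x \<in> X \<omega> \<and> x - y \<in> X \<omega>} = s"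
  shows "expectation (\<lambda>\<omega>. measure lebesgue (Xg \<omega> \<inter> transl y (Xg \<omega>) \<inter> B)) = s * measure lebesgue B"
proof -
  interpret P: pair_sigma_finite \<Omega> "lborel :: 'a measure" ..
  note [measurable] = B(1)
  have BL: "B \<in> lmeasurable" using B by (intro bounded_set_imp_lmeasurable) auto
  have s0: "0 \<le> s" using two[of 0] measure_nonneg by metis
  have "(\<integral>\<^sup>+\<omega>. ennreal (measure lebesgue (Xg \<omega> \<inter> transl y (Xg \<omega>) \<inter> B)) \<partial>\<Omega>)
     = (\<integral>\<^sup>+\<omega>. (\<integral>\<^sup>+x. (if x \<in> X \<omega> \<and> x - y \<in> X \<omega> then indicator B x else 0) \<partial>lborel) \<partial>\<Omega>)"
    using AE_good
  proof (intro nn_integral_cong_AE, eventually_elim)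
    fix \<omega> assume g: "\<omega> \<in> good"
    then have w: "\<omega> \<in> space \<Omega>" by (simp add: good_def)
    have bS: "X \<omega> \<inter> transl y (X \<omega>) \<inter> B \<in> sets borel"
    proof -
      have "transl y (X \<omega>) \<in> sets borel"
        using measurable_sets[of "\<lambda>x. x - y" borel borel "X \<omega>"] X_borel[OF w] by (simp add: transl_vimage)
      then show ?thesis using X_borel[OF w] B by auto
    qed
    have "X \<omega> \<inter> transl y (X \<omega>) \<inter> B \<in> lmeasurable"
      using bS B by (intro bounded_set_imp_lmeasurable) (auto simp: bounded_Int)
    then have "ennreal (measure lebesgue (X \<omega> \<inter> transl y (X \<omega>) \<inter> B)) = emeasure lebesgue (X \<omega> \<inter> transl y (X \<omega>) \<inter> B)"
      by (rule emeasure_eq_measure2[symmetric])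
    also have "\<dots> = emeasure lborel (X \<omega> \<inter> transl y (X \<omega>) \<inter> B)" using bS by simp
    also have "\<dots> = (\<integral>\<^sup>+x. indicator (X \<omega> \<inter> transl y (X \<omega>) \<inter> B) x \<partial>lborel)" using bS by simp
    also have "\<dots> = (\<integral>\<^sup>+x. (if x \<in> X \<omega> \<and> x - y \<in> X \<omega> then indicator B x else 0) \<partial>lborel)"
      by (intro nn_integral_cong) (auto simp: indicator_def transl_iff)
    finally show "ennreal (measure lebesgue (Xg \<omega> \<inter> transl y (Xg \<omega>) \<inter> B))
        = (\<integral>\<^sup>+x. (if x \<in> X \<omega> \<and> x - y \<in> X \<omega> then indicator B x else 0) \<partial>lborel)"
      using g by (simp add: Xg_def)
  qed
  also have "\<dots> = (\<integral>\<^sup>+x. (\<integral>\<^sup>+\<omega>. (if x \<in> X \<omega> \<and> x - y \<in> X \<omega> then indicator B x else 0) \<partial>\<Omega>) \<partial>lborel)"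
    by (intro P.Fubini'[symmetric]) (simp add: case_prod_beta)
  also have "\<dots> = (\<integral>\<^sup>+x. ennreal s * indicator B x \<partial>lborel)"
  proof (intro nn_integral_cong)
    fix x
    have m: "{\<omega>\<in>space \<Omega>. x \<in> X \<omega> \<and> x - y \<in> X \<omega>} \<in> events" by (intro sets.sets_Collect_conj event_X)
    have "(\<integral>\<^sup>+\<omega>. (if x \<in> X \<omega> \<and> x - y \<in> X \<omega> then indicator B x else 0) \<partial>\<Omega>)
       = (\<integral>\<^sup>+\<omega>. indicator B x * indicator {\<omega>\<in>space \<Omega>. x \<in> X \<omega> \<and> x - y \<in> X \<omega>} \<omega> \<partial>\<Omega>)"
      by (intro nn_integral_cong) (auto simp: indicator_def)
    also have "\<dots> = indicator B x * ennreal s"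
      using m by (simp add: nn_integral_cmult_indicator emeasure_eq_measure two)
    finally show "(\<integral>\<^sup>+\<omega>. (if x \<in> X \<omega> \<and> x - y \<in> X \<omega> then indicator B x else 0) \<partial>\<Omega>) = ennreal s * indicator B x"
      by (simp add: mult.commute)
  qed
  also have "\<dots> = ennreal s * emeasure lborel B" by (rule nn_integral_cmult_indicator) simp
  also have "emeasure lborel B = emeasure lebesgue B" using B by simp
  also have "\<dots> = ennreal (measure lebesgue B)" using BL by (rule emeasure_eq_measure2)
  finally have "(\<integral>\<^sup>+\<omega>. ennreal (measure lebesgue (Xg \<omega> \<inter> transl y (Xg \<omega>) \<inter> B)) \<partial>\<Omega>) = ennreal (s * measure lebesgue B)"
    using s0 by (simp add: ennreal_mult)
  then show ?thesis
    using s0 B by (intro nn_integral_eq_integrable[THEN iffD1, THEN conjunct2] measurable_compose[OF measurable_Xg borel_measurable_delta]) auto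
qed

end

section \<open>Realizability\<close>

context random_field
begin

text \<open>A translate of the field is again a \<open>random_field\<close> with the same modulus,
  and its finite traces have the same laws. Equality of the laws of the sets follows from
  \<open>expectation_Xg_limit\<close>. The result is stated for the law of \<open>Xg\<close> with
  \<open>id\<close>, so that the sample space consists of sets.\<close>

lemma stationary_rams_Xg:
  assumes shift: "\<And>F y. finite F \<Longrightarrow>
    prob {\<omega>\<in>space \<Omega>. \<forall>x\<in>F. x + y \<in> X \<omega>} = prob {\<omega>\<in>space \<Omega>. \<forall>x\<in>F. x \<in> X \<omega>}"
  shows "stationary_rams (distr \<Omega> rams_space Xg) id"
proof -
  let ?N = "distr \<Omega> rams_space Xg"
  note [measurable] = measurable_Xg
  have eq: "distr \<Omega> rams_space (\<lambda>\<omega>. transl y (Xg \<omega>)) = ?N" for y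
  proof -
    interpret Y: random_field w \<Omega> "\<lambda>\<omega>. transl y (X \<omega>)" K
    proof
      have "Measurable.pred (\<Omega> \<Otimes>\<^sub>M borel) (\<lambda>p. snd p - y \<in> X (fst p))" by measurable
      then show "{p\<in>space (\<Omega> \<Otimes>\<^sub>M borel). snd p \<in> transl y (X (fst p))} \<in> sets (\<Omega> \<Otimes>\<^sub>M borel)"
        by (simp add: pred_def transl_iff)
      show "prob {\<omega>\<in>space \<Omega>. (x \<in> transl y (X \<omega>)) \<noteq> (x' \<in> transl y (X \<omega>))} \<le> K * norm (x - x')" for x x'
        using modulus[of "x - y" "x' - y"] by (simp add: transl_iff)
    qed (rule K_nonneg)
    have tm: "(\<lambda>\<omega>. transl y (Xg \<omega>)) \<in> \<Omega> \<rightarrow>\<^sub>M rams_space"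
      by (rule measurable_compose[OF measurable_Xg measurable_transl_rams])
    show ?thesis
    proof (rule rams_measure_eqI)
      show "prob_space (distr \<Omega> rams_space (\<lambda>\<omega>. transl y (Xg \<omega>)))" by (rule prob_space_distr[OF tm])
      show "prob_space ?N" by (rule prob_space_distr[OF measurable_Xg])
      fix L F assume F: "wlip L F" and b: "\<And>A. 0 \<le> F A \<and> F A \<le> 1"
      have Fm: "F \<in> borel_measurable rams_space" by (rule borel_measurable_wlip[OF F])
      \<comment> \<open>The good event of the translated field may differ from the original one;
        both have probability one, so the two modifications agree almost surely.\<close>
      have "expectation (\<lambda>\<omega>. F (transl y (Xg \<omega>))) = expectation (\<lambda>\<omega>. F (Y.Xg \<omega>))"
      proof (rule integral_cong_AE)
        show "(\<lambda>\<omega>. F (transl y (Xg \<omega>))) \<in> borel_measurable \<Omega>" by (rule measurable_compose[OF tm Fm])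
        show "(\<lambda>\<omega>. F (Y.Xg \<omega>)) \<in> borel_measurable \<Omega>" by (rule measurable_compose[OF Y.measurable_Xg Fm])
        show "AE \<omega> in \<Omega>. F (transl y (Xg \<omega>)) = F (Y.Xg \<omega>)"
          using AE_good Y.AE_good by eventually_elim (simp add: Xg_def Y.Xg_def)
      qed
      moreover have "expectation (\<lambda>\<omega>. F (round_set k (node k \<inter> transl y (X \<omega>)))) = expectation (\<lambda>\<omega>. F (round_set k (node k \<inter> X \<omega>)))" for k
      proof (rule expectation_trace_eq(2)[OF finite_node Y.event_X event_X])
        fix T assume "T \<subseteq> node k"
        then have "finite T" using finite_node finite_subset by blast
        from shift[OF this, of "- y"]
        show "prob {\<omega>\<in>space \<Omega>. \<forall>z\<in>T. z \<in> transl y (X \<omega>)} = prob {\<omega>\<in>space \<Omega>. \<forall>z\<in>T. z \<in> X \<omega>}"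
          by (simp add: transl_iff)
      qed
      ultimately have "expectation (\<lambda>\<omega>. F (transl y (Xg \<omega>))) = expectation (\<lambda>\<omega>. F (Xg \<omega>))"
        using Y.expectation_Xg_limit[OF F b] expectation_Xg_limit[OF F b] LIMSEQ_unique by simp
      then show "(\<integral>A. F A \<partial>distr \<Omega> rams_space (\<lambda>\<omega>. transl y (Xg \<omega>))) = (\<integral>A. F A \<partial>?N)"
        using Fm tm by (simp add: integral_distr)
    qed auto
  qed
  have "distr ?N rams_space (\<lambda>A. transl y (id A)) = distr ?N rams_space id" for y
  proof -
    have "distr ?N rams_space (transl y) = distr \<Omega> rams_space (transl y \<circ> Xg)"
      by (rule distr_distr[OF measurable_transl_rams measurable_Xg])
    also have "\<dots> = ?N" using eq[of y] by (simp add: comp_def)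
    also have "\<dots> = distr ?N rams_space id"
      by (subst distr_distr) (auto simp: id_def comp_def)
    finally show ?thesis by simp
  qed
  moreover have "prob_space ?N" by (rule prob_space_distr[OF measurable_Xg])
  moreover have "id \<in> ?N \<rightarrow>\<^sub>M rams_space" by (simp add: id_def)
  ultimately show ?thesis by (simp add: stationary_rams_def)
qed

lemma spec_cov_Xg:
  assumes "\<And>x. prob {\<omega>\<in>space \<Omega>. x \<in> X \<omega> \<and> x - y \<in> X \<omega>} = s"
  shows "spec_cov (distr \<Omega> rams_space Xg) id y = s"
proof -
  have "spec_cov (distr \<Omega> rams_space Xg) id y = expectation (\<lambda>\<omega>. measure lebesgue (Xg \<omega> \<inter> transl y (Xg \<omega>) \<inter> box 0 One))"
    unfolding spec_cov_def id_apply by (intro integral_distr measurable_Xg borel_measurable_delta) auto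
  also have "\<dots> = s * measure lebesgue (box 0 (One :: 'a))" by (rule expectation_window[OF _ _ assms]) auto
  finally show ?thesis by simp
qed

end

text \<open>The field has modulus \<open>2 * C\<close>, since the points of a pair disagree with
  probability \<open>2 * (S2 0 - S2 (x - y))\<close>. Passing to the law of \<open>F.Xg\<close>
  supplies the sample space of type \<open>'a set\<close> named in the conclusion.\<close>

lemma realizable_if_admissible:
  fixes S2 :: "'a::euclidean_space \<Rightarrow> real"
  assumes adm: "admissible_S2 S2" and lip: "\<And>j. j \<in> Basis \<Longrightarrow> Lip_dir S2 0 j < \<infinity>"
  shows "\<exists>(M :: 'a set measure) X. stationary_rams M X \<and> (\<forall>y. S2 y = spec_cov M X y) \<and> spec_per M X < \<infinity>"
proof -
  obtain C where C: "0 \<le> C" "\<And>x y. \<bar>S2 x - S2 y\<bar> \<le> C * norm (x - y)"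
    using admissible_Lip_imp_Lipschitz[OF adm lip] by blast
  obtain \<Omega> :: "real measure" and X where \<Omega>: "prob_space \<Omega>"
    and joint: "{p\<in>space (\<Omega> \<Otimes>\<^sub>M borel). snd p \<in> X (fst p)} \<in> sets (\<Omega> \<Otimes>\<^sub>M (borel :: 'a measure))"
    and two': "\<forall>x x'. measure \<Omega> {\<omega>\<in>space \<Omega>. x \<in> X \<omega> \<and> x' \<in> X \<omega>} = S2 (x - x')"
    and shift': "\<forall>F y. finite F \<longrightarrow>
      measure \<Omega> {\<omega>\<in>space \<Omega>. \<forall>x\<in>F. x + y \<in> X \<omega>} = measure \<Omega> {\<omega>\<in>space \<Omega>. \<forall>x\<in>F. x \<in> X \<omega>}"
    using measurable_field_exists[OF adm C] by (elim exE conjE)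
  note two = two'[rule_format] and shift = shift'[rule_format]
  interpret prob_space \<Omega> by (rule \<Omega>)
  have ev: "{\<omega>\<in>space \<Omega>. x \<in> X \<omega>} \<in> events" for x
  proof -
    have "(\<lambda>\<omega>. (\<omega>, x)) -` {p\<in>space (\<Omega> \<Otimes>\<^sub>M borel). snd p \<in> X (fst p)} \<inter> space \<Omega> \<in> events"
      by (rule measurable_sets[OF _ joint]) simp
    moreover have "(\<lambda>\<omega>. (\<omega>, x)) -` {p\<in>space (\<Omega> \<Otimes>\<^sub>M borel). snd p \<in> X (fst p)} \<inter> space \<Omega> = {\<omega>\<in>space \<Omega>. x \<in> X \<omega>}"
      by (auto simp: space_pair_measure)
    ultimately show ?thesis by simp
  qed
  obtain w :: "'a \<Rightarrow> real" where w: "local_weight w"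
    using local_weight_exists unfolding local_weight_def by blast
  interpret F: random_field w \<Omega> X "2 * C"
  proof (intro random_field.intro w \<Omega> random_field_axioms.intro joint)
    fix x y
    have "prob {\<omega>\<in>space \<Omega>. (x \<in> X \<omega>) \<noteq> (y \<in> X \<omega>)} \<le> 2 * (S2 0 - S2 (x - y))"
      using prob_neq_le[OF ev ev, of x y] two[of x x] two[of y y] two[of x y] by simp
    also have "S2 0 - S2 (x - y) \<le> C * norm (x - y)" using C(2)[of 0 "x - y"] by (simp add: abs_le_iff norm_minus_commute)
    finally show "prob {\<omega>\<in>space \<Omega>. (x \<in> X \<omega>) \<noteq> (y \<in> X \<omega>)} \<le> 2 * C * norm (x - y)" by simp
  qed (use C in auto)
  let ?M = "distr \<Omega> rams_space F.Xg"
  have st: "stationary_rams ?M id" by (rule F.stationary_rams_Xg[OF shift])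
  have cov: "spec_cov ?M id y = S2 y" for y by (rule F.spec_cov_Xg) (simp add: two)
  have "spec_per ?M id < \<infinity>"
  proof (rule spec_per_finite[OF st C(1)])
    fix j :: 'a and t :: real assume "j \<in> Basis"
    then show "spec_cov ?M id 0 - spec_cov ?M id (t *\<^sub>R j) \<le> C * \<bar>t\<bar>"
      using C(2)[of 0 "t *\<^sub>R j"] by (simp add: cov abs_le_iff)
  qed
  then show ?thesis using st cov by (intro exI[of _ ?M] exI[of _ id]) simp
qed

lemma admissible_if_realizable:
  fixes S2 :: "'a::euclidean_space \<Rightarrow> real" and M :: "'w measure"
  assumes "stationary_rams M X \<and> (\<forall>y. S2 y = spec_cov M X y) \<and> spec_per M X < \<infinity>"
  shows "admissible_S2 S2 \<and> (\<forall>j\<in>Basis. Lip_dir S2 0 j < \<infinity>)"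
  using assms spec_cov_admissible[of M X S2] spec_per_finite_imp_Lip[of M X _ S2] by blast

text \<open>An existential statement cannot range over types of sample spaces. Existence is
  therefore claimed on sets themselves, and the second conjunct states necessity for a sample space
  of any type \<open>'w\<close>.\<close>

theorem theorem1p2:
  fixes S2 :: "'a::euclidean_space \<Rightarrow> real"
  shows "((admissible_S2 S2 \<and> (\<forall>j\<in>Basis. Lip_dir S2 0 j < \<infinity>)) \<longleftrightarrow>
            (\<exists>(M::'a set measure) X. stationary_rams M X \<and> (\<forall>y. S2 y = spec_cov M X y)
               \<and> spec_per M X < \<infinity>))
       \<and> (\<forall>(M::'w measure) X. stationary_rams M X \<and> (\<forall>y. S2 y = spec_cov M X y)
               \<and> spec_per M X < \<infinity>
            \<longrightarrow> admissible_S2 S2 \<and> (\<forall>j\<in>Basis. Lip_dir S2 0 j < \<infinity>))"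
proof (intro conjI allI impI)
  show "(admissible_S2 S2 \<and> (\<forall>j\<in>Basis. Lip_dir S2 0 j < \<infinity>)) \<longleftrightarrow>
    (\<exists>(M::'a set measure) X. stationary_rams M X \<and> (\<forall>y. S2 y = spec_cov M X y) \<and> spec_per M X < \<infinity>)"
    using realizable_if_admissible[of S2] admissible_if_realizable[where 'w="'a set" and ?S2.0=S2] by blast
qed (use admissible_if_realizable[where 'w='w and ?S2.0=S2] in blast)+

end
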